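(* Let $\lhd$ be a random element of $\mathcal{O}$ whose law is $\mathcal{I}$-invariant. Then: (1) Almost surely, for every $n\in\mathbb{Z}$ the limits $$X_n=\lim_{N\to\infty}\frac1N\sum_{k=-N}^{n}1_{(k\lhd n)},\qquad Y_n=\lim_{N\to\infty}\frac1N\sum_{k=n}^{N}1_{(k\lhd n)}$$ exist, and for all integers $m<n$ the relation $m\lhd n$ holds if and only if at least one of the following holds: $X_m<X_n$; or $Y_m<Y_n$; or ($X_m=X_n$, $Y_m=Y_n$ and $X_m>Y_m$). (2) The sequence $(X_n)_{n\in\mathbb{Z}}$ is exchangeable, and with probability one it admits an empirical distribution $\mu(X)$, which is quasi-uniform. (3) Conditionally on $\mu(X)=\mu$, the law of $\lhd$ is $\mathbb{P}^{\mu}$; that is, for every measurable $A\subseteq\mathcal{O}$, the conditional probability that $\lhd\in A$ given $\mu(X)$ equals $\mathbb{P}^{\mu(X)}(A)$ almost surely.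
   Context: **Orderings.** $\mathcal{O}$ is the set of all strict total orderings $\lhd$ of $\mathbb{Z}$, with the measurable structure inherited as a subset of $2^{\mathbb{Z}\times\mathbb{Z}}$ (product $\sigma$-algebra). For a strictly increasing map $f:\mathbb{Z}\to\mathbb{Z}$, the induced map $\hat f:\mathcal{O}\to\mathcal{O}$ sends $\lhd$ to the ordering in which $m$ is less than $n$ if and only if $f(m)\lhd f(n)$. A probability measure $\mathbb{P}$ on $\mathcal{O}$ is $\mathcal{I}$-invariant if $\mathbb{P}\circ\hat f^{-1}=\mathbb{P}$ for all strictly increasing $f:\mathbb{Z}\to\mathbb{Z}$. **Quasi-uniform measures.** A probability measure $\mu$ on $[0,1]$ is quasi-uniform if $\mu\{x\in[0,1]:\mu[0,x)\le x\le\mu[0,x]\}=1$. Every quasi-uniform $\mu$ can be written, uniquely up to the labelling of the intervals, as $\mu=\lambda_F+\sum_i m_i\delta_{x_i}$, where $F\subseteq[0,1]$ is closed with $0,1\in F$, $\lambda_F$ is the measure with density $1_F$ with respect to Lebesgue measure, the sum is over the open components $G_i$ of $[0,1]\setminus F$, $m_i$ is the length of $G_i$, and $x_i$ is either the left or the right endpoint of $G_i$. **Conjugate pairs.** With this decomposition, let $y_i$ be the endpoint of $G_i$ other than $x_i$. A conjugate pair $(X,Y)$ with $X$ distributed according to $\mu$ is a pair of random variables with joint law $\int_F\delta_{(x,x)}\,dx+\sum_i m_i\delta_{(x_i,y_i)}$. So $X$ has law $\mu$, $Y$ has law $\mu'=\lambda_F+\sum_i m_i\delta_{y_i}$, and almost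 surely $X$ and $Y$ are equal or are the two ends of a component of $[0,1]\setminus F$. **The law $\mathbb{P}^\mu$.** For quasi-uniform $\mu$, let $(X_n,Y_n)_{n\in\mathbb{Z}}$ be independent conjugate pairs with each $X_n$ distributed according to $\mu$. Define $\lhd$ by declaring, for integers $m<n$, that $m\lhd n$ if and only if $X_m<X_n$, or $Y_m<Y_n$, or ($X_m=X_n$, $Y_m=Y_n$ and $X_m>Y_m$); otherwise $n\lhd m$. Almost surely this is a strict total ordering of $\mathbb{Z}$; its law is denoted $\mathbb{P}^\mu$. The empirical distribution of a sequence $(X_k)$ is the weak limit, when it exists, of $\frac1N\sum_{k=1}^N\delta_{X_k}$ as $N\to\infty$. *)

theory Defs
  imports "HOL-Probability.Probability"
begin

section \<open>Random orderings of the integers\<close>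

text \<open>The pair \<open>(m, n)\<close> belongs to \<open>r\<close> iff \<open>m\<close> is less than \<open>n\<close>. Only the space and the
  \<open>\<sigma>\<close>-algebra of \<open>order_space\<close> matter: the trace of the product \<open>\<sigma>\<close>-algebra on
  \<open>int \<times> int \<Rightarrow> bool\<close>, transported along \<open>r \<mapsto> (\<lambda>p. p \<in> r)\<close>.\<close>

definition order_space :: "int rel measure" where
  "order_space =
     vimage_algebra {r. strict_linear_order r} (\<lambda>r p. p \<in> r)
       (\<Pi>\<^sub>M p\<in>(UNIV :: (int \<times> int) set). count_space (UNIV :: bool set))"

text \<open>Here \<open>inv_image r f = {(m, n). (f m, f n) \<in> r}\<close> is the induced map applied to \<open>r\<close>.\<close>

definition I_invariant :: "int rel measure \<Rightarrow> bool" where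
  "I_invariant P \<longleftrightarrow>
     (\<forall>f :: int \<Rightarrow> int. strict_mono f \<longrightarrow> distr P order_space (\<lambda>r. inv_image r f) = P)"

definition left_average :: "int rel \<Rightarrow> int \<Rightarrow> nat \<Rightarrow> real" where
  "left_average r n N = (\<Sum>k = - int N..n. of_bool ((k, n) \<in> r)) / real N"

definition right_average :: "int rel \<Rightarrow> int \<Rightarrow> nat \<Rightarrow> real" where
  "right_average r n N = (\<Sum>k = n..int N. of_bool ((k, n) \<in> r)) / real N"


section \<open>Quasi-uniform measures and conjugate pairs\<close>

text \<open>A probability measure on \<open>[0,1]\<close> is represented as a Borel probability measure on the
  real line that gives mass 1 to \<open>[0,1]\<close>.\<close>

definition quasi_uniform :: "real measure \<Rightarrow> bool" where
  "quasi_uniform \<mu> \<longleftrightarrow>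
     real_distribution \<mu> \<and> measure \<mu> {0..1} = 1 \<and>
     measure \<mu> {x \<in> {0..1}. measure \<mu> {0..<x} \<le> x \<and> x \<le> measure \<mu> {0..x}} = 1"

definition gaps :: "real set \<Rightarrow> real set set" where
  "gaps F = components ({0..1} - F)"

text \<open>The decomposition \<open>\<mu> = \<lambda>\<^sub>F + (\<Sum>i. m\<^sub>i \<delta>(x\<^sub>i))\<close>. The gaps serve as their own indices, so
  that \<open>x\<close> assigns an endpoint to every gap; it is irrelevant elsewhere. An integral with
  respect to a counting measure is the sum of a family of extended nonnegative reals.\<close>

definition decomposition :: "real measure \<Rightarrow> real set \<Rightarrow> (real set \<Rightarrow> real) \<Rightarrow> bool" where
  "decomposition \<mu> F x \<longleftrightarrow>
     closed F \<and> F \<subseteq> {0..1} \<and> 0 \<in> F \<and> 1 \<in> F \<and>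
     (\<forall>G\<in>gaps F. x G = Inf G \<or> x G = Sup G) \<and>
     sets \<mu> = sets borel \<and>
     (\<forall>A\<in>sets borel. emeasure \<mu> A =
        emeasure lborel (A \<inter> F) +
        (\<integral>\<^sup>+ G. emeasure lborel G * indicator A (x G) \<partial>count_space (gaps F)))"

definition other_end :: "(real set \<Rightarrow> real) \<Rightarrow> real set \<Rightarrow> real" where
  "other_end x G = (if x G = Inf G then Sup G else Inf G)"

text \<open>The joint law \<open>\<integral>\<^sub>F \<delta>(t,t) dt + (\<Sum>i. m\<^sub>i \<delta>(x\<^sub>i,y\<^sub>i))\<close>.\<close>

definition pair_law :: "real set \<Rightarrow> (real set \<Rightarrow> real) \<Rightarrow> (real \<times> real) measure" where
  "pair_law F x =
     measure_of UNIV (sets borel)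
       (\<lambda>A. emeasure lborel {t \<in> F. (t, t) \<in> A} +
            (\<integral>\<^sup>+ G. emeasure lborel G * indicator A (x G, other_end x G) \<partial>count_space (gaps F)))"

text \<open>For quasi-uniform \<open>\<mu>\<close> the decomposition exists, and \<open>F\<close> and the restriction of \<open>x\<close> to
  \<open>gaps F\<close> are determined by \<open>\<mu>\<close>, so the choice is from a singleton.\<close>

definition conjugate_law :: "real measure \<Rightarrow> (real \<times> real) measure" where
  "conjugate_law \<mu> = (SOME N. \<exists>F x. decomposition \<mu> F x \<and> N = pair_law F x)"


section \<open>The law of the ordering built from independent conjugate pairs\<close>

definition earlier_below :: "real \<times> real \<Rightarrow> real \<times> real \<Rightarrow> bool" where
  "earlier_below p q \<longleftrightarrow>
     fst p < fst q \<or> snd p < snd q \<or> (fst p = fst q \<and> snd p = snd q \<and> fst p > snd p)"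

definition pairs_rel :: "(int \<Rightarrow> real \<times> real) \<Rightarrow> int rel" where
  "pairs_rel z = {(m, n). (m < n \<and> earlier_below (z m) (z n)) \<or>
                          (n < m \<and> \<not> earlier_below (z n) (z m))}"

text \<open>For quasi-uniform \<open>\<mu>\<close>, \<open>pairs_rel\<close> is almost surely a strict total ordering. On the
  exceptional null set the usual order of the integers is substituted, which makes the map
  take values in \<open>order_space\<close> everywhere without changing the law.\<close>

definition ordering_law :: "real measure \<Rightarrow> int rel measure" where
  "ordering_law \<mu> =
     distr (\<Pi>\<^sub>M n\<in>(UNIV :: int set). conjugate_law \<mu>) order_space
       (\<lambda>z. if strict_linear_order (pairs_rel z) then pairs_rel z else {(m, n). m < n})"


section \<open>Exchangeability and empirical distributions\<close>

definition exchangeable :: "'a measure \<Rightarrow> ('a \<Rightarrow> int \<Rightarrow> real) \<Rightarrow> bool" where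
  "exchangeable M X \<longleftrightarrow>
     (\<forall>n. (\<lambda>\<omega>. X \<omega> n) \<in> borel_measurable M) \<and>
     (\<forall>\<pi>. bij \<pi> \<and> finite {n. \<pi> n \<noteq> n} \<longrightarrow>
        distr M (\<Pi>\<^sub>M n\<in>UNIV. borel) (\<lambda>\<omega> n. X \<omega> (\<pi> n)) = distr M (\<Pi>\<^sub>M n\<in>UNIV. borel) X)"

text \<open>\<open>empirical_measure x N\<close> is the average of the unit masses at \<open>x 1, \<dots>, x N\<close>
  (and the null measure for \<open>N = 0\<close>).\<close>

definition empirical_measure :: "(int \<Rightarrow> real) \<Rightarrow> nat \<Rightarrow> real measure" where
  "empirical_measure x N = distr (uniform_count_measure {1..int N}) borel x"

definition has_empirical_distribution :: "(int \<Rightarrow> real) \<Rightarrow> real measure \<Rightarrow> bool" where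
  "has_empirical_distribution x \<mu> \<longleftrightarrow>
     real_distribution \<mu> \<and> weak_conv_m (empirical_measure x) \<mu>"

text \<open>The default value ensures that this is a probability measure for every sequence.\<close>

definition empirical_distribution :: "(int \<Rightarrow> real) \<Rightarrow> real measure" where
  "empirical_distribution x =
     (if \<exists>\<mu>. has_empirical_distribution x \<mu>
      then (THE \<mu>. has_empirical_distribution x \<mu>) else return borel 0)"

end

theory Submission
  imports Defs
begin

text \<open>For a fixed \<open>n\<close> the indicators of \<open>k \<lhd> n\<close> with \<open>k < n\<close> (or \<open>k > n\<close>) have constant correlations, so an
  elementary strong law yields the limits \<open>X n\<close>, \<open>Y n\<close>, and the limit along any subsequence is the same. Hence
  the pairs \<open>(X n, Y n)\<close> are equivariant under the maps induced by increasing functions. Replacing one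
  index after the other by an average shows that equivariant families are conditionally independent
  and identically distributed, in particular exchangeable.

  Transitivity makes \<open>k \<lhd> n\<close> imply \<open>X k \<le> X n\<close> and \<open>Y k \<le> Y n\<close>, so only ties need an argument. Let \<open>Lw n\<close>
  and \<open>Up n\<close> be the frequencies of the indices whose pair is strictly below, respectively not above, that of
  \<open>n\<close>. Second moments over three tied indices show that \<open>{X n, Y n} = {Lw n, Up n}\<close>, with all ties ordered in the same
  direction. Comparing the rank of a new index with that of \<open>N\<close> others shows that the frequency of
  \<open>Up \<le> q\<close> is at most \<open>q\<close>, and dually for \<open>Lw\<close>. Therefore the open intervals between \<open>X n\<close> and \<open>Y n\<close> are exactly the gaps
  of a closed set \<open>F\<close>, and the empirical distributions can be read off: they are the images of Lebesgue
  measure under the map that sends each gap to its two ends and fixes \<open>F\<close>. The second coordinate of this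
  map is almost everywhere the distribution function of the first, so the conjugate law depends measurably
  on the empirical distribution of \<open>X\<close>.\<close>

section \<open>Cesaro means\<close>

text \<open>An increasing map can push an index towards infinity on its own side of the others, but
  never past another index. So the outermost index is averaged first, and a family with two indices
  has separate left and right means. Ties, where the relation says more than \<open>S\<close>, are
  therefore treated by moment identities. Conditioning is postponed: a bounded invariant weight
  \<open>G\<close> is carried through the expectation identities and at the end becomes the
  indicator of an event of the empirical distribution. Limits are equivariant only up to null sets
  that depend on the map, so every identity uses one map at a time. The measure
  \<open>conjugate_law\<close> is obtained by a choice, which says nothing about measurability in
  \<open>\<mu>\<close>; the explicit \<open>conjugate_kernel\<close> replaces it wherever a
  decomposition exists.\<close>

definition cesaro :: "(nat \<Rightarrow> real) \<Rightarrow> nat \<Rightarrow> real" where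
  "cesaro u N = (\<Sum>i<N. u i) / real N"

lemma cesaro_abs_le:
  assumes "\<And>i. \<bar>u i\<bar> \<le> 1"
  shows "\<bar>cesaro u N\<bar> \<le> 1"
proof -
  have "\<bar>\<Sum>i<N. u i\<bar> \<le> (\<Sum>i<N. 1)"
    by (rule order_trans[OF sum_abs sum_mono]) (use assms in auto)
  then show ?thesis unfolding cesaro_def by (cases "N = 0") (auto simp: field_simps)
qed

lemma cesaro_add: "cesaro (\<lambda>i. u i + v i) N = cesaro u N + cesaro v N"
  and cesaro_diff: "cesaro (\<lambda>i. u i - v i) N = cesaro u N - cesaro v N"
  by (auto simp: cesaro_def sum.distrib sum_subtractf add_divide_distrib diff_divide_distrib)

lemma cesaro_mono:
  assumes "\<And>i. u i \<le> v i"
  shows "cesaro u N \<le> cesaro v N"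
  unfolding cesaro_def by (intro divide_right_mono sum_mono assms) auto

lemma cesaro_const: "cesaro (\<lambda>_. c) \<longlonglongrightarrow> c"
proof (rule Lim_transform_eventually[OF tendsto_const])
  show "\<forall>\<^sub>F N in sequentially. c = cesaro (\<lambda>_. c) N"
    using eventually_gt_at_top[of 0] by eventually_elim (auto simp: cesaro_def)
qed

text \<open>Changing the number of terms by a fixed integer, or the sum by a fixed real, disappears
  after division by \<open>N\<close>. A negative \<open>c\<close> is allowed, since the ranges of
  the left and right averages have \<open>N + n\<close> and \<open>N - n\<close> terms up to a
  constant; truncation by \<open>nat\<close> affects only finitely many \<open>N\<close>.\<close>

lemma sum_shift_div_tendsto:
  assumes "cesaro u \<longlonglongrightarrow> l"
    and "eventually (\<lambda>N. v N = (\<Sum>i<nat (int N + c). u i) + d) sequentially"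
  shows "(\<lambda>N. v N / real N) \<longlonglongrightarrow> l"
proof -
  have 1: "filterlim (\<lambda>N. nat (int N + c)) at_top sequentially"
    unfolding filterlim_at_top
  proof
    fix Z :: nat
    show "\<forall>\<^sub>F N in sequentially. Z \<le> nat (int N + c)"
      using eventually_ge_at_top[of "Z + nat \<bar>c\<bar>"] by eventually_elim linarith
  qed
  have 2: "(\<lambda>N. cesaro u (nat (int N + c))) \<longlonglongrightarrow> l"
    by (rule filterlim_compose[OF assms(1) 1])
  have "(\<lambda>N. 1 + real_of_int c / real N) \<longlonglongrightarrow> 1 + 0"
    by (intro tendsto_intros lim_const_over_n)
  moreover have "(\<lambda>N. d / real N) \<longlonglongrightarrow> 0" by (rule lim_const_over_n)
  ultimately have 3: "(\<lambda>N. cesaro u (nat (int N + c)) * (1 + real_of_int c / real N) + d / real N) \<longlonglongrightarrow> l * (1 + 0) + 0"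
    by (intro tendsto_intros 2)
  have "\<forall>\<^sub>F N in sequentially.
      cesaro u (nat (int N + c)) * (1 + real_of_int c / real N) + d / real N = v N / real N"
    using assms(2) eventually_gt_at_top[of "nat \<bar>c\<bar>"]
  proof eventually_elim
    case (elim N)
    have "real (nat (int N + c)) = real N + real_of_int c" "real N + real_of_int c \<noteq> 0" "real N \<noteq> 0"
      using elim by linarith+
    define a where "a = real N + real_of_int c"
    have a: "real (nat (int N + c)) = a" "a \<noteq> 0" "1 + real_of_int c / real N = a / real N"
      using \<open>real (nat (int N + c)) = real N + real_of_int c\<close> \<open>real N + real_of_int c \<noteq> 0\<close> \<open>real N \<noteq> 0\<close>
      by (auto simp: a_def field_simps)
    show ?case using a(2) by (simp add: cesaro_def a(1,3) elim add_divide_distrib)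
  qed
  from Lim_transform_eventually[OF 3 this] show ?thesis by simp
qed

lemma cesaro_shift:
  assumes "cesaro u \<longlonglongrightarrow> l"
  shows "cesaro (\<lambda>i. u (i + k)) \<longlonglongrightarrow> l"
  unfolding cesaro_def
proof (rule sum_shift_div_tendsto[OF assms, where c = "int k" and d = "- (\<Sum>i<k. u i)"])
  have "(\<Sum>i<N. u (i + k)) = (\<Sum>i<nat (int N + int k). u i) + - sum u {..<k}" for N
  proof -
    have "sum u {..<N + k} = sum u {..<k} + (\<Sum>i<N. u (i + k))"
      by (induction N) auto
    then show ?thesis by (simp add: nat_int_add)
  qed
  then show "\<forall>\<^sub>F N in sequentially. (\<Sum>i<N. u (i + k)) = (\<Sum>i<nat (int N + int k). u i) + - sum u {..<k}"
    by simp
qed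

text \<open>Bounded terms cannot move the average much between consecutive fourth powers, because
  \<open>(k + 1) ^ 4 / k ^ 4\<close> tends to 1. The exponent 4 comes from
  \<open>AE_summable_of_square_bound\<close>: second moments of order \<open>1 / k ^ 4\<close> give
  first moments of order \<open>1 / k ^ 2\<close>, which are summable.\<close>

lemma cesaro_sparse:
  assumes "\<And>i. \<bar>u i\<bar> \<le> 1" and "(\<lambda>k. cesaro u (k ^ 4)) \<longlonglongrightarrow> l"
  shows "cesaro u \<longlonglongrightarrow> l"
proof -
  define k where "k N = nat \<lfloor>root 4 (real N)\<rfloor>" for N
  have rk: "real (k N) = real_of_int \<lfloor>root 4 (real N)\<rfloor>" for N
    unfolding k_def by simp
  have k1: "k N ^ 4 \<le> N" for N
  proof -
    have "real (k N) ^ 4 \<le> root 4 (real N) ^ 4"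
      by (rule power_mono) (auto simp: rk)
    then have "real (k N ^ 4) \<le> real N" by simp
    then show ?thesis by linarith
  qed
  have k2: "N \<le> (k N + 1) ^ 4" for N
  proof -
    have "root 4 (real N) ^ 4 \<le> (real (k N) + 1) ^ 4"
      by (rule power_mono) (auto simp: rk intro: real_of_int_floor_add_one_ge)
    then have "real N \<le> real ((k N + 1) ^ 4)" by (simp add: add.commute)
    then show ?thesis by linarith
  qed
  have klim: "filterlim k at_top sequentially"
    unfolding filterlim_at_top
  proof
    fix Z :: nat
    show "\<forall>\<^sub>F N in sequentially. Z \<le> k N"
      using eventually_ge_at_top[of "(Z + 1) ^ 4"]
    proof eventually_elim
      case (elim N)
      then have "(Z + 1) ^ 4 \<le> (k N + 1) ^ 4" using k2[of N] by linarith
      then show ?case using power_le_imp_le_base by fastforce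
    qed
  qed
  have 1: "(\<lambda>N. cesaro u (k N ^ 4)) \<longlonglongrightarrow> l"
    by (rule filterlim_compose[OF assms(2) klim])
  have "(\<lambda>j::nat. 2 * ((real j + 1) ^ 4 - real j ^ 4) / real j ^ 4) \<longlonglongrightarrow> 0"
    by real_asymp
  then have 2: "(\<lambda>N. 2 * ((real (k N) + 1) ^ 4 - real (k N) ^ 4) / real (k N) ^ 4) \<longlonglongrightarrow> 0"
    by (rule filterlim_compose[OF _ klim])
  have 3: "(\<lambda>N. cesaro u N - cesaro u (k N ^ 4)) \<longlonglongrightarrow> 0"
  proof (rule Lim_null_comparison[OF _ 2])
    have "\<forall>\<^sub>F N in sequentially. 1 \<le> k N"
      using klim unfolding filterlim_at_top by blast
    then show "\<forall>\<^sub>F N in sequentially. norm (cesaro u N - cesaro u (k N ^ 4))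
        \<le> 2 * ((real (k N) + 1) ^ 4 - real (k N) ^ 4) / real (k N) ^ 4"
    proof eventually_elim
      case (elim N)
      define m where "m = k N ^ 4"
      have m: "0 < m" "m \<le> N" using elim k1[of N] by (auto simp: m_def)
      have m': "real m = real (k N) ^ 4" by (simp add: m_def)
      have "real N \<le> real ((k N + 1) ^ 4)" using k2[of N] by linarith
      then have N2: "real N - real m \<le> (real (k N) + 1) ^ 4 - real (k N) ^ 4"
        by (simp add: m' add.commute)
      have s1: "\<bar>\<Sum>i\<in>{m..<N}. u i\<bar> \<le> real N - real m"
      proof -
        have "\<bar>\<Sum>i\<in>{m..<N}. u i\<bar> \<le> (\<Sum>i\<in>{m..<N}. 1)"
          by (rule order_trans[OF sum_abs sum_mono]) (use assms in auto)
        then show ?thesis using m by (simp add: of_nat_diff)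
      qed
      have s2: "\<bar>\<Sum>i<m. u i\<bar> \<le> real m"
      proof -
        have "\<bar>\<Sum>i<m. u i\<bar> \<le> (\<Sum>i<m. 1)"
          by (rule order_trans[OF sum_abs sum_mono]) (use assms in auto)
        then show ?thesis by simp
      qed
      have split: "(\<Sum>i<N. u i) = (\<Sum>i<m. u i) + (\<Sum>i\<in>{m..<N}. u i)"
        using m by (simp add: lessThan_atLeast0 sum.atLeastLessThan_concat)
      \<comment> \<open>One part comes from the \<open>N - m\<close> new terms, the other from the
        changed denominator. Each is at most \<open>(N - m) / N\<close>, whence the factor
        2.\<close>
      have "cesaro u N - cesaro u m = (\<Sum>i\<in>{m..<N}. u i) / real N - (\<Sum>i<m. u i) * (real N - real m) / (real N * real m)"
        using m by (simp add: cesaro_def split field_simps)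
      also have "\<bar>\<dots>\<bar> \<le> \<bar>\<Sum>i\<in>{m..<N}. u i\<bar> / real N + \<bar>\<Sum>i<m. u i\<bar> * (real N - real m) / (real N * real m)"
        using m by (intro order_trans[OF abs_triangle_ineq4]) (auto simp: abs_mult)
      also have "\<dots> \<le> (real N - real m) / real N + real m * (real N - real m) / (real N * real m)"
        using m s1 s2 by (intro add_mono divide_right_mono mult_right_mono) auto
      also have "\<dots> = 2 * (real N - real m) / real N" using m by simp
      also have "\<dots> \<le> 2 * (real N - real m) / real m"
        using m by (intro divide_left_mono mult_pos_pos) auto
      also have "\<dots> \<le> 2 * ((real (k N) + 1) ^ 4 - real (k N) ^ 4) / real m"
        using N2 by (intro divide_right_mono) auto
      finally show ?case by (simp add: m_def)
    qed
  qed
  from tendsto_add[OF 3 1] show ?thesis by simp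
qed

section \<open>A strong law for sequences with constant correlations\<close>

lemma (in prob_space) integrable_bounded_real:
  assumes "f \<in> borel_measurable M" and "\<And>x. \<bar>f x\<bar> \<le> (B::real)"
  shows "integrable M f"
  by (rule integrable_const_bound[where B = B]) (use assms in auto)

text \<open>The elementary bound \<open>\<bar>Z\<bar> \<le> s * Z\<^sup>2 + 1 / s\<close> with
  \<open>s = (k + 1)\<^sup>2\<close> turns the second moments into summable first moments; then the
  series has a finite integral and is finite almost everywhere.\<close>

lemma (in prob_space) AE_summable_of_square_bound:
  fixes Z :: "nat \<Rightarrow> 'a \<Rightarrow> real"
  assumes [measurable]: "\<And>k. Z k \<in> borel_measurable M"
    and b: "\<And>k x. \<bar>Z k x\<bar> \<le> B"
    and sq: "\<And>k. (\<integral>x. (Z k x)\<^sup>2 \<partial>M) \<le> C / (real (Suc k)) ^ 4"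
  shows "AE x in M. summable (\<lambda>k. \<bar>Z k x\<bar>)"
proof -
  have B: "0 \<le> B" using b[of 0] not_empty by (meson abs_ge_zero order_trans)
  have i2: "integrable M (\<lambda>x. (Z k x)\<^sup>2)" for k
  proof (rule integrable_bounded_real[where B = "B\<^sup>2"])
    show "\<bar>(Z k x)\<^sup>2\<bar> \<le> B\<^sup>2" for x
      using b[of k x] B by (metis abs_ge_zero abs_power2 power2_abs power_mono)
  qed simp
  have i1: "integrable M (\<lambda>x. \<bar>Z k x\<bar>)" for k
    by (rule integrable_bounded_real[where B = "B"]) (use b in auto)
  have e: "(\<integral>x. \<bar>Z k x\<bar> \<partial>M) \<le> (C + 1) / (real (Suc k))\<^sup>2" for k
  proof -
    define s where "s = (real (Suc k))\<^sup>2"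
    have s: "s > 0" "(real (Suc k)) ^ 4 = s * s" by (auto simp: s_def power2_eq_square power4_eq_xxxx)
    have pw: "\<bar>Z k x\<bar> \<le> s * (Z k x)\<^sup>2 + 1 / s" for x
    proof -
      have "0 \<le> (s * \<bar>Z k x\<bar> - 1)\<^sup>2 + s * \<bar>Z k x\<bar>" using s by (intro add_nonneg_nonneg) auto
      then have "s * \<bar>Z k x\<bar> \<le> s\<^sup>2 * (Z k x)\<^sup>2 + 1"
        by (simp add: power2_eq_square algebra_simps)
      then have "s * \<bar>Z k x\<bar> / s \<le> (s\<^sup>2 * (Z k x)\<^sup>2 + 1) / s" using s by (intro divide_right_mono) auto
      then show ?thesis using s by (simp add: power2_eq_square add_divide_distrib)
    qed
    have "(\<integral>x. \<bar>Z k x\<bar> \<partial>M) \<le> (\<integral>x. s * (Z k x)\<^sup>2 + 1 / s \<partial>M)"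
      by (intro integral_mono i1 Bochner_Integration.integrable_add integrable_mult_right i2 pw) auto
    also have "\<dots> = s * (\<integral>x. (Z k x)\<^sup>2 \<partial>M) + 1 / s"
      using i2[of k] by (simp add: prob_space)
    also have "\<dots> \<le> s * (C / (s * s)) + 1 / s"
      using sq[of k] s by (intro add_mono mult_left_mono) auto
    also have "\<dots> = (C + 1) / s" using s by (simp add: field_simps)
    finally show ?thesis by (simp add: s_def)
  qed
  have sum_e: "summable (\<lambda>k. (C + 1) / (real (Suc k))\<^sup>2)"
  proof -
    have "summable (\<lambda>n. inverse ((real n)\<^sup>2))" by (rule inverse_power_summable) simp
    then have "summable (\<lambda>n. inverse ((real (Suc n))\<^sup>2))"
      using summable_Suc_iff[of "\<lambda>n. inverse ((real n)\<^sup>2)"] by simp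
    from summable_mult[OF this, of "C + 1"] show ?thesis by (simp add: divide_inverse)
  qed
  have "(\<integral>\<^sup>+x. (\<Sum>k. ennreal \<bar>Z k x\<bar>) \<partial>M) = (\<Sum>k. \<integral>\<^sup>+x. ennreal \<bar>Z k x\<bar> \<partial>M)"
    by (rule nn_integral_suminf) simp
  also have "\<dots> = (\<Sum>k. ennreal (\<integral>x. \<bar>Z k x\<bar> \<partial>M))"
    by (simp add: nn_integral_eq_integral i1)
  also have "\<dots> \<le> (\<Sum>k. ennreal ((C + 1) / (real (Suc k))\<^sup>2))"
    by (intro suminf_le ennreal_leI e summableI)
  also have "\<dots> < \<infinity>"
  proof -
    have "0 \<le> (C + 1) / (real (Suc k))\<^sup>2" for k
      using e[of k] by (rule order_trans[rotated]) simp
    then have "(\<Sum>k. ennreal ((C + 1) / (real (Suc k))\<^sup>2)) = ennreal (\<Sum>k. (C + 1) / (real (Suc k))\<^sup>2)"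
      by (intro suminf_ennreal2 sum_e)
    then show ?thesis by simp
  qed
  finally have "(\<integral>\<^sup>+x. (\<Sum>k. ennreal \<bar>Z k x\<bar>) \<partial>M) \<noteq> \<infinity>" by simp
  then have "AE x in M. (\<Sum>k. ennreal \<bar>Z k x\<bar>) \<noteq> \<infinity>"
    by (intro nn_integral_PInf_AE) auto
  then show ?thesis
  proof eventually_elim
    case (elim x)
    then show ?case
      by (intro summable_suminf_not_top) (auto simp: infinity_ennreal_def)
  qed
qed

text \<open>The constant is an uncentred product moment of distinct indices, so the averages in
  general have a random limit. What is obtained is that they converge and that the limit is the same
  along all subsequences. The index set is a parameter because for families with two indices only
  one side of the second index is admissible.\<close>

locale constant_correlation = prob_space M for M :: "'a measure" +
  fixes I :: "'i set" and \<eta> :: "'i \<Rightarrow> 'a \<Rightarrow> real" and c :: real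
  assumes meas: "\<And>i. i \<in> I \<Longrightarrow> \<eta> i \<in> borel_measurable M"
    and bounded: "\<And>i x. \<bar>\<eta> i x\<bar> \<le> 1"
    and corr: "\<And>i j. i \<in> I \<Longrightarrow> j \<in> I \<Longrightarrow> i \<noteq> j \<Longrightarrow> (\<integral>x. \<eta> i x * \<eta> j x \<partial>M) = c"
begin

definition avg :: "(nat \<Rightarrow> 'i) \<Rightarrow> nat \<Rightarrow> 'a \<Rightarrow> real" where
  "avg s N x = cesaro (\<lambda>i. \<eta> (s i) x) N"

lemma avg_measurable: "range s \<subseteq> I \<Longrightarrow> avg s N \<in> borel_measurable M"
  unfolding avg_def cesaro_def by (intro borel_measurable_divide borel_measurable_sum meas) auto

lemma avg_abs_le: "\<bar>avg s N x\<bar> \<le> 1"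
  unfolding avg_def by (intro cesaro_abs_le bounded)

lemma abs_corr_le: "i \<in> I \<Longrightarrow> j \<in> I \<Longrightarrow> \<bar>\<integral>x. \<eta> i x * \<eta> j x \<partial>M\<bar> \<le> 1"
proof -
  assume ij: "i \<in> I" "j \<in> I"
  have b: "\<bar>\<eta> i x * \<eta> j x\<bar> \<le> 1" for x
    using bounded[of i x] bounded[of j x] by (simp add: abs_mult mult_le_one)
  have [measurable]: "\<eta> i \<in> borel_measurable M" "\<eta> j \<in> borel_measurable M" using ij meas by auto
  have i: "integrable M (\<lambda>x. \<eta> i x * \<eta> j x)"
    by (rule integrable_bounded_real[OF _ b]) simp
  have "\<bar>\<integral>x. \<eta> i x * \<eta> j x \<partial>M\<bar> \<le> (\<integral>x. \<bar>\<eta> i x * \<eta> j x\<bar> \<partial>M)" by (rule integral_abs_bound)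
  also have "\<dots> \<le> (\<integral>x. 1 \<partial>M)" by (intro integral_mono integrable_abs i b) auto
  finally show ?thesis by (simp add: prob_space)
qed

text \<open>A product \<open>\<eta> (s i) * \<eta> (t j)\<close> has expectation \<open>c\<close>
  unless \<open>s i = t j\<close>. As \<open>t\<close> is injective, each \<open>i\<close> meets at
  most one such \<open>j\<close>, with a deviation of at most 2; the total error
  \<open>2 * N\<close> is then divided by \<open>N * K\<close>.\<close>

lemma avg_cross:
  assumes s: "inj s" "range s \<subseteq> I" and t: "inj t" "range t \<subseteq> I" and NK: "0 < N" "0 < K"
  shows "\<bar>(\<integral>x. avg s N x * avg t K x \<partial>M) - c\<bar> \<le> 2 / real K"
proof -
  define e where "e i j = (\<integral>x. \<eta> (s i) x * \<eta> (t j) x \<partial>M)" for i j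
  have sI: "s i \<in> I" "t i \<in> I" for i using s t by auto
  note [measurable] = meas[OF sI(1)] meas[OF sI(2)]
  have int: "integrable M (\<lambda>x. \<eta> (s i) x * \<eta> (t j) x)" for i j
    by (rule integrable_bounded_real[where B = 1])
      (use bounded in \<open>auto simp: abs_mult mult_le_one\<close>)
  have "(\<integral>x. avg s N x * avg t K x \<partial>M) = (\<integral>x. (\<Sum>i<N. \<Sum>j<K. \<eta> (s i) x * \<eta> (t j) x) / (real N * real K) \<partial>M)"
    by (simp add: avg_def cesaro_def sum_product)
  also have "\<dots> = (\<Sum>i<N. \<Sum>j<K. e i j) / (real N * real K)"
    using int by (simp add: e_def)
  finally have 1: "(\<integral>x. avg s N x * avg t K x \<partial>M) - c = (\<Sum>i<N. \<Sum>j<K. e i j - c) / (real N * real K)"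
    using NK by (simp add: sum_subtractf field_simps)
  have s01: "s 0 \<noteq> s 1" using s by (auto dest: injD)
  have c1: "\<bar>c\<bar> \<le> 1" using abs_corr_le[OF sI(1)[of 0] sI(1)[of 1]] corr[OF sI(1)[of 0] sI(1)[of 1] s01] by simp
  have row: "(\<Sum>j<K. \<bar>e i j - c\<bar>) \<le> 2" for i
  proof -
    have le: "\<bar>e i j - c\<bar> \<le> (if s i = t j then 2 else 0)" for j
    proof (cases "s i = t j")
      case True
      have "\<bar>e i j\<bar> \<le> 1" unfolding e_def by (intro abs_corr_le sI)
      then show ?thesis using c1 True by simp
    next
      case False
      then have "e i j = c" unfolding e_def by (intro corr sI)
      then show ?thesis using False by simp
    qed
    have "(\<Sum>j<K. \<bar>e i j - c\<bar>) \<le> (\<Sum>j<K. if s i = t j then 2 else 0)"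
      by (intro sum_mono le)
    also have "\<dots> = (\<Sum>j\<in>{j. j < K \<and> s i = t j}. 2)"
      by (subst sum.inter_filter[symmetric]) (auto intro!: arg_cong2[where f=sum])
    also have "\<dots> = 2 * real (card {j. j < K \<and> s i = t j})" by simp
    also have "\<dots> \<le> 2"
    proof -
      have "\<forall>a\<in>{j. j < K \<and> s i = t j}. \<forall>b\<in>{j. j < K \<and> s i = t j}. a = b"
        using t(1) by (auto dest: injD)
      then have "card {j. j < K \<and> s i = t j} \<le> Suc 0"
        by (subst card_le_Suc0_iff_eq) auto
      then show ?thesis by simp
    qed
    finally show ?thesis .
  qed
  have "\<bar>\<Sum>i<N. \<Sum>j<K. e i j - c\<bar> \<le> (\<Sum>i<N. \<Sum>j<K. \<bar>e i j - c\<bar>)"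
    by (intro order_trans[OF sum_abs] sum_mono sum_abs)
  also have "\<dots> \<le> (\<Sum>i<N. 2)" by (intro sum_mono row)
  finally have "\<bar>\<Sum>i<N. \<Sum>j<K. e i j - c\<bar> \<le> 2 * real N" by simp
  then show ?thesis unfolding 1 using NK by (simp add: abs_divide field_simps)
qed

text \<open>In the expanded square the contributions \<open>c - 2 * c + c\<close> cancel, and the
  errors \<open>2 / N\<close>, \<open>4 / K\<close> and \<open>2 / K\<close> remain.\<close>

lemma avg_diff_sq:
  assumes s: "inj s" "range s \<subseteq> I" and t: "inj t" "range t \<subseteq> I" and NK: "0 < N" "0 < K"
  shows "(\<integral>x. (avg s N x - avg t K x)\<^sup>2 \<partial>M) \<le> 2 / real N + 6 / real K"
proof -
  note [measurable] = avg_measurable[OF s(2)] avg_measurable[OF t(2)]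
  have int: "integrable M (\<lambda>x. avg s N x * avg s N x)" "integrable M (\<lambda>x. avg s N x * avg t K x)"
    "integrable M (\<lambda>x. avg t K x * avg t K x)"
    by (rule integrable_bounded_real[where B = 1]; use avg_abs_le in \<open>auto simp: abs_mult simp del: abs_mult_self_eq intro!: mult_le_one\<close>)+
  have "(\<integral>x. (avg s N x - avg t K x)\<^sup>2 \<partial>M) =
      (\<integral>x. avg s N x * avg s N x - 2 * (avg s N x * avg t K x) + avg t K x * avg t K x \<partial>M)"
    by (rule Bochner_Integration.integral_cong) (auto simp: power2_eq_square algebra_simps)
  also have "\<dots> = (\<integral>x. avg s N x * avg s N x \<partial>M) - 2 * (\<integral>x. avg s N x * avg t K x \<partial>M)
      + (\<integral>x. avg t K x * avg t K x \<partial>M)"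
    using int by simp
  also have "\<dots> \<le> 2 / real N + 6 / real K"
    using avg_cross[OF s s NK(1) NK(1)] avg_cross[OF s t NK] avg_cross[OF t t NK(2) NK(2)] by linarith
  finally show ?thesis .
qed

theorem strong_law:
  assumes s: "inj s" "range s \<subseteq> I" and t: "inj t" "range t \<subseteq> I"
  shows "AE x in M. \<exists>l. cesaro (\<lambda>i. \<eta> (s i) x) \<longlonglongrightarrow> l \<and> cesaro (\<lambda>i. \<eta> (t i) x) \<longlonglongrightarrow> l"
proof -
  note [measurable] = avg_measurable[OF s(2)] avg_measurable[OF t(2)]
  have b: "\<bar>avg u N x - avg v K x\<bar> \<le> 2" for u v N K x
    using avg_abs_le[of u N x] avg_abs_le[of v K x] by linarith
  have sq: "(\<integral>x. (avg u ((Suc (Suc k)) ^ 4) x - avg v ((Suc k) ^ 4) x)\<^sup>2 \<partial>M) \<le> 8 / real (Suc k) ^ 4"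
    if "inj u" "range u \<subseteq> I" "inj v" "range v \<subseteq> I" for u v k
  proof -
    have "(\<integral>x. (avg u ((Suc (Suc k)) ^ 4) x - avg v ((Suc k) ^ 4) x)\<^sup>2 \<partial>M)
        \<le> 2 / real ((Suc (Suc k)) ^ 4) + 6 / real ((Suc k) ^ 4)"
      by (rule avg_diff_sq) (use that in auto)
    also have "2 / real ((Suc (Suc k)) ^ 4) \<le> 2 / real ((Suc k) ^ 4)"
      by (intro divide_left_mono of_nat_mono power_mono) auto
    finally show ?thesis by simp
  qed
  have "AE x in M. summable (\<lambda>k. \<bar>avg s ((Suc (Suc k)) ^ 4) x - avg s ((Suc k) ^ 4) x\<bar>)"
    by (rule AE_summable_of_square_bound[OF _ b sq]) (use s in auto)
  \<comment> \<open>Comparing \<open>s\<close> at one fourth power with \<open>t\<close> at the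
    preceding one gives a null sequence, so \<open>t\<close> inherits the limit that the first
    series provides for \<open>s\<close>.\<close>
  moreover have "AE x in M. summable (\<lambda>k. \<bar>avg s ((Suc (Suc k)) ^ 4) x - avg t ((Suc k) ^ 4) x\<bar>)"
    by (rule AE_summable_of_square_bound[OF _ b sq]) (use s t in auto)
  ultimately show ?thesis
  proof eventually_elim
    case (elim x)
    define A where "A k = avg s (k ^ 4) x" for k
    have "summable (\<lambda>k. A (Suc (Suc k)) - A (Suc k))"
      using elim(1) unfolding A_def by (rule summable_rabs_cancel)
    then have "convergent (\<lambda>n. \<Sum>k<n. A (Suc (Suc k)) - A (Suc k))"
      by (simp add: summable_iff_convergent)
    moreover have "(\<Sum>k<n. A (Suc (Suc k)) - A (Suc k)) = A (Suc n) - A (Suc 0)" for n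
      by (induction n) auto
    ultimately obtain l' where "(\<lambda>n. A (Suc n) - A (Suc 0)) \<longlonglongrightarrow> l'"
      by (auto simp: convergent_def)
    from tendsto_add[OF this tendsto_const[of "A (Suc 0)"]]
    obtain l where l: "(\<lambda>k. A (Suc k)) \<longlonglongrightarrow> l" by auto
    then have Al: "A \<longlonglongrightarrow> l" by (simp add: filterlim_sequentially_Suc)
    have "(\<lambda>k. avg s ((Suc (Suc k)) ^ 4) x - avg t ((Suc k) ^ 4) x) \<longlonglongrightarrow> 0"
      using summable_LIMSEQ_zero[OF elim(2)] by (simp add: tendsto_rabs_zero_iff)
    moreover have "(\<lambda>k. avg s ((Suc (Suc k)) ^ 4) x) \<longlonglongrightarrow> l"
      using l unfolding A_def by (subst (asm) filterlim_sequentially_Suc[symmetric])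
    ultimately have "(\<lambda>k. avg s ((Suc (Suc k)) ^ 4) x - (avg s ((Suc (Suc k)) ^ 4) x - avg t ((Suc k) ^ 4) x)) \<longlonglongrightarrow> l - 0"
      by (intro tendsto_diff)
    then have "(\<lambda>k. avg t ((Suc k) ^ 4) x) \<longlonglongrightarrow> l" by simp
    then have tl: "(\<lambda>k. avg t (k ^ 4) x) \<longlonglongrightarrow> l"
      using filterlim_sequentially_Suc[of "\<lambda>k. avg t (k ^ 4) x"] by simp
    show ?case
      using cesaro_sparse[where u = "\<lambda>i. \<eta> (s i) x" and l = l]
        cesaro_sparse[where u = "\<lambda>i. \<eta> (t i) x" and l = l] bounded Al tl
      unfolding A_def avg_def by blast
  qed
qed

end

section \<open>Measures on sequences\<close>

lemma Int_stable_range_atMost: "Int_stable (range atMost :: 'a::semilattice_inf set set)"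
proof (rule Int_stableI)
  fix A B :: "'a set" assume "A \<in> range atMost" "B \<in> range atMost"
  then obtain a b where "A = {..a}" "B = {..b}" by blast
  then have "A \<inter> B = {..inf a b}" by auto
  then show "A \<inter> B \<in> range atMost" by blast
qed

text \<open>The events of the finite-dimensional distribution functions: closed under intersection
  and generating the product sigma-algebra, hence determining finite measures. The type class covers
  sequences of reals and sequences of pairs.\<close>

definition lower_cylinders :: "('i \<Rightarrow> 'b::ordered_euclidean_space) set set" where
  "lower_cylinders = {C. \<exists>J a. finite J \<and> C = {z. \<forall>j\<in>J. z j \<le> a j}}"

lemma lower_cylindersI: "finite J \<Longrightarrow> {z. \<forall>j\<in>J. z j \<le> a j} \<in> lower_cylinders"
  unfolding lower_cylinders_def by (intro CollectI exI conjI) simp_all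

lemma lower_cylindersE:
  assumes "C \<in> lower_cylinders"
  obtains J a where "finite J" "C = {z. \<forall>j\<in>J. z j \<le> a j}"
  using assms unfolding lower_cylinders_def by (elim CollectE exE conjE)

lemma sets_PiM_atMost:
  "sets (\<Pi>\<^sub>M i\<in>(UNIV :: 'i set). (borel :: 'b::ordered_euclidean_space measure)) =
     sigma_sets UNIV lower_cylinders" (is "sets ?M = _")
proof
  have sp: "space ?M = UNIV" by (simp add: space_PiM)
  have "lower_cylinders \<subseteq> sets ?M"
  proof
    fix C :: "('i \<Rightarrow> 'b) set" assume "C \<in> lower_cylinders"
    then obtain J a where J: "finite J" "C = {z. \<forall>j\<in>J. z j \<le> a j}" by (rule lower_cylindersE)
    have "{z \<in> space ?M. z j \<in> {..a j}} \<in> sets ?M" for j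
      by (rule measurable_sets_Collect[OF measurable_component_singleton]) auto
    then have "{z \<in> space ?M. \<forall>j\<in>J. z j \<in> {..a j}} \<in> sets ?M"
      using J(1) by (intro sets.sets_Collect_finite_All) simp_all
    then show "C \<in> sets ?M" by (simp add: sp J(2))
  qed
  then show "sigma_sets UNIV lower_cylinders \<subseteq> sets ?M"
    using sets.sigma_sets_subset[of lower_cylinders ?M] by (simp add: sp)
next
  let ?S = "sigma UNIV lower_cylinders :: ('i \<Rightarrow> 'b) measure"
  have S: "sets ?S = sigma_sets UNIV lower_cylinders" "space ?S = UNIV" by simp_all
  have "(\<lambda>z. z) \<in> measurable ?S ?M"
  proof (rule measurable_PiM_single')
    fix i :: 'i
    show "(\<lambda>z. z i) \<in> measurable ?S borel"
      unfolding borel_eq_atMost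
    proof (rule measurable_measure_of)
      fix A assume "A \<in> range (\<lambda>a::'b. {..a})"
      then obtain a :: 'b where A: "A = {..a}" by (elim rangeE)
      have "{z. \<forall>j\<in>{i}. z j \<le> (\<lambda>_. a) j} \<in> lower_cylinders" by (intro lower_cylindersI) simp
      then have "{z. z i \<le> a} \<in> sets ?S" unfolding S by (intro sigma_sets.Basic) simp
      moreover have "(\<lambda>z. z i) -` A \<inter> space ?S = {z. z i \<le> a}" by (simp add: A vimage_def)
      ultimately show "(\<lambda>z. z i) -` A \<inter> space ?S \<in> sets ?S" by (simp only:)
    qed simp_all
  qed (simp add: space_PiM)
  from measurable_sets[OF this] have "A \<in> sets ?S" if "A \<in> sets ?M" for A
    using that by (simp add: S)
  then show "sets ?M \<subseteq> sigma_sets UNIV lower_cylinders" unfolding S by (rule subsetI)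
qed

lemma Int_stable_lower_cylinders:
  "Int_stable (lower_cylinders :: ('i \<Rightarrow> 'b::ordered_euclidean_space) set set)"
proof (rule Int_stableI)
  fix A B :: "('i \<Rightarrow> 'b) set" assume "A \<in> lower_cylinders" "B \<in> lower_cylinders"
  then obtain J a K b where AB: "finite J" "finite K"
    "A = {z. \<forall>j\<in>J. z j \<le> a j}" "B = {z. \<forall>j\<in>K. z j \<le> b j}"
    by (elim lower_cylindersE)
  have "A \<inter> B = {z. \<forall>j\<in>J \<union> K. z j \<le> (if j \<in> J \<inter> K then inf (a j) (b j) else if j \<in> J then a j else b j)}"
    unfolding AB(3,4) by (auto split: if_splits)
  then show "A \<inter> B \<in> lower_cylinders" using AB(1,2) by (simp only: lower_cylindersI finite_Un)
qed

lemma measure_eqI_PiM_atMost: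
  fixes N1 N2 :: "('i \<Rightarrow> 'b::ordered_euclidean_space) measure"
  assumes s: "sets N1 = sets (\<Pi>\<^sub>M i\<in>UNIV. borel)" "sets N2 = sets (\<Pi>\<^sub>M i\<in>UNIV. borel)"
    and eq: "\<And>J a. finite J \<Longrightarrow> emeasure N1 {z. \<forall>j\<in>J. z j \<le> a j} = emeasure N2 {z. \<forall>j\<in>J. z j \<le> a j}"
    and fin: "emeasure N1 UNIV \<noteq> \<infinity>"
  shows "N1 = N2"
proof (rule measure_eqI_generator_eq[where A = "\<lambda>_. UNIV" and E = lower_cylinders and \<Omega> = UNIV])
  show "range (\<lambda>_::nat. UNIV :: ('i \<Rightarrow> 'b) set) \<subseteq> lower_cylinders"
    using lower_cylindersI[of "{}" "undefined :: 'i \<Rightarrow> 'b"] by simp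
  show "emeasure N1 X = emeasure N2 X" if X: "X \<in> lower_cylinders" for X
    using X by (rule lower_cylindersE) (simp add: eq)
qed (use fin in \<open>simp_all add: s sets_PiM_atMost Int_stable_lower_cylinders\<close>)

text \<open>All Cesaro means of the \<open>\<zeta> s\<close>, from the first on, have integral
  \<open>e\<close> against \<open>W\<close>, and dominated convergence carries this to the limit.
  Only the products with \<open>W\<close> have to agree in expectation, so \<open>W\<close> may
  depend on further indices.\<close>

lemma (in prob_space) expectation_averaged:
  fixes \<zeta> :: "nat \<Rightarrow> 'a \<Rightarrow> real"
  assumes [measurable]: "\<And>s. \<zeta> s \<in> borel_measurable M" "W \<in> borel_measurable M" "Z \<in> borel_measurable M"
    and b: "\<And>s x. \<bar>\<zeta> s x\<bar> \<le> 1" and W: "AE x in M. \<bar>W x\<bar> \<le> 1"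
    and e: "\<And>s. expectation (\<lambda>x. \<zeta> s x * W x) = e"
    and lim: "AE x in M. cesaro (\<lambda>s. \<zeta> s x) \<longlonglongrightarrow> Z x"
  shows "expectation (\<lambda>x. Z x * W x) = e"
proof -
  have i: "integrable M (\<lambda>x. \<zeta> s x * W x)" for s
  proof (rule integrable_const_bound[where B = 1])
    show "AE x in M. norm (\<zeta> s x * W x) \<le> 1"
      using W by eventually_elim (use b in \<open>auto simp: abs_mult intro!: mult_le_one\<close>)
  qed simp
  have [measurable]: "(\<lambda>x. cesaro (\<lambda>s. \<zeta> s x) N) \<in> borel_measurable M" for N
    unfolding cesaro_def by measurable
  have "(\<lambda>N. expectation (\<lambda>x. cesaro (\<lambda>s. \<zeta> s x) N * W x)) \<longlonglongrightarrow> expectation (\<lambda>x. Z x * W x)"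
  proof (rule integral_dominated_convergence[where w = "\<lambda>_. 1"])
    show "AE x in M. (\<lambda>N. cesaro (\<lambda>s. \<zeta> s x) N * W x) \<longlonglongrightarrow> Z x * W x"
      using lim by eventually_elim (intro tendsto_intros)
    show "AE x in M. norm (cesaro (\<lambda>s. \<zeta> s x) N * W x) \<le> 1" for N
      using W by eventually_elim (use cesaro_abs_le b in \<open>auto simp: abs_mult intro!: mult_le_one\<close>)
  qed auto
  moreover have "expectation (\<lambda>x. cesaro (\<lambda>s. \<zeta> s x) N * W x) = cesaro (\<lambda>s. e) N" for N
  proof -
    have "expectation (\<lambda>x. cesaro (\<lambda>s. \<zeta> s x) N * W x) = expectation (\<lambda>x. (\<Sum>s<N. \<zeta> s x * W x) / real N)"
      by (simp add: cesaro_def sum_distrib_right)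
    also have "\<dots> = cesaro (\<lambda>s. e) N" using i e by (simp add: cesaro_def)
    finally show ?thesis .
  qed
  ultimately have "cesaro (\<lambda>s. e) \<longlonglongrightarrow> expectation (\<lambda>x. Z x * W x)" by simp
  from LIMSEQ_unique[OF this cesaro_const] show ?thesis .
qed

section \<open>Equivariant families on the space of orderings\<close>

lemma space_order_space: "space order_space = {r. strict_linear_order r}"
  by (simp add: order_space_def)

lemma mem_measurable [measurable]: "(\<lambda>r. (m, n) \<in> r) \<in> measurable order_space (count_space UNIV)"
proof -
  have "(\<lambda>r p. p \<in> r) \<in> measurable order_space (\<Pi>\<^sub>M p\<in>(UNIV :: (int \<times> int) set). count_space (UNIV :: bool set))"
    unfolding order_space_def by (rule measurable_vimage_algebra1) (auto simp: space_PiM)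
  from measurable_compose[OF this measurable_component_singleton[of "(m, n)"]] show ?thesis by simp
qed

lemma measurable_order_spaceI:
  assumes "\<And>x. x \<in> space N \<Longrightarrow> strict_linear_order (g x)"
    and "\<And>m n. (\<lambda>x. (m, n) \<in> g x) \<in> measurable N (count_space UNIV)"
  shows "g \<in> measurable N order_space"
  unfolding order_space_def
proof (rule measurable_vimage_algebra2)
  show "(\<lambda>x p. p \<in> g x) \<in> measurable N (\<Pi>\<^sub>M p\<in>UNIV. count_space UNIV)"
  proof (rule measurable_PiM_single')
    show "(\<lambda>x. p \<in> g x) \<in> measurable N (count_space UNIV)" for p
      using assms(2)[of "fst p" "snd p"] by simp
  qed auto
qed (use assms in auto)

lemma strict_linear_order_inv_image:
  "strict_linear_order r \<Longrightarrow> inj f \<Longrightarrow> strict_linear_order (inv_image r f)"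
  unfolding strict_linear_order_on_def trans_def irrefl_def total_on_def inv_image_def inj_def
  by simp blast

lemma inv_image_measurable [measurable]:
  assumes "strict_mono (f :: int \<Rightarrow> int)"
  shows "(\<lambda>r. inv_image r f) \<in> measurable order_space order_space"
  using strict_linear_order_inv_image strict_mono_imp_inj_on[OF assms]
  by (intro measurable_order_spaceI) (auto simp: space_order_space)

locale spreadable_order = prob_space P for P :: "int rel measure" +
  assumes sets_P [measurable_cong]: "sets P = sets order_space" and I_inv: "I_invariant P"
begin

lemma space_P: "space P = {r. strict_linear_order r}"
  using sets_eq_imp_space_eq[OF sets_P] by (simp add: space_order_space)

lemma AE_transport:
  assumes "strict_mono f" "AE r in P. Q r"
  shows "AE r in P. Q (inv_image r f)"
proof (rule AE_distrD[where M' = P])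
  show "(\<lambda>r. inv_image r f) \<in> measurable P P" using inv_image_measurable[OF assms(1)]
    by (simp add: measurable_cong_sets[OF sets_P sets_P])
  have "distr P P (\<lambda>r. inv_image r f) = distr P order_space (\<lambda>r. inv_image r f)"
    by (rule distr_cong) (auto simp: sets_P)
  also have "\<dots> = P" using I_inv assms(1) by (auto simp: I_invariant_def)
  finally have eq: "distr P P (\<lambda>r. inv_image r f) = P" .
  show "AE x in distr P P (\<lambda>r. inv_image r f). Q x" unfolding eq by (rule assms(2))
qed

lemma expectation_transport:
  fixes F F' :: "int rel \<Rightarrow> real"
  assumes "F \<in> borel_measurable P" "F' \<in> borel_measurable P" "strict_mono f"
    and "AE r in P. F (inv_image r f) = F' r"
  shows "expectation F = expectation F'"
proof -
  have m: "(\<lambda>r. inv_image r f) \<in> measurable P order_space" using inv_image_measurable[OF assms(3)]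
    by (simp add: measurable_cong_sets[OF sets_P refl])
  have "distr P order_space (\<lambda>r. inv_image r f) = P" using I_inv assms(3) by (auto simp: I_invariant_def)
  then have "expectation F = (\<integral>r. F r \<partial>distr P order_space (\<lambda>r. inv_image r f))" by simp
  also have "\<dots> = expectation (\<lambda>r. F (inv_image r f))"
    using m assms(1) by (intro integral_distr) (auto simp: measurable_cong_sets[OF sets_P refl])
  also have "\<dots> = expectation F'"
    using assms(2,4) measurable_compose[OF m, of F borel] assms(1)
    by (intro integral_cong_AE) (auto simp: measurable_cong_sets[OF sets_P refl])
  finally show ?thesis .
qed

text \<open>There are uncountably many increasing maps, so the exceptional null set is allowed to
  depend on the map; likewise for \<open>equivariant\<close> and
  \<open>equivariant2\<close>.\<close>

definition invariant :: "(int rel \<Rightarrow> 'b::topological_space) \<Rightarrow> bool" where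
  "invariant G \<longleftrightarrow> G \<in> borel_measurable P \<and>
     (\<forall>f. strict_mono f \<longrightarrow> (AE r in P. G (inv_image r f) = G r))"

definition equivariant :: "(int \<Rightarrow> int rel \<Rightarrow> 'b::topological_space) \<Rightarrow> bool" where
  "equivariant w \<longleftrightarrow> (\<forall>n. w n \<in> borel_measurable P) \<and>
     (\<forall>f n. strict_mono f \<longrightarrow> (AE r in P. w n (inv_image r f) = w (f n) r))"

definition equivariant2 :: "(int \<Rightarrow> int \<Rightarrow> int rel \<Rightarrow> real) \<Rightarrow> bool" where
  "equivariant2 \<psi> \<longleftrightarrow> (\<forall>k n. \<psi> k n \<in> borel_measurable P) \<and> (\<forall>k n r. \<bar>\<psi> k n r\<bar> \<le> 1) \<and>
     (\<forall>f k n. strict_mono f \<longrightarrow> (AE r in P. \<psi> k n (inv_image r f) = \<psi> (f k) (f n) r))"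

lemma equivariantD:
  assumes "equivariant w"
  shows "w n \<in> borel_measurable P" "strict_mono f \<Longrightarrow> AE r in P. w n (inv_image r f) = w (f n) r"
  using assms by (auto simp: equivariant_def)

lemma equivariant2D:
  assumes "equivariant2 \<psi>"
  shows "\<psi> k n \<in> borel_measurable P" "\<bar>\<psi> k n r\<bar> \<le> 1"
    "strict_mono f \<Longrightarrow> AE r in P. \<psi> k n (inv_image r f) = \<psi> (f k) (f n) r"
  using assms by (auto simp: equivariant2_def)

lemma invariantD:
  assumes "invariant G"
  shows "G \<in> borel_measurable P" "strict_mono f \<Longrightarrow> AE r in P. G (inv_image r f) = G r"
  using assms by (auto simp: invariant_def)

lemma ex_strict_mono3:
  assumes "(a::int) < b" "b < c"
  obtains f :: "int \<Rightarrow> int" where "strict_mono f" "f 0 = a" "f 1 = b" "f 2 = c"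
proof
  let ?f = "\<lambda>n. if n \<le> 0 then a + n else if n = 1 then b else c + n - 2"
  show "strict_mono ?f" using assms by (auto simp: strict_mono_def)
qed auto

text \<open>These push the index \<open>b\<close> through infinitely many positions while all
  indices on its other side stay fixed; averaging over \<open>s\<close> then replaces the index by a
  mean.\<close>

lemma strict_mono_shift_up: "strict_mono (\<lambda>i. if i < b then i else i + int s)"
  and strict_mono_shift_down: "strict_mono (\<lambda>i. if i \<le> b then i - int s else i)"
  by (auto simp: strict_mono_def)

lemma equivariant_correlation:
  assumes "equivariant (\<phi> :: int \<Rightarrow> int rel \<Rightarrow> real)"
  shows "i \<noteq> j \<Longrightarrow> expectation (\<lambda>r. \<phi> i r * \<phi> j r) = expectation (\<lambda>r. \<phi> 0 r * \<phi> 1 r)"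
proof -
  note [measurable] = equivariantD(1)[OF assms]
  have *: "expectation (\<lambda>r. \<phi> i r * \<phi> j r) = expectation (\<lambda>r. \<phi> 0 r * \<phi> 1 r)" if ij: "i < j" for i j
  proof -
    obtain f :: "int \<Rightarrow> int" where f: "strict_mono f" "f 0 = i" "f 1 = j" "f 2 = j + 1"
      by (rule ex_strict_mono3[OF ij, of "j + 1"]) auto
    show ?thesis
    proof (rule expectation_transport[symmetric, OF _ _ f(1)])
      show "AE r in P. \<phi> 0 (inv_image r f) * \<phi> 1 (inv_image r f) = \<phi> i r * \<phi> j r"
        using equivariantD(2)[OF assms f(1), of 0] equivariantD(2)[OF assms f(1), of 1]
        by eventually_elim (simp add: f)
    qed simp_all
  qed
  assume "i \<noteq> j"
  then show ?thesis using *[of i j] *[of j i] by (cases "i < j") (auto simp: mult.commute)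
qed

text \<open>Starting at 1 matches \<open>empirical_measure\<close>. By \<open>mean_limit\<close>
  every injective enumeration of indices has the same limit almost surely, for bounded equivariant
  families.\<close>

definition mean :: "(int \<Rightarrow> int rel \<Rightarrow> real) \<Rightarrow> int rel \<Rightarrow> real" where
  "mean \<phi> r = lim (cesaro (\<lambda>i. \<phi> (1 + int i) r))"

lemma mean_limit:
  assumes e: "equivariant \<phi>" and b: "\<And>n r. \<bar>\<phi> n r\<bar> \<le> 1" and s: "inj s"
  shows "AE r in P. cesaro (\<lambda>i. \<phi> (s i) r) \<longlonglongrightarrow> mean \<phi> r"
proof -
  interpret constant_correlation P UNIV \<phi> "expectation (\<lambda>r. \<phi> 0 r * \<phi> 1 r)"
    by unfold_locales (rule equivariantD(1)[OF e], rule b, rule equivariant_correlation[OF e])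
  have "inj (\<lambda>i. 1 + int i)" by (auto simp: inj_def)
  from strong_law[OF s _ this]
  have "AE r in P. \<exists>l. cesaro (\<lambda>i. \<phi> (s i) r) \<longlonglongrightarrow> l \<and> cesaro (\<lambda>i. \<phi> (1 + int i) r) \<longlonglongrightarrow> l" by simp
  then show ?thesis by eventually_elim (auto simp: mean_def limI)
qed

lemma mean_measurable:
  assumes "equivariant \<phi>"
  shows "mean \<phi> \<in> borel_measurable P"
proof -
  note [measurable] = equivariantD(1)[OF assms]
  show ?thesis unfolding mean_def cesaro_def by measurable
qed

text \<open>An increasing map turns the enumeration \<open>1 + int i\<close> into another injective
  one, to which \<open>mean_limit\<close> assigns the same limit.\<close>

lemma mean_invariant:
  assumes e: "equivariant \<phi>" and b: "\<And>n r. \<bar>\<phi> n r\<bar> \<le> 1"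
  shows "invariant (mean \<phi>)"
  unfolding invariant_def
proof (intro conjI allI impI mean_measurable e)
  fix f :: "int \<Rightarrow> int" assume f: "strict_mono f"
  have "inj (\<lambda>i. f (1 + int i))" using strict_mono_eq[OF f] by (auto simp: inj_def)
  from mean_limit[OF e b this]
  have 1: "AE r in P. cesaro (\<lambda>i. \<phi> (f (1 + int i)) r) \<longlonglongrightarrow> mean \<phi> r" .
  have "AE r in P. \<forall>i. \<phi> (1 + int i) (inv_image r f) = \<phi> (f (1 + int i)) r"
    by (subst AE_all_countable) (use equivariantD(2)[OF e f] in auto)
  with 1 show "AE r in P. mean \<phi> (inv_image r f) = mean \<phi> r"
    by eventually_elim (simp add: mean_def[of _ "inv_image _ _"] limI)
qed

lemma mean_bound:
  assumes e: "equivariant \<phi>" and b: "\<And>n r. \<bar>\<phi> n r\<bar> \<le> 1"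
  shows "AE r in P. \<bar>mean \<phi> r\<bar> \<le> 1"
proof -
  have "inj (\<lambda>i::nat. int i)" by (auto simp: inj_def)
  from mean_limit[OF e b this] show ?thesis
  proof eventually_elim
    case (elim r)
    from tendsto_rabs[OF this] show ?case
      by (rule LIMSEQ_le_const2) (use cesaro_abs_le b in auto)
  qed
qed

text \<open>Induction on the largest index \<open>b\<close>: it can be pushed to infinity while the
  smaller indices stay fixed, so its factor may be replaced by its mean. The mean is invariant and
  joins the weight, which is why \<open>G\<close> is arbitrary in the induction.\<close>

lemma expectation_prod_ordered:
  assumes "finite J" and "\<And>j. j \<in> J \<Longrightarrow> equivariant (\<phi> j)"
    and "\<And>j n r. \<bar>\<phi> j n r\<bar> \<le> 1" and "invariant G" and "AE r in P. \<bar>G r\<bar> \<le> 1"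
  shows "expectation (\<lambda>r. (\<Prod>j\<in>J. \<phi> j j r) * G r) = expectation (\<lambda>r. (\<Prod>j\<in>J. mean (\<phi> j) r) * G r)"
  using assms
proof (induction J arbitrary: G rule: finite_linorder_max_induct)
  case empty
  then show ?case by simp
next
  case (insert b A)
  have eA: "\<And>j. j \<in> A \<Longrightarrow> equivariant (\<phi> j)" and eb: "equivariant (\<phi> b)" using insert.prems(1) by auto
  note bd = insert.prems(2)
  note [measurable] = equivariantD(1)[OF eA] equivariantD(1)[OF eb] invariantD(1)[OF insert.prems(3)]
    mean_measurable[OF eb]
  have nA: "b \<notin> A" using insert.hyps by auto
  let ?W = "\<lambda>r. (\<Prod>j\<in>A. \<phi> j j r) * G r"
  have mW: "?W \<in> borel_measurable P" by (intro borel_measurable_times borel_measurable_prod) auto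
  have inj: "inj (\<lambda>s. b + int s)" by (auto simp: inj_def)
  have "expectation (\<lambda>r. mean (\<phi> b) r * ?W r) = expectation (\<lambda>r. \<phi> b b r * ?W r)"
  proof (rule expectation_averaged[where \<zeta> = "\<lambda>s. \<phi> b (b + int s)"])
    show "?W \<in> borel_measurable P" by (rule mW)
    show "AE r in P. \<bar>?W r\<bar> \<le> 1"
      using insert.prems(4)
    proof eventually_elim
      case (elim r)
      have "\<bar>\<Prod>j\<in>A. \<phi> j j r\<bar> \<le> 1" unfolding abs_prod by (intro prod_le_1) (use bd in auto)
      then show ?case using elim by (auto simp: abs_mult intro: mult_le_one)
    qed
    show "AE r in P. cesaro (\<lambda>s. \<phi> b (b + int s) r) \<longlonglongrightarrow> mean (\<phi> b) r"
      by (rule mean_limit[OF eb bd inj])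
    fix s
    let ?f = "\<lambda>i. if i < b then i else i + int s"
    have sm: "strict_mono ?f" by (rule strict_mono_shift_up)
    show "expectation (\<lambda>r. \<phi> b (b + int s) r * ?W r) = expectation (\<lambda>r. \<phi> b b r * ?W r)"
    proof (rule expectation_transport[symmetric, OF _ _ sm])
      have "AE r in P. \<forall>j\<in>A. \<phi> j j (inv_image r ?f) = \<phi> j (?f j) r"
        using insert.hyps(1) by (intro AE_finite_allI equivariantD(2)[OF eA sm]) auto
      moreover have "AE r in P. \<phi> b b (inv_image r ?f) = \<phi> b (?f b) r"
        by (rule equivariantD(2)[OF eb sm])
      moreover have "AE r in P. G (inv_image r ?f) = G r"
        by (rule invariantD(2)[OF insert.prems(3) sm])
      ultimately show "AE r in P. \<phi> b b (inv_image r ?f) * ?W (inv_image r ?f) = \<phi> b (b + int s) r * ?W r"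
      proof eventually_elim
        case (elim r)
        have "(\<Prod>j\<in>A. \<phi> j j (inv_image r ?f)) = (\<Prod>j\<in>A. \<phi> j j r)"
          using elim(1) insert.hyps(2) by (intro prod.cong) auto
        then show ?case using elim by simp
      qed
    qed (use mW in auto)
  qed (use bd in auto)
  moreover have "expectation (\<lambda>r. (\<Prod>j\<in>A. \<phi> j j r) * (mean (\<phi> b) r * G r)) =
      expectation (\<lambda>r. (\<Prod>j\<in>A. mean (\<phi> j) r) * (mean (\<phi> b) r * G r))"
  proof (rule insert.IH)
    show "invariant (\<lambda>r. mean (\<phi> b) r * G r)"
      unfolding invariant_def
    proof (intro conjI allI impI)
      fix f :: "int \<Rightarrow> int" assume f: "strict_mono f"
      show "AE r in P. mean (\<phi> b) (inv_image r f) * G (inv_image r f) = mean (\<phi> b) r * G r"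
        using invariantD(2)[OF mean_invariant[OF eb bd] f] invariantD(2)[OF insert.prems(3) f]
        by eventually_elim simp
    qed simp
    show "AE r in P. \<bar>mean (\<phi> b) r * G r\<bar> \<le> 1"
      using insert.prems(4) mean_bound[OF eb bd]
      by eventually_elim (auto simp: abs_mult intro: mult_le_one)
  qed (use eA bd in auto)
  ultimately show ?case
    using nA insert.hyps(1) by (simp add: mult_ac)
qed

text \<open>The factors are labelled by \<open>J\<close> but placed at the positions
  \<open>g j\<close>, in any order. Since the right-hand side does not involve \<open>g\<close>,
  this is the source of exchangeability.\<close>

lemma expectation_prod:
  assumes J: "finite J" and g: "inj_on g J" and e: "\<And>j. j \<in> J \<Longrightarrow> equivariant (\<phi> j)"
    and b: "\<And>j n r. \<bar>\<phi> j n r\<bar> \<le> 1" and G: "invariant G" "AE r in P. \<bar>G r\<bar> \<le> 1"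
  shows "expectation (\<lambda>r. (\<Prod>j\<in>J. \<phi> j (g j) r) * G r) = expectation (\<lambda>r. (\<Prod>j\<in>J. mean (\<phi> j) r) * G r)"
proof -
  let ?\<phi> = "\<lambda>i. \<phi> (inv_into J g i)"
  have "expectation (\<lambda>r. (\<Prod>i\<in>g ` J. ?\<phi> i i r) * G r) = expectation (\<lambda>r. (\<Prod>i\<in>g ` J. mean (?\<phi> i) r) * G r)"
    by (rule expectation_prod_ordered) (use assms in \<open>auto simp: inv_into_into\<close>)
  then show ?thesis using g by (simp add: prod.reindex)
qed

lemma equivariant_comp:
  assumes "equivariant w" "h \<in> borel_measurable borel"
  shows "equivariant (\<lambda>n r. h (w n r))"
  unfolding equivariant_def
proof (intro conjI allI impI)
  show "(\<lambda>r. h (w n r)) \<in> borel_measurable P" for n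
    using measurable_compose[OF equivariantD(1)[OF assms(1)] assms(2)] .
  fix f :: "int \<Rightarrow> int" and n assume "strict_mono f"
  from equivariantD(2)[OF assms(1) this, of n]
  show "AE r in P. h (w n (inv_image r f)) = h (w (f n) r)" by eventually_elim simp
qed

text \<open>Both sides are masses under image measures of the density \<open>G\<close>; by
  \<open>expectation_prod\<close> these agree on lower cylinders. The weight makes the statement
  usable on invariant events, and injections instead of permutations let \<open>cmp_limit\<close>
  prescribe finitely many values freely.\<close>

lemma exchangeable_under_injection:
  fixes w :: "int \<Rightarrow> int rel \<Rightarrow> 'b::ordered_euclidean_space"
  assumes w: "equivariant w" and G: "invariant G" "\<And>r. 0 \<le> G r" "\<And>r. G r \<le> (1::real)"
    and g: "inj g" and A: "A \<in> sets (\<Pi>\<^sub>M n\<in>(UNIV::int set). borel)"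
  shows "expectation (\<lambda>r. indicator A (\<lambda>n. w (g n) r) * G r) = expectation (\<lambda>r. indicator A (\<lambda>n. w n r) * G r)"
proof -
  let ?PI = "\<Pi>\<^sub>M n\<in>(UNIV::int set). (borel :: 'b measure)"
  note [measurable] = equivariantD(1)[OF w] invariantD(1)[OF G(1)]
  define N where "N h = distr (density P (\<lambda>r. ennreal (G r))) ?PI (\<lambda>r n. w (h n) r)" for h :: "int \<Rightarrow> int"
  have mz: "(\<lambda>r n. w (h n) r) \<in> measurable P ?PI" for h :: "int \<Rightarrow> int"
    by (rule measurable_PiM_single') auto
  have em: "emeasure (N h) B = ennreal (expectation (\<lambda>r. indicator B (\<lambda>n. w (h n) r) * G r))"
    if B: "B \<in> sets ?PI" for B h
  proof -
    have mB: "(\<lambda>r. indicator B (\<lambda>n. w (h n) r) :: real) \<in> borel_measurable P"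
      using measurable_compose[OF mz[of h] borel_measurable_indicator[OF B]] .
    have "emeasure (N h) B = emeasure (density P (\<lambda>r. ennreal (G r))) ((\<lambda>r n. w (h n) r) -` B \<inter> space P)"
      unfolding N_def using mz[of h] B by (subst emeasure_distr) (auto simp: measurable_def)
    also have "\<dots> = (\<integral>\<^sup>+r. ennreal (G r) * indicator ((\<lambda>r n. w (h n) r) -` B \<inter> space P) r \<partial>P)"
      using measurable_sets[OF mz[of h] B] by (subst emeasure_density) auto
    also have "\<dots> = (\<integral>\<^sup>+r. ennreal (indicator B (\<lambda>n. w (h n) r) * G r) \<partial>P)"
      by (rule nn_integral_cong) (auto simp: indicator_def)
    also have "\<dots> = ennreal (expectation (\<lambda>r. indicator B (\<lambda>n. w (h n) r) * G r))"
      using mB G by (intro nn_integral_eq_integral integrable_bounded_real[where B = 1])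
        (auto simp: indicator_def)
    finally show ?thesis .
  qed
  have "N g = N (\<lambda>n. n)"
  proof (rule measure_eqI_PiM_atMost)
    fix J :: "int set" and a :: "int \<Rightarrow> 'b" assume J: "finite J"
    let ?B = "{z. \<forall>j\<in>J. z j \<le> a j}"
    have B: "?B \<in> sets ?PI" unfolding sets_PiM_atMost using J by (intro sigma_sets.Basic lower_cylindersI)
    have ind: "indicator ?B (\<lambda>n. w (h n) r) = (\<Prod>j\<in>J. indicator {..a j} (w (h j) r) :: real)" for h r
      using J by (auto simp: indicator_def prod_eq_1_iff intro!: prod_zero)
    have "expectation (\<lambda>r. indicator ?B (\<lambda>n. w (h n) r) * G r) =
       expectation (\<lambda>r. (\<Prod>j\<in>J. mean (\<lambda>n r. indicator {..a j} (w n r)) r) * G r)" if "inj h" for h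
      unfolding ind
    proof (rule expectation_prod[OF J])
      show "inj_on h J" using that by (simp add: inj_on_def inj_def)
      show "equivariant (\<lambda>n r. indicator {..a j} (w n r) :: real)" for j
        by (rule equivariant_comp[OF w]) simp
      show "AE r in P. \<bar>G r\<bar> \<le> 1" using G by simp
    qed (use G in \<open>auto simp: indicator_def\<close>)
    from this[OF g] this[of "\<lambda>n. n"]
    show "emeasure (N g) ?B = emeasure (N (\<lambda>n. n)) ?B" unfolding em[OF B] by simp
  next
    have "UNIV \<in> sets ?PI" using sets.top[of ?PI] by (simp add: space_PiM)
    from em[OF this] show "emeasure (N g) UNIV \<noteq> \<infinity>" by simp
  qed (auto simp: N_def)
  then have "ennreal (expectation (\<lambda>r. indicator A (\<lambda>n. w (g n) r) * G r)) =
     ennreal (expectation (\<lambda>r. indicator A (\<lambda>n. w n r) * G r))"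
    by (simp only: em[OF A, symmetric])
  moreover have "0 \<le> expectation (\<lambda>r. indicator A (\<lambda>n. w (h n) r) * G r)" for h
    using G by (intro integral_nonneg_AE) auto
  ultimately show ?thesis by (subst (asm) ennreal_inj) auto
qed

end

lemma cesaro_unshift:
  assumes "cesaro (\<lambda>i. u (i + k)) \<longlonglongrightarrow> l"
  shows "cesaro u \<longlonglongrightarrow> l"
  unfolding cesaro_def
proof (rule sum_shift_div_tendsto[OF assms, where c = "- int k" and d = "\<Sum>i<k. u i"])
  show "\<forall>\<^sub>F N in sequentially. (\<Sum>i<N. u i) = (\<Sum>i<nat (int N + - int k). u (i + k)) + sum u {..<k}"
    using eventually_ge_at_top[of k]
  proof eventually_elim
    case (elim N)
    then obtain p where N: "N = p + k" by (metis le_add_diff_inverse2)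
    have "sum u {..<p + k} = sum u {..<k} + (\<Sum>i<p. u (i + k))" by (induction p) auto
    then show ?case by (simp add: N)
  qed
qed

lemma abs_mult_le_one: "\<bar>a\<bar> \<le> 1 \<Longrightarrow> \<bar>b\<bar> \<le> 1 \<Longrightarrow> \<bar>a * b\<bar> \<le> (1::real)"
  by (simp add: abs_mult mult_le_one del: abs_mult_self_eq)

section \<open>One-sided means of families with two indices\<close>

context spreadable_order
begin

lemma equivariant_expectation:
  assumes "equivariant (\<phi> :: int \<Rightarrow> int rel \<Rightarrow> real)"
  shows "expectation (\<phi> m) = expectation (\<phi> n)"
proof (rule expectation_transport)
  show "strict_mono (\<lambda>i. i + (n - m))" by (auto simp: strict_mono_def)
  from equivariantD(2)[OF assms this, of m]
  show "AE r in P. \<phi> m (inv_image r (\<lambda>i. i + (n - m))) = \<phi> n r" by simp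
qed (rule equivariantD(1)[OF assms])+

lemma equivariant_comp2:
  fixes v :: "int \<Rightarrow> int rel \<Rightarrow> 'b::second_countable_topology"
    and w :: "int \<Rightarrow> int rel \<Rightarrow> 'c::second_countable_topology"
  assumes "equivariant v" "equivariant w" "(\<lambda>p. h (fst p) (snd p)) \<in> borel_measurable (borel \<Otimes>\<^sub>M borel)"
  shows "equivariant (\<lambda>n r. h (v n r) (w n r))"
  unfolding equivariant_def
proof (intro conjI allI impI)
  note [measurable] = equivariantD(1)[OF assms(1)] equivariantD(1)[OF assms(2)]
  have "(\<lambda>r. (v n r, w n r)) \<in> P \<rightarrow>\<^sub>M borel \<Otimes>\<^sub>M borel" for n by measurable
  from measurable_compose[OF this assms(3)]
  show "(\<lambda>r. h (v n r) (w n r)) \<in> borel_measurable P" for n by simp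
  fix f :: "int \<Rightarrow> int" and n assume f: "strict_mono f"
  from equivariantD(2)[OF assms(1) f, of n] equivariantD(2)[OF assms(2) f, of n]
  show "AE r in P. h (v n (inv_image r f)) (w n (inv_image r f)) = h (v (f n) r) (w (f n) r)"
    by eventually_elim simp
qed

definition left_mean :: "(int \<Rightarrow> int \<Rightarrow> int rel \<Rightarrow> real) \<Rightarrow> int \<Rightarrow> int rel \<Rightarrow> real" where
  "left_mean \<psi> n r = lim (cesaro (\<lambda>i. \<psi> (n - 1 - int i) n r))"

definition right_mean :: "(int \<Rightarrow> int \<Rightarrow> int rel \<Rightarrow> real) \<Rightarrow> int \<Rightarrow> int rel \<Rightarrow> real" where
  "right_mean \<psi> n r = lim (cesaro (\<lambda>i. \<psi> (n + 1 + int i) n r))"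

text \<open>An increasing map preserves the side of \<open>n\<close>, so the moments of pairs on the
  left and of pairs on the right are two constants that need not agree; hence the two separate
  means.\<close>

lemma one_sided_correlation:
  assumes e: "equivariant2 \<psi>" and ij: "i \<noteq> j"
  shows "i < n \<Longrightarrow> j < n \<Longrightarrow> expectation (\<lambda>r. \<psi> i n r * \<psi> j n r) = expectation (\<lambda>r. \<psi> 0 2 r * \<psi> 1 2 r)"
    and "n < i \<Longrightarrow> n < j \<Longrightarrow> expectation (\<lambda>r. \<psi> i n r * \<psi> j n r) = expectation (\<lambda>r. \<psi> 1 0 r * \<psi> 2 0 r)"
proof -
  note [measurable] = equivariant2D(1)[OF e]
  have tr: "expectation (\<lambda>r. \<psi> (f a) (f c) r * \<psi> (f b) (f c) r) = expectation (\<lambda>r. \<psi> a c r * \<psi> b c r)"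
    if f: "strict_mono f" for f a b c
  proof (rule expectation_transport[symmetric, OF _ _ f])
    show "AE r in P. \<psi> a c (inv_image r f) * \<psi> b c (inv_image r f) = \<psi> (f a) (f c) r * \<psi> (f b) (f c) r"
      using equivariant2D(3)[OF e f, of a c] equivariant2D(3)[OF e f, of b c] by eventually_elim simp
  qed simp_all
  have L: "expectation (\<lambda>r. \<psi> i n r * \<psi> j n r) = expectation (\<lambda>r. \<psi> 0 2 r * \<psi> 1 2 r)"
    if ij: "i < j" and jn: "j < n" for i j
    by (rule ex_strict_mono3[OF ij jn]) (use tr[of _ 0 2 1] in auto)
  have R: "expectation (\<lambda>r. \<psi> i n r * \<psi> j n r) = expectation (\<lambda>r. \<psi> 1 0 r * \<psi> 2 0 r)"
    if ij: "i < j" and ni: "n < i" for i j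
    by (rule ex_strict_mono3[OF ni ij]) (use tr[of _ 1 0 2] in auto)
  show "expectation (\<lambda>r. \<psi> i n r * \<psi> j n r) = expectation (\<lambda>r. \<psi> 0 2 r * \<psi> 1 2 r)" if "i < n" "j < n"
    using L[of i j] L[of j i] ij that by (cases "i < j") (auto simp: mult.commute)
  show "expectation (\<lambda>r. \<psi> i n r * \<psi> j n r) = expectation (\<lambda>r. \<psi> 1 0 r * \<psi> 2 0 r)" if "n < i" "n < j"
    using R[of i j] R[of j i] ij that by (cases "i < j") (auto simp: mult.commute)
qed

lemma left_mean_limit:
  assumes e: "equivariant2 \<psi>" and s: "inj s" "\<And>i. s i < n"
  shows "AE r in P. cesaro (\<lambda>i. \<psi> (s i) n r) \<longlonglongrightarrow> left_mean \<psi> n r"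
proof -
  interpret constant_correlation P "{..<n}" "\<lambda>k. \<psi> k n" "expectation (\<lambda>r. \<psi> 0 2 r * \<psi> 1 2 r)"
    by unfold_locales (rule equivariant2D[OF e], rule equivariant2D[OF e],
        rule one_sided_correlation[OF e], simp_all)
  have "AE r in P. \<exists>l. cesaro (\<lambda>i. \<psi> (s i) n r) \<longlonglongrightarrow> l \<and> cesaro (\<lambda>i. \<psi> (n - 1 - int i) n r) \<longlonglongrightarrow> l"
    by (rule strong_law) (use s in \<open>auto simp: inj_def\<close>)
  then show ?thesis by eventually_elim (auto simp: left_mean_def limI)
qed

lemma right_mean_limit:
  assumes e: "equivariant2 \<psi>" and s: "inj s" "\<And>i. n < s i"
  shows "AE r in P. cesaro (\<lambda>i. \<psi> (s i) n r) \<longlonglongrightarrow> right_mean \<psi> n r"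
proof -
  interpret constant_correlation P "{n<..}" "\<lambda>k. \<psi> k n" "expectation (\<lambda>r. \<psi> 1 0 r * \<psi> 2 0 r)"
    by unfold_locales (rule equivariant2D[OF e], rule equivariant2D[OF e],
        rule one_sided_correlation[OF e], simp_all)
  have "AE r in P. \<exists>l. cesaro (\<lambda>i. \<psi> (s i) n r) \<longlonglongrightarrow> l \<and> cesaro (\<lambda>i. \<psi> (n + 1 + int i) n r) \<longlonglongrightarrow> l"
    by (rule strong_law) (use s in \<open>auto simp: inj_def\<close>)
  then show ?thesis by eventually_elim (auto simp: right_mean_def limI)
qed

lemma equivariant_left_mean:
  assumes e: "equivariant2 \<psi>"
  shows "equivariant (left_mean \<psi>)"
  unfolding equivariant_def
proof (intro conjI allI impI)
  note [measurable] = equivariant2D(1)[OF e]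
  show "left_mean \<psi> n \<in> borel_measurable P" for n unfolding left_mean_def cesaro_def by measurable
  fix f :: "int \<Rightarrow> int" and n assume f: "strict_mono f"
  have "AE r in P. cesaro (\<lambda>i. \<psi> (f (n - 1 - int i)) (f n) r) \<longlonglongrightarrow> left_mean \<psi> (f n) r"
    by (rule left_mean_limit[OF e]) (use strict_mono_eq[OF f] strict_mono_less[OF f] in \<open>auto simp: inj_def\<close>)
  moreover have "AE r in P. \<forall>i. \<psi> (n - 1 - int i) n (inv_image r f) = \<psi> (f (n - 1 - int i)) (f n) r"
    by (subst AE_all_countable) (use equivariant2D(3)[OF e f] in auto)
  ultimately show "AE r in P. left_mean \<psi> n (inv_image r f) = left_mean \<psi> (f n) r"
    by eventually_elim (simp add: left_mean_def[of _ _ "inv_image _ _"] limI)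
qed

lemma equivariant_right_mean:
  assumes e: "equivariant2 \<psi>"
  shows "equivariant (right_mean \<psi>)"
  unfolding equivariant_def
proof (intro conjI allI impI)
  note [measurable] = equivariant2D(1)[OF e]
  show "right_mean \<psi> n \<in> borel_measurable P" for n unfolding right_mean_def cesaro_def by measurable
  fix f :: "int \<Rightarrow> int" and n assume f: "strict_mono f"
  have "AE r in P. cesaro (\<lambda>i. \<psi> (f (n + 1 + int i)) (f n) r) \<longlonglongrightarrow> right_mean \<psi> (f n) r"
    by (rule right_mean_limit[OF e]) (use strict_mono_eq[OF f] strict_mono_less[OF f] in \<open>auto simp: inj_def\<close>)
  moreover have "AE r in P. \<forall>i. \<psi> (n + 1 + int i) n (inv_image r f) = \<psi> (f (n + 1 + int i)) (f n) r"
    by (subst AE_all_countable) (use equivariant2D(3)[OF e f] in auto)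
  ultimately show "AE r in P. right_mean \<psi> n (inv_image r f) = right_mean \<psi> (f n) r"
    by eventually_elim (simp add: right_mean_def[of _ _ "inv_image _ _"] limI)
qed

lemma left_mean_default: "equivariant2 \<psi> \<Longrightarrow> AE r in P. cesaro (\<lambda>i. \<psi> (n - 1 - int i) n r) \<longlonglongrightarrow> left_mean \<psi> n r"
  by (rule left_mean_limit) (auto simp: inj_def)

lemma right_mean_default: "equivariant2 \<psi> \<Longrightarrow> AE r in P. cesaro (\<lambda>i. \<psi> (n + 1 + int i) n r) \<longlonglongrightarrow> right_mean \<psi> n r"
  by (rule right_mean_limit) (auto simp: inj_def)

text \<open>The maps that lower the indices up to \<open>k\<close> and fix the rest leave
  \<open>W\<close> unchanged, and the values of \<open>\<psi>\<close> along \<open>k - int s\<close>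
  average to \<open>left_mean \<psi> n\<close>. The weight may therefore involve any indices above
  \<open>k\<close>.\<close>

lemma expectation_average_left:
  assumes e: "equivariant2 \<psi>" and W: "W \<in> borel_measurable P" "AE r in P. \<bar>W r\<bar> \<le> 1"
    and k: "k < n"
    and inv: "\<And>f. strict_mono f \<Longrightarrow> (\<And>i. k < i \<Longrightarrow> f i = i) \<Longrightarrow> AE r in P. W (inv_image r f) = W r"
  shows "expectation (\<lambda>r. \<psi> k n r * W r) = expectation (\<lambda>r. left_mean \<psi> n r * W r)"
proof (rule sym, rule expectation_averaged[where \<zeta> = "\<lambda>s. \<psi> (k - int s) n"])
  note [measurable] = equivariant2D(1)[OF e] W(1)
  show "AE r in P. cesaro (\<lambda>s. \<psi> (k - int s) n r) \<longlonglongrightarrow> left_mean \<psi> n r"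
    by (rule left_mean_limit[OF e]) (use k in \<open>auto simp: inj_def\<close>)
  fix s
  let ?f = "\<lambda>i. if i \<le> k then i - int s else i"
  have f: "strict_mono ?f" by (rule strict_mono_shift_down)
  show "expectation (\<lambda>r. \<psi> (k - int s) n r * W r) = expectation (\<lambda>r. \<psi> k n r * W r)"
  proof (rule expectation_transport[symmetric, OF _ _ f])
    have "AE r in P. W (inv_image r ?f) = W r" by (rule inv[OF f]) auto
    with equivariant2D(3)[OF e f, of k n]
    show "AE r in P. \<psi> k n (inv_image r ?f) * W (inv_image r ?f) = \<psi> (k - int s) n r * W r"
      by eventually_elim (use k in simp)
  qed simp_all
qed (use W equivariant2D[OF e] equivariantD(1)[OF equivariant_left_mean[OF e]] in auto)

lemma expectation_average_right:
  assumes e: "equivariant2 \<psi>" and W: "W \<in> borel_measurable P" "AE r in P. \<bar>W r\<bar> \<le> 1"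
    and k: "n < k"
    and inv: "\<And>f. strict_mono f \<Longrightarrow> (\<And>i. i < k \<Longrightarrow> f i = i) \<Longrightarrow> AE r in P. W (inv_image r f) = W r"
  shows "expectation (\<lambda>r. \<psi> k n r * W r) = expectation (\<lambda>r. right_mean \<psi> n r * W r)"
proof (rule sym, rule expectation_averaged[where \<zeta> = "\<lambda>s. \<psi> (k + int s) n"])
  note [measurable] = equivariant2D(1)[OF e] W(1)
  show "AE r in P. cesaro (\<lambda>s. \<psi> (k + int s) n r) \<longlonglongrightarrow> right_mean \<psi> n r"
    by (rule right_mean_limit[OF e]) (use k in \<open>auto simp: inj_def\<close>)
  fix s
  let ?f = "\<lambda>i. if i < k then i else i + int s"
  have f: "strict_mono ?f" by (rule strict_mono_shift_up)
  show "expectation (\<lambda>r. \<psi> (k + int s) n r * W r) = expectation (\<lambda>r. \<psi> k n r * W r)"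
  proof (rule expectation_transport[symmetric, OF _ _ f])
    have "AE r in P. W (inv_image r ?f) = W r" by (rule inv[OF f]) auto
    with equivariant2D(3)[OF e f, of k n]
    show "AE r in P. \<psi> k n (inv_image r ?f) * W (inv_image r ?f) = \<psi> (k + int s) n r * W r"
      by eventually_elim (use k in simp)
  qed simp_all
qed (use W equivariant2D[OF e] equivariantD(1)[OF equivariant_right_mean[OF e]] in auto)

lemma
  assumes e: "equivariant2 \<psi>" and G: "equivariant G" "AE r in P. \<bar>G n r\<bar> \<le> 1"
  shows expectation_left_equivariant:
      "k < n \<Longrightarrow> expectation (\<lambda>r. \<psi> k n r * G n r) = expectation (\<lambda>r. left_mean \<psi> n r * G n r)"
    and expectation_right_equivariant:
      "n < k \<Longrightarrow> expectation (\<lambda>r. \<psi> k n r * G n r) = expectation (\<lambda>r. right_mean \<psi> n r * G n r)"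
proof -
  have inv: "AE r in P. G n (inv_image r f) = G n r" if "strict_mono f" "f n = n" for f
    using equivariantD(2)[OF G(1) that(1), of n] that(2) by simp
  show "k < n \<Longrightarrow> expectation (\<lambda>r. \<psi> k n r * G n r) = expectation (\<lambda>r. left_mean \<psi> n r * G n r)"
    by (rule expectation_average_left[OF e equivariantD(1)[OF G(1)] G(2)]) (use inv in auto)
  show "n < k \<Longrightarrow> expectation (\<lambda>r. \<psi> k n r * G n r) = expectation (\<lambda>r. right_mean \<psi> n r * G n r)"
    by (rule expectation_average_right[OF e equivariantD(1)[OF G(1)] G(2)]) (use inv in auto)
qed

lemma left_mean_bounds:
  assumes e: "equivariant2 \<psi>"
  shows "AE r in P. \<bar>left_mean \<psi> n r\<bar> \<le> 1"
  using left_mean_default[OF e, of n]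
proof eventually_elim
  case (elim r)
  from tendsto_rabs[OF this] show ?case
    by (rule LIMSEQ_le_const2) (use cesaro_abs_le equivariant2D(2)[OF e] in auto)
qed

lemma right_mean_bounds:
  assumes e: "equivariant2 \<psi>"
  shows "AE r in P. \<bar>right_mean \<psi> n r\<bar> \<le> 1"
  using right_mean_default[OF e, of n]
proof eventually_elim
  case (elim r)
  from tendsto_rabs[OF this] show ?case
    by (rule LIMSEQ_le_const2) (use cesaro_abs_le equivariant2D(2)[OF e] in auto)
qed

text \<open>The common second index lies at the right end, the left end or in the middle of
  \<open>k < m < n\<close>. An extreme index is averaged first, so that the remaining factor is not
  moved; after that the weight depends on the centre alone.\<close>

lemma
  assumes e: "equivariant2 \<psi>" "equivariant2 \<theta>" and kmn: "k < m" "m < n"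
  shows expectation_left_left:
      "expectation (\<lambda>r. \<psi> k n r * \<theta> m n r) = expectation (\<lambda>r. left_mean \<psi> n r * left_mean \<theta> n r)"
    and expectation_right_right:
      "expectation (\<lambda>r. \<psi> n k r * \<theta> m k r) = expectation (\<lambda>r. right_mean \<psi> k r * right_mean \<theta> k r)"
    and expectation_left_right:
      "expectation (\<lambda>r. \<psi> k m r * \<theta> n m r) = expectation (\<lambda>r. left_mean \<psi> m r * right_mean \<theta> m r)"
proof -
  have inv: "AE r in P. \<theta> a b (inv_image r f) = \<theta> a b r" if "strict_mono f" "f a = a" "f b = b" for f a b
    using equivariant2D(3)[OF e(2) that(1), of a b] that(2,3) by simp
  note meas = equivariant2D(1)[OF e(2)]
  note bd = equivariant2D(2)[OF e(2)]
  have "expectation (\<lambda>r. \<psi> k n r * \<theta> m n r) = expectation (\<lambda>r. left_mean \<psi> n r * \<theta> m n r)"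
    by (rule expectation_average_left[OF e(1) meas]) (use inv bd kmn in auto)
  also have "\<dots> = expectation (\<lambda>r. \<theta> m n r * left_mean \<psi> n r)" by (simp add: mult.commute)
  also have "\<dots> = expectation (\<lambda>r. left_mean \<theta> n r * left_mean \<psi> n r)"
    by (rule expectation_left_equivariant[OF e(2) equivariant_left_mean[OF e(1)] left_mean_bounds[OF e(1)] kmn(2)])
  finally show "expectation (\<lambda>r. \<psi> k n r * \<theta> m n r) = expectation (\<lambda>r. left_mean \<psi> n r * left_mean \<theta> n r)"
    by (simp add: mult.commute)
  have "expectation (\<lambda>r. \<psi> n k r * \<theta> m k r) = expectation (\<lambda>r. right_mean \<psi> k r * \<theta> m k r)"
    by (rule expectation_average_right[OF e(1) meas]) (use inv bd kmn in auto)
  also have "\<dots> = expectation (\<lambda>r. \<theta> m k r * right_mean \<psi> k r)" by (simp add: mult.commute)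
  also have "\<dots> = expectation (\<lambda>r. right_mean \<theta> k r * right_mean \<psi> k r)"
    by (rule expectation_right_equivariant[OF e(2) equivariant_right_mean[OF e(1)] right_mean_bounds[OF e(1)] kmn(1)])
  finally show "expectation (\<lambda>r. \<psi> n k r * \<theta> m k r) = expectation (\<lambda>r. right_mean \<psi> k r * right_mean \<theta> k r)"
    by (simp add: mult.commute)
  have "expectation (\<lambda>r. \<psi> k m r * \<theta> n m r) = expectation (\<lambda>r. left_mean \<psi> m r * \<theta> n m r)"
    by (rule expectation_average_left[OF e(1) meas]) (use inv bd kmn in auto)
  also have "\<dots> = expectation (\<lambda>r. \<theta> n m r * left_mean \<psi> m r)" by (simp add: mult.commute)
  also have "\<dots> = expectation (\<lambda>r. right_mean \<theta> m r * left_mean \<psi> m r)"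
    by (rule expectation_right_equivariant[OF e(2) equivariant_left_mean[OF e(1)] left_mean_bounds[OF e(1)] kmn(2)])
  finally show "expectation (\<lambda>r. \<psi> k m r * \<theta> n m r) = expectation (\<lambda>r. left_mean \<psi> m r * right_mean \<theta> m r)"
    by (simp add: mult.commute)
qed

section \<open>The left and right averages\<close>

definition below :: "int \<Rightarrow> int \<Rightarrow> int rel \<Rightarrow> real" where
  "below k n r = of_bool ((k, n) \<in> r)"

lemma mem_measurable_P [measurable]: "Measurable.pred P (\<lambda>r. (m, n) \<in> r)"
  using mem_measurable[of m n] by (simp add: measurable_cong_sets[OF sets_P refl])

lemma equivariant2_below: "equivariant2 below"
  unfolding equivariant2_def below_def by (auto simp: of_bool_def)

text \<open>Defined from the averages themselves and thus for every relation. The agreement with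
  \<open>left_mean below\<close> and, for \<open>Y\<close>, with \<open>right_mean below\<close>
  holds only almost surely; \<open>equivariant_cong\<close> transfers equivariance across
  it.\<close>

definition X :: "int \<Rightarrow> int rel \<Rightarrow> real" where "X n r = lim (left_average r n)"
definition Y :: "int \<Rightarrow> int rel \<Rightarrow> real" where "Y n r = lim (right_average r n)"

lemma left_average_tendsto:
  assumes "cesaro (\<lambda>i. below (n - 1 - int i) n r) \<longlonglongrightarrow> l"
  shows "left_average r n \<longlonglongrightarrow> l"
  unfolding left_average_def
\<comment> \<open>\<open>{- int N..<n}\<close> has \<open>N + n\<close> elements for large
  \<open>N\<close>, and \<open>d\<close> is the diagonal term \<open>k = n\<close> of the
  average.\<close>
proof (rule sum_shift_div_tendsto[OF assms, where c = n and d = "of_bool ((n, n) \<in> r)"])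
  show "\<forall>\<^sub>F N in sequentially. (\<Sum>k = - int N..n. of_bool ((k, n) \<in> r)) =
      (\<Sum>i<nat (int N + n). below (n - 1 - int i) n r) + of_bool ((n, n) \<in> r)"
    using eventually_ge_at_top[of "nat \<bar>n\<bar>"]
  proof eventually_elim
    case (elim N)
    have "{- int N..n} = insert n {- int N..<n}" using elim by auto
    then have "(\<Sum>k = - int N..n. of_bool ((k, n) \<in> r)) = of_bool ((n, n) \<in> r) + (\<Sum>k\<in>{- int N..<n}. below k n r)"
      by (simp add: below_def)
    also have "(\<Sum>k\<in>{- int N..<n}. below k n r) = (\<Sum>i<nat (int N + n). below (n - 1 - int i) n r)"
      by (rule sum.reindex_bij_witness[where j = "\<lambda>k. nat (n - 1 - k)" and i = "\<lambda>i. n - 1 - int i"]) auto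
    finally show ?case by simp
  qed
qed

lemma right_average_tendsto:
  assumes "cesaro (\<lambda>i. below (n + 1 + int i) n r) \<longlonglongrightarrow> l"
  shows "right_average r n \<longlonglongrightarrow> l"
  unfolding right_average_def
proof (rule sum_shift_div_tendsto[OF assms, where c = "- n" and d = "of_bool ((n, n) \<in> r)"])
  show "\<forall>\<^sub>F N in sequentially. (\<Sum>k = n..int N. of_bool ((k, n) \<in> r)) =
      (\<Sum>i<nat (int N + - n). below (n + 1 + int i) n r) + of_bool ((n, n) \<in> r)"
    using eventually_ge_at_top[of "nat \<bar>n\<bar>"]
  proof eventually_elim
    case (elim N)
    have "{n..int N} = insert n {n<..int N}" using elim by auto
    then have "(\<Sum>k = n..int N. of_bool ((k, n) \<in> r)) = of_bool ((n, n) \<in> r) + (\<Sum>k\<in>{n<..int N}. below k n r)"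
      by (simp add: below_def)
    also have "(\<Sum>k\<in>{n<..int N}. below k n r) = (\<Sum>i<nat (int N + - n). below (n + 1 + int i) n r)"
      by (rule sum.reindex_bij_witness[where j = "\<lambda>k. nat (k - n - 1)" and i = "\<lambda>i. n + 1 + int i"]) auto
    finally show ?case by simp
  qed
qed

lemma AE_averages: "AE r in P. \<forall>n. left_average r n \<longlonglongrightarrow> X n r \<and> right_average r n \<longlonglongrightarrow> Y n r"
proof -
  have "AE r in P. left_average r n \<longlonglongrightarrow> X n r \<and> right_average r n \<longlonglongrightarrow> Y n r" for n
    using left_mean_default[OF equivariant2_below, of n] right_mean_default[OF equivariant2_below, of n]
    by eventually_elim (auto dest!: left_average_tendsto right_average_tendsto simp: X_def Y_def limI)
  then show ?thesis by (intro AE_all_countable[THEN iffD2] allI)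
qed

lemma AE_X_eq: "AE r in P. X n r = left_mean below n r"
  using left_mean_default[OF equivariant2_below, of n]
  by eventually_elim (auto dest!: left_average_tendsto simp: X_def limI)

lemma AE_Y_eq: "AE r in P. Y n r = right_mean below n r"
  using right_mean_default[OF equivariant2_below, of n]
  by eventually_elim (auto dest!: right_average_tendsto simp: Y_def limI)

lemma equivariant_cong:
  assumes e: "equivariant v" and m: "\<And>n. w n \<in> borel_measurable P" and eq: "\<And>n. AE r in P. w n r = v n r"
  shows "equivariant w"
  unfolding equivariant_def
proof (intro conjI allI impI m)
  fix f :: "int \<Rightarrow> int" and n assume f: "strict_mono f"
  show "AE r in P. w n (inv_image r f) = w (f n) r"
    using AE_transport[OF f eq[of n]] eq[of "f n"] equivariantD(2)[OF e f, of n]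
    by eventually_elim simp
qed

lemma X_measurable [measurable]: "X n \<in> borel_measurable P"
  and Y_measurable [measurable]: "Y n \<in> borel_measurable P"
  unfolding X_def Y_def left_average_def right_average_def by measurable

lemma equivariant_X: "equivariant X"
  by (rule equivariant_cong[OF equivariant_left_mean[OF equivariant2_below] X_measurable AE_X_eq])

lemma equivariant_Y: "equivariant Y"
  by (rule equivariant_cong[OF equivariant_right_mean[OF equivariant2_below] Y_measurable AE_Y_eq])

definition S :: "int \<Rightarrow> int rel \<Rightarrow> real" where "S n r = X n r + Y n r"

lemma equivariant_S: "equivariant S"
  unfolding S_def by (rule equivariant_comp2[OF equivariant_X equivariant_Y]) simp

lemma S_measurable [measurable]: "S n \<in> borel_measurable P"
  by (rule equivariantD(1)[OF equivariant_S])

text \<open>Transitivity gives \<open>below k m \<le> below k n\<close> for every \<open>k\<close>.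
  The averages at \<open>m\<close> and \<open>n\<close> are compared along one common sequence
  beyond both indices, since their limits do not depend on the sequence.\<close>

lemma AE_mono:
  "AE r in P. \<forall>m n. (m, n) \<in> r \<longrightarrow> X m r \<le> X n r \<and> Y m r \<le> Y n r"
proof -
  have "AE r in P. (m, n) \<in> r \<longrightarrow> X m r \<le> X n r \<and> Y m r \<le> Y n r" for m n
  proof -
    let ?s = "\<lambda>i. min m n - 1 - int i" and ?t = "\<lambda>i. max m n + 1 + int i"
    have s: "inj ?s" "inj ?t" "\<And>i. ?s i < m" "\<And>i. ?s i < n" "\<And>i. m < ?t i" "\<And>i. n < ?t i"
      by (auto simp: inj_def)
    note L = left_mean_limit[OF equivariant2_below s(1)] and R = right_mean_limit[OF equivariant2_below s(2)]
    show ?thesis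
      using AE_space L[OF s(3)] L[OF s(4)] R[OF s(5)] R[OF s(6)]
        AE_X_eq[of m] AE_X_eq[of n] AE_Y_eq[of m] AE_Y_eq[of n]
    proof eventually_elim
      case (elim r)
      show ?case
      proof
        assume mn: "(m, n) \<in> r"
        have "trans r" using elim(1) by (simp add: space_P strict_linear_order_on_def)
        then have b: "below k m r \<le> below k n r" for k
          using mn by (auto simp: below_def dest: transD)
        show "X m r \<le> X n r \<and> Y m r \<le> Y n r"
          unfolding elim(6-9)
          by (intro conjI LIMSEQ_le[OF elim(2,3)] LIMSEQ_le[OF elim(4,5)] exI[of _ 0] allI impI cesaro_mono b)
      qed
    qed
  qed
  then show ?thesis by (intro AE_all_countable[THEN iffD2] allI)
qed

text \<open>By totality and \<open>AE_mono\<close> any two pairs are comparable in both coordinates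
  in the same direction. A comparison of the sums therefore decides both coordinates, and equal sums
  force equal pairs.\<close>

lemma AE_chain:
  "AE r in P. \<forall>m n. (S m r < S n r \<longrightarrow> (m, n) \<in> r) \<and> ((m, n) \<in> r \<longrightarrow> S m r \<le> S n r) \<and>
     (S m r = S n r \<longrightarrow> X m r = X n r \<and> Y m r = Y n r) \<and>
     (S m r \<le> S n r \<longrightarrow> X m r \<le> X n r \<and> Y m r \<le> Y n r)"
  using AE_mono AE_space
proof eventually_elim
  case (elim r)
  have tot: "m = n \<or> (m, n) \<in> r \<or> (n, m) \<in> r" for m n
    using elim(2) by (auto simp: space_P strict_linear_order_on_def total_on_def)
  show ?case
  proof (intro allI)
    fix m n
    show "(S m r < S n r \<longrightarrow> (m, n) \<in> r) \<and> ((m, n) \<in> r \<longrightarrow> S m r \<le> S n r) \<and>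
     (S m r = S n r \<longrightarrow> X m r = X n r \<and> Y m r = Y n r) \<and>
     (S m r \<le> S n r \<longrightarrow> X m r \<le> X n r \<and> Y m r \<le> Y n r)"
      using tot[of m n] elim(1)[rule_format, of m n] elim(1)[rule_format, of n m]
      by (auto simp: S_def)
  qed
qed

section \<open>Positions in the chain of pairs\<close>

text \<open>Almost surely the pairs \<open>(X n, Y n)\<close> form a chain, on which \<open>S n = X n + Y n\<close> is an order
  isomorphism onto its image.\<close>

definition cmp :: "(real \<Rightarrow> real \<Rightarrow> bool) \<Rightarrow> int \<Rightarrow> int \<Rightarrow> int rel \<Rightarrow> real" where
  "cmp Q k n r = of_bool (Q (S k r) (S n r))"

lemma equivariant2_cmp:
  assumes Q[measurable]: "Measurable.pred (borel \<Otimes>\<^sub>M borel) (\<lambda>p. Q (fst p) (snd p))"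
  shows "equivariant2 (cmp Q)"
  unfolding equivariant2_def
proof (intro conjI allI impI)
  fix k n
  have "(\<lambda>r. (S k r, S n r)) \<in> P \<rightarrow>\<^sub>M borel \<Otimes>\<^sub>M borel" by measurable
  from measurable_compose[OF this Q] have "Measurable.pred P (\<lambda>r. Q (S k r) (S n r))" by simp
  then show "cmp Q k n \<in> borel_measurable P" unfolding cmp_def by measurable
  show "\<bar>cmp Q k n r\<bar> \<le> 1" for r by (simp add: cmp_def)
  fix f :: "int \<Rightarrow> int" assume f: "strict_mono f"
  show "AE r in P. cmp Q k n (inv_image r f) = cmp Q (f k) (f n) r"
    using equivariantD(2)[OF equivariant_S f, of k] equivariantD(2)[OF equivariant_S f, of n]
    by eventually_elim (simp add: cmp_def)
qed

text \<open>\<open>cmp Q k n\<close> is a function of the exchangeable family \<open>S\<close>, so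
  the correlation of \<open>i\<close> and \<open>j\<close> is the same on both sides of
  \<open>n\<close>. Hence \<open>left_mean\<close> serves here as a two-sided frequency.\<close>

lemma cmp_limit:
  assumes Q: "Measurable.pred (borel \<Otimes>\<^sub>M borel) (\<lambda>p. Q (fst p) (snd p))"
    and s: "inj s" "\<And>i. s i \<noteq> n"
  shows "AE r in P. cesaro (\<lambda>i. cmp Q (s i) n r) \<longlonglongrightarrow> left_mean (cmp Q) n r"
proof -
  note e = equivariant2_cmp[OF Q]
  have corr: "expectation (\<lambda>r. cmp Q i n r * cmp Q j n r) = expectation (\<lambda>r. cmp Q 0 2 r * cmp Q 1 2 r)"
    if "i \<noteq> j" "i \<noteq> n" "j \<noteq> n" for i j
  proof -
    let ?PI = "\<Pi>\<^sub>M n\<in>(UNIV::int set). (borel :: real measure)"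
    define A where "A = {z \<in> space ?PI. Q (z 0) (z 2) \<and> Q (z 1) (z 2)}"
    have pr: "Measurable.pred ?PI (\<lambda>z. Q (z a) (z b))" for a b
    proof -
      have "(\<lambda>z. (z a, z b)) \<in> ?PI \<rightarrow>\<^sub>M borel \<Otimes>\<^sub>M borel"
        by (intro measurable_Pair measurable_component_singleton) simp_all
      from measurable_compose[OF this Q] show ?thesis by simp
    qed
    have A: "A \<in> sets ?PI" unfolding A_def using pr[of 0 2] pr[of 1 2] by measurable
    define B where "B = \<bar>i\<bar> + \<bar>j\<bar> + \<bar>n\<bar> + 1"
    have B: "i < B" "j < B" "n < B" by (auto simp: B_def)
    \<comment> \<open>An injection that sends \<open>0, 1, 2\<close> to \<open>i, j, n\<close>; all
      other integers go to distinct values not below \<open>B\<close>, hence away from these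
      three.\<close>
    define g :: "int \<Rightarrow> int" where
      "g a = (if a = 0 then i else if a = 1 then j else if a = 2 then n else B + int (int_encode a))" for a
    have g_big: "a \<notin> {0, 1, 2} \<Longrightarrow> B \<le> g a" for a by (simp add: g_def)
    have g3: "g 0 = i" "g 1 = j" "g 2 = n" by (simp_all add: g_def)
    have g_other: "a \<notin> {0, 1, 2} \<Longrightarrow> b \<notin> {0, 1, 2} \<Longrightarrow> g a = g b \<Longrightarrow> a = b" for a b
      using injD[OF inj_int_encode, of a b] by (simp add: g_def)
    have "inj g"
    proof (rule injI)
      fix a b assume ab: "g a = g b"
      show "a = b"
        using g_big[of a] g_big[of b] g_other[of a b] ab B that g3
        by (cases "a \<in> {0, 1, 2}"; cases "b \<in> {0, 1, 2}") auto
    qed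
    note ex = exchangeable_under_injection[OF equivariant_S, where G = "\<lambda>_. 1", OF _ _ _ this A]
    have "expectation (\<lambda>r. indicator A (\<lambda>n. S (g n) r) * (1::real)) = expectation (\<lambda>r. indicator A (\<lambda>n. S n r) * (1::real))"
      by (rule ex) (auto simp: invariant_def)
    moreover have "indicator A (\<lambda>n. S (g n) r) * (1::real) = cmp Q i n r * cmp Q j n r" for r
      by (auto simp: A_def g_def cmp_def space_PiM)
    moreover have "indicator A (\<lambda>n. S n r) * (1::real) = cmp Q 0 2 r * cmp Q 1 2 r" for r
      by (auto simp: A_def cmp_def space_PiM)
    ultimately show ?thesis by simp
  qed
  interpret constant_correlation P "UNIV - {n}" "\<lambda>k. cmp Q k n" "expectation (\<lambda>r. cmp Q 0 2 r * cmp Q 1 2 r)"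
    by unfold_locales (rule equivariant2D[OF e], rule equivariant2D[OF e], rule corr, simp_all)
  have "AE r in P. \<exists>l. cesaro (\<lambda>i. cmp Q (s i) n r) \<longlonglongrightarrow> l \<and> cesaro (\<lambda>i. cmp Q (n - 1 - int i) n r) \<longlonglongrightarrow> l"
    by (rule strong_law) (use s in \<open>auto simp: inj_def\<close>)
  then show ?thesis by eventually_elim (auto simp: left_mean_def limI)
qed

lemma pred_cmp [measurable]:
  "Measurable.pred (borel \<Otimes>\<^sub>M borel) (\<lambda>p. fst p < (snd p :: real))"
  "Measurable.pred (borel \<Otimes>\<^sub>M borel) (\<lambda>p. fst p \<le> (snd p :: real))"
  "Measurable.pred (borel \<Otimes>\<^sub>M borel) (\<lambda>p. fst p = (snd p :: real))"
  by measurable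

definition Lw :: "int \<Rightarrow> int rel \<Rightarrow> real" where "Lw = left_mean (cmp (<))"
definition Up :: "int \<Rightarrow> int rel \<Rightarrow> real" where "Up = left_mean (cmp (\<le>))"

lemma equivariant_Lw: "equivariant Lw" and equivariant_Up: "equivariant Up"
  unfolding Lw_def Up_def by (intro equivariant_left_mean equivariant2_cmp pred_cmp)+

lemma Lw_measurable [measurable]: "Lw n \<in> borel_measurable P"
  and Up_measurable [measurable]: "Up n \<in> borel_measurable P"
  by (rule equivariantD(1)[OF equivariant_Lw], rule equivariantD(1)[OF equivariant_Up])

lemma AE_Lw_Up_eq: "AE r in P. \<forall>k n. S k r = S n r \<longrightarrow> Lw k r = Lw n r \<and> Up k r = Up n r"
proof -
  have "AE r in P. S k r = S n r \<longrightarrow> Lw k r = Lw n r \<and> Up k r = Up n r" for k n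
  proof -
    let ?s = "\<lambda>i. max k n + 1 + int i"
    have s: "inj ?s" "\<And>i. ?s i \<noteq> k" "\<And>i. ?s i \<noteq> n" by (auto simp: inj_def)
    note l = cmp_limit[OF pred_cmp(1) s(1), folded Lw_def] and u = cmp_limit[OF pred_cmp(2) s(1), folded Up_def]
    show ?thesis
      using l[OF s(2)] l[OF s(3)] u[OF s(2)] u[OF s(3)]
    proof eventually_elim
      case (elim r)
      show ?case
      proof
        assume "S k r = S n r"
        then have "cmp Q i k r = cmp Q i n r" for Q i by (simp add: cmp_def)
        then show "Lw k r = Lw n r \<and> Up k r = Up n r"
          using elim LIMSEQ_unique by auto
      qed
    qed
  qed
  then show ?thesis by (intro AE_all_countable[THEN iffD2] allI)
qed

section \<open>Ties\<close>

definition tied_below :: "int \<Rightarrow> int \<Rightarrow> int rel \<Rightarrow> real" where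
  "tied_below k n r = of_bool (S k r = S n r \<and> (k, n) \<in> r)"
definition tied_above :: "int \<Rightarrow> int \<Rightarrow> int rel \<Rightarrow> real" where
  "tied_above k n r = of_bool (S k r = S n r \<and> (n, k) \<in> r)"

lemma equivariant2_tied: "equivariant2 tied_below" "equivariant2 tied_above"
proof -
  have eq: "AE r in P. S k (inv_image r f) = S (f k) r \<and> S n (inv_image r f) = S (f n) r" if f: "strict_mono f" for f k n
    using equivariantD(2)[OF equivariant_S f, of k] equivariantD(2)[OF equivariant_S f, of n]
    by eventually_elim simp
  show "equivariant2 tied_below" unfolding equivariant2_def
  proof (intro conjI allI impI)
    fix k n and f :: "int \<Rightarrow> int" assume "strict_mono f"
    from eq[OF this, of k n] show "AE r in P. tied_below k n (inv_image r f) = tied_below (f k) (f n) r"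
      by eventually_elim (simp add: tied_below_def)
  next
    show "tied_below k n \<in> borel_measurable P" for k n unfolding tied_below_def by measurable
  qed (simp add: tied_below_def)
  show "equivariant2 tied_above" unfolding equivariant2_def
  proof (intro conjI allI impI)
    fix k n and f :: "int \<Rightarrow> int" assume "strict_mono f"
    from eq[OF this, of k n] show "AE r in P. tied_above k n (inv_image r f) = tied_above (f k) (f n) r"
      by eventually_elim (simp add: tied_above_def)
  next
    show "tied_above k n \<in> borel_measurable P" for k n unfolding tied_above_def by measurable
  qed (simp add: tied_above_def)
qed

abbreviation "tied \<equiv> cmp (=)"
text \<open>Both count ties whose order in \<open>r\<close> agrees with the order of the integers,
  \<open>tie_lo\<close> seen from the larger of the two integers and \<open>tie_hi\<close> from the
  smaller one.\<close>

abbreviation "tie_lo \<equiv> left_mean tied_below"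
abbreviation "tie_hi \<equiv> right_mean tied_above"

text \<open>These are the limits of two pointwise identities on the left of \<open>n\<close>:
  \<open>below\<close> is \<open>cmp (<)\<close> plus \<open>tied_below\<close>, and
  \<open>cmp (\<le>)\<close> is \<open>cmp (<)\<close> plus \<open>tied\<close>.\<close>

lemma AE_tie_lo: "AE r in P. tie_lo n r = X n r - Lw n r \<and> left_mean tied n r = Up n r - Lw n r \<and>
    0 \<le> tie_lo n r \<and> tie_lo n r \<le> left_mean tied n r \<and> 0 \<le> Lw n r \<and> Up n r \<le> 1"
  using AE_chain AE_space AE_X_eq[of n] left_mean_default[OF equivariant2_below, of n]
    left_mean_default[OF equivariant2_tied(1), of n] left_mean_default[OF equivariant2_cmp[OF pred_cmp(1)], of n]
    left_mean_default[OF equivariant2_cmp[OF pred_cmp(2)], of n] left_mean_default[OF equivariant2_cmp[OF pred_cmp(3)], of n]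
proof eventually_elim
  case (elim r)
  let ?s = "\<lambda>i. n - 1 - int i"
  have "below (?s i) n r = cmp (<) (?s i) n r + tied_below (?s i) n r" for i
    using elim(1)[rule_format, of "?s i" n] by (auto simp: below_def cmp_def tied_below_def not_less)
  then have "(\<lambda>i. below (?s i) n r) = (\<lambda>i. cmp (<) (?s i) n r + tied_below (?s i) n r)" by auto
  then have "cesaro (\<lambda>i. below (?s i) n r) \<longlonglongrightarrow> Lw n r + tie_lo n r"
    using tendsto_add[OF elim(6,5)] unfolding Lw_def by (simp add: cesaro_add[abs_def])
  then have 1: "X n r = Lw n r + tie_lo n r" using elim(4) unfolding elim(3) by (rule LIMSEQ_unique[rotated])
  have "(\<lambda>i. cmp (\<le>) (?s i) n r) = (\<lambda>i. cmp (<) (?s i) n r + tied (?s i) n r)"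
    by (auto simp: cmp_def)
  then have "cesaro (\<lambda>i. cmp (\<le>) (?s i) n r) \<longlonglongrightarrow> Lw n r + left_mean tied n r"
    using tendsto_add[OF elim(6,8)] unfolding Lw_def by (simp add: cesaro_add[abs_def])
  then have 2: "Up n r = Lw n r + left_mean tied n r" using elim(7) unfolding Up_def by (rule LIMSEQ_unique[rotated])
  have nn: "0 \<le> tie_lo n r"
    by (rule LIMSEQ_le_const[OF elim(5)]) (auto simp: cesaro_def tied_below_def intro!: exI[of _ 0] sum_nonneg divide_nonneg_nonneg)
  have "tie_lo n r \<le> left_mean tied n r"
    by (rule LIMSEQ_le[OF elim(5,8)])
      (auto simp: tied_below_def cmp_def intro!: exI[of _ 0] cesaro_mono)
  moreover have "0 \<le> Lw n r" unfolding Lw_def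
    by (rule LIMSEQ_le_const[OF elim(6)]) (auto simp: cesaro_def cmp_def intro!: exI[of _ 0] sum_nonneg divide_nonneg_nonneg)
  moreover have "Up n r \<le> 1" unfolding Up_def
    using cesaro_abs_le[of "\<lambda>i. cmp (\<le>) (?s i) n r"]
    by (intro LIMSEQ_le_const2[OF elim(7)]) (auto simp: cmp_def abs_le_iff)
  ultimately show ?case using 1 2 nn by simp
qed

text \<open>On the right of \<open>n\<close> a tied index that is not below \<open>n\<close> is
  above it, so \<open>tied_above\<close> is \<open>cmp (\<le>)\<close> minus \<open>below\<close>.
  Combined with \<open>AE_tie_lo\<close>, the equality of \<open>tie_lo\<close> and
  \<open>tie_hi\<close> amounts to \<open>X n + Y n = Lw n + Up n\<close>.\<close>

lemma AE_tie_hi: "AE r in P. tie_hi n r = Up n r - Y n r \<and> 0 \<le> tie_hi n r \<and> tie_hi n r \<le> 1"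
proof -
  have "inj (\<lambda>i. n + 1 + int i)" by (auto simp: inj_def)
  note u = cmp_limit[OF pred_cmp(2) this, of n, folded Up_def]
  have "AE r in P. cesaro (\<lambda>i. cmp (\<le>) (n + 1 + int i) n r) \<longlonglongrightarrow> Up n r" by (rule u) auto
  then show ?thesis
    using AE_chain AE_space AE_Y_eq[of n] right_mean_default[OF equivariant2_below, of n]
      right_mean_default[OF equivariant2_tied(2), of n]
  proof eventually_elim
    case (elim r)
    let ?s = "\<lambda>i. n + 1 + int i"
    have "tied_above (?s i) n r = cmp (\<le>) (?s i) n r - below (?s i) n r" for i
    proof -
      have "(?s i, n) \<in> r \<or> (n, ?s i) \<in> r" "\<not> ((?s i, n) \<in> r \<and> (n, ?s i) \<in> r)"
        using elim(3) by (auto simp: space_P strict_linear_order_on_def total_on_def irrefl_def dest: transD)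
      then show ?thesis
        using elim(2)[rule_format, of "?s i" n] elim(2)[rule_format, of n "?s i"]
        by (auto simp: below_def cmp_def tied_above_def)
    qed
    then have "(\<lambda>i. tied_above (?s i) n r) = (\<lambda>i. cmp (\<le>) (?s i) n r - below (?s i) n r)" by auto
    then have "cesaro (\<lambda>i. tied_above (?s i) n r) \<longlonglongrightarrow> Up n r - Y n r"
      using tendsto_diff[OF elim(1,5)] unfolding elim(4) by (simp add: cesaro_diff[abs_def])
    then have 1: "tie_hi n r = Up n r - Y n r" using elim(6) by (rule LIMSEQ_unique[rotated])
    have "0 \<le> tie_hi n r"
      by (rule LIMSEQ_le_const[OF elim(6)]) (auto simp: cesaro_def tied_above_def intro!: exI[of _ 0] sum_nonneg divide_nonneg_nonneg)
    moreover have "tie_hi n r \<le> 1"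
      using cesaro_abs_le[of "\<lambda>i. tied_above (?s i) n r"]
      by (intro LIMSEQ_le_const2[OF elim(6)]) (auto simp: tied_above_def abs_le_iff)
    ultimately show ?case using 1 by simp
  qed
qed

lemma tie_measurable [measurable]: "tie_lo n \<in> borel_measurable P" "tie_hi n \<in> borel_measurable P"
  "left_mean tied n \<in> borel_measurable P"
  by (rule equivariantD(1)[OF equivariant_left_mean[OF equivariant2_tied(1)]],
      rule equivariantD(1)[OF equivariant_right_mean[OF equivariant2_tied(2)]],
      rule equivariantD(1)[OF equivariant_left_mean[OF equivariant2_cmp[OF pred_cmp(3)]]])

lemma integrable_AE_bounded:
  "f \<in> borel_measurable P \<Longrightarrow> AE r in P. \<bar>f r\<bar> \<le> 1 \<Longrightarrow> integrable P (f :: int rel \<Rightarrow> real)"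
  by (rule integrable_const_bound[where B = 1]) auto

text \<open>The difference \<open>c\<close> of the two sides agrees at tied indices, so the expectation of \<open>c\<close> over pairs
  \<open>k < n\<close> tied in increasing order can be averaged over \<open>k\<close> or over \<open>n\<close>. Comparing the results
  shows that \<open>c\<^sup>2\<close> has expectation 0.\<close>

lemma AE_tie_lo_eq_tie_hi: "AE r in P. tie_lo n r = tie_hi n r"
proof -
  define c where "c n r = tie_lo n r - tie_hi n r" for n r
  have ec: "equivariant c"
    unfolding c_def by (rule equivariant_comp2[OF equivariant_left_mean[OF equivariant2_tied(1)]
          equivariant_right_mean[OF equivariant2_tied(2)]]) simp
  note [measurable] = equivariantD(1)[OF ec]
  have b1: "AE r in P. \<bar>tie_lo n r\<bar> \<le> 1" for n by (rule left_mean_bounds[OF equivariant2_tied(1)])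
  have b2: "AE r in P. \<bar>tie_hi n r\<bar> \<le> 1" for n by (rule right_mean_bounds[OF equivariant2_tied(2)])
  have bc: "AE r in P. \<bar>c n r\<bar> \<le> 1" for n
    using AE_tie_hi[of n] AE_tie_lo[of n] b1[of n] by eventually_elim (auto simp: c_def)
  let ?k = "n - 1"
  have "expectation (\<lambda>r. tie_lo n r * c n r) = expectation (\<lambda>r. tied_below ?k n r * c n r)"
    by (rule expectation_left_equivariant[OF equivariant2_tied(1) ec bc, symmetric]) simp
  also have "\<dots> = expectation (\<lambda>r. tied_above n ?k r * c ?k r)"
  proof (rule integral_cong_AE)
    show "AE r in P. tied_below ?k n r * c n r = tied_above n ?k r * c ?k r"
      using AE_Lw_Up_eq AE_chain AE_tie_lo[of n] AE_tie_lo[of ?k] AE_tie_hi[of n] AE_tie_hi[of ?k]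
    proof eventually_elim
      case (elim r)
      show ?case
      proof (cases "S ?k r = S n r")
        case True
        then have "c n r = c ?k r"
          using elim(1)[rule_format, of ?k n] elim(2)[rule_format, of ?k n] elim(3-6) by (simp add: c_def)
        then show ?thesis by (simp add: tied_below_def tied_above_def eq_commute)
      qed (auto simp: tied_below_def tied_above_def)
    qed
  qed (use equivariant2D(1)[OF equivariant2_tied(1)] equivariant2D(1)[OF equivariant2_tied(2)] in auto)
  also have "\<dots> = expectation (\<lambda>r. tie_hi ?k r * c ?k r)"
    by (rule expectation_right_equivariant[OF equivariant2_tied(2) ec bc]) simp
  also have "\<dots> = expectation (\<lambda>r. tie_hi n r * c n r)"
    by (rule equivariant_expectation[OF equivariant_comp2[OF equivariant_right_mean[OF equivariant2_tied(2)] ec]]) simp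
  finally have eq: "expectation (\<lambda>r. tie_lo n r * c n r) = expectation (\<lambda>r. tie_hi n r * c n r)" .
  have i: "integrable P (\<lambda>r. tie_lo n r * c n r)" "integrable P (\<lambda>r. tie_hi n r * c n r)"
  proof -
    show "integrable P (\<lambda>r. tie_lo n r * c n r)"
      by (rule integrable_AE_bounded, simp, use b1[of n] bc[of n] in eventually_elim) (intro abs_mult_le_one)
    show "integrable P (\<lambda>r. tie_hi n r * c n r)"
      by (rule integrable_AE_bounded, simp, use b2[of n] bc[of n] in eventually_elim) (intro abs_mult_le_one)
  qed
  have "(\<lambda>r. c n r * c n r) = (\<lambda>r. tie_lo n r * c n r - tie_hi n r * c n r)"
    by (auto simp: c_def algebra_simps)
  then have "integrable P (\<lambda>r. c n r * c n r)" "expectation (\<lambda>r. c n r * c n r) = 0"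
    using i eq by simp_all
  then have "AE r in P. c n r * c n r = 0"
    by (subst (asm) integral_nonneg_eq_0_iff_AE) auto
  then show ?thesis by eventually_elim (simp add: c_def)
qed

text \<open>For tied \<open>k < m < n\<close> let \<open>u\<close>, \<open>v\<close>, \<open>w\<close> indicate that \<open>k\<close> is below \<open>m\<close>, \<open>m\<close> below \<open>n\<close> and \<open>k\<close> below \<open>n\<close>.
  Transitivity gives \<open>w = u w + v w - u v\<close>. With \<open>a = tie_lo\<close> and \<open>t\<close> the frequency of ties, averaging the
  four terms around suitable centres turns this into \<open>E (a t) = E (a\<^sup>2)\<close>, while \<open>0 \<le> a \<le> t\<close>.\<close>

lemma AE_tie_lo_extreme: "AE r in P. tie_lo n r = 0 \<or> tie_lo n r = left_mean tied n r"
proof -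
  let ?k = "n - 2" and ?m = "n - 1" and ?t = "left_mean tied"
  have km: "?k < ?m" "?m < n" by auto
  have e3: "equivariant2 tied" by (rule equivariant2_cmp[OF pred_cmp(3)])
  note e1 = equivariant2_tied(1) and e2 = equivariant2_tied(2)
  note [measurable] = equivariant2D(1)[OF e1] equivariant2D(1)[OF e2] equivariant2D(1)[OF e3]
  have b1: "AE r in P. \<bar>tie_lo n r\<bar> \<le> 1" by (rule left_mean_bounds[OF e1])
  have b3: "AE r in P. \<bar>?t n r\<bar> \<le> 1" by (rule left_mean_bounds[OF e3])
  have i2: "integrable P (\<lambda>r. \<psi> a b r * \<theta> c d r)" if "equivariant2 \<psi>" "equivariant2 \<theta>" for \<psi> \<theta> a b c d
    using equivariant2D[OF that(1)] equivariant2D[OF that(2)]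
    by (intro integrable_AE_bounded AE_I2 abs_mult_le_one) auto
  have sq: "expectation (\<lambda>r. tie_hi ?k r * tie_hi ?k r) = expectation (\<lambda>r. tie_lo n r * tie_lo n r)"
  proof -
    have "expectation (\<lambda>r. tie_hi ?k r * tie_hi ?k r) = expectation (\<lambda>r. tie_hi n r * tie_hi n r)"
      by (rule equivariant_expectation[OF equivariant_comp2[OF equivariant_right_mean[OF e2] equivariant_right_mean[OF e2]]]) simp
    also have "\<dots> = expectation (\<lambda>r. tie_lo n r * tie_lo n r)"
      by (rule integral_cong_AE; (measurable)?) (use AE_tie_lo_eq_tie_hi[of n] in \<open>eventually_elim, simp\<close>)
    finally show ?thesis .
  qed
  have mx: "expectation (\<lambda>r. tie_lo ?m r * tie_hi ?m r) = expectation (\<lambda>r. tie_lo n r * tie_lo n r)"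
  proof -
    have "expectation (\<lambda>r. tie_lo ?m r * tie_hi ?m r) = expectation (\<lambda>r. tie_lo n r * tie_hi n r)"
      by (rule equivariant_expectation[OF equivariant_comp2[OF equivariant_left_mean[OF e1] equivariant_right_mean[OF e2]]]) simp
    also have "\<dots> = expectation (\<lambda>r. tie_lo n r * tie_lo n r)"
      by (rule integral_cong_AE; (measurable)?) (use AE_tie_lo_eq_tie_hi[of n] in \<open>eventually_elim, simp\<close>)
    finally show ?thesis .
  qed
  have "expectation (\<lambda>r. tie_lo n r * ?t n r) = expectation (\<lambda>r. tied_below ?k n r * tied ?m n r)"
    by (rule expectation_left_left[OF e1 e3 km, symmetric])
  \<comment> \<open>The product \<open>u w\<close> is centred at \<open>?k\<close>,
    \<open>v w\<close> at \<open>n\<close> and \<open>u v\<close> at \<open>?m\<close>. Because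
    \<open>tie_lo\<close> and \<open>tie_hi\<close> agree, each of the three averages to the second
    moment of \<open>tie_lo\<close>, and two minus one of them remain.\<close>
  also have "\<dots> = expectation (\<lambda>r. tied_above n ?k r * tied_above ?m ?k r + tied_below ?k n r * tied_below ?m n r
       - tied_below ?k ?m r * tied_above n ?m r)"
  proof (rule Bochner_Integration.integral_cong[OF refl])
    fix r assume "r \<in> space P"
    then have r: "trans r" "\<And>i. (i, i) \<notin> r" "\<And>i j. i = j \<or> (i, j) \<in> r \<or> (j, i) \<in> r"
      by (auto simp: space_P strict_linear_order_on_def total_on_def irrefl_def)
    have as: "\<not> ((i, j) \<in> r \<and> (j, i) \<in> r)" for i j using r(1,2) by (auto dest: transD)
    have tr: "(i, j) \<in> r \<Longrightarrow> (j, l) \<in> r \<Longrightarrow> (i, l) \<in> r" for i j l using r(1) by (auto dest: transD)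
    have t1: "(?k, ?m) \<in> r \<or> (?m, ?k) \<in> r" "(?m, n) \<in> r \<or> (n, ?m) \<in> r" "(?k, n) \<in> r \<or> (n, ?k) \<in> r"
      using r(3)[of ?k ?m] r(3)[of ?m n] r(3)[of ?k n] by auto
    show "tied_below ?k n r * tied ?m n r = tied_above n ?k r * tied_above ?m ?k r + tied_below ?k n r * tied_below ?m n r
       - tied_below ?k ?m r * tied_above n ?m r"
      using t1 as[of ?k ?m] as[of ?m n] as[of ?k n] tr[of ?k ?m n] tr[of n ?m ?k]
      unfolding tied_below_def tied_above_def cmp_def by auto
  qed
  also have "\<dots> = expectation (\<lambda>r. tied_above n ?k r * tied_above ?m ?k r) + expectation (\<lambda>r. tied_below ?k n r * tied_below ?m n r)
       - expectation (\<lambda>r. tied_below ?k ?m r * tied_above n ?m r)"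
    using i2[OF e1 e1] i2[OF e2 e2] i2[OF e1 e2] by simp
  also have "\<dots> = expectation (\<lambda>r. tie_lo n r * tie_lo n r)"
    unfolding expectation_right_right[OF e2 e2 km] expectation_left_left[OF e1 e1 km]
      expectation_left_right[OF e1 e2 km] sq mx by simp
  finally have eq: "expectation (\<lambda>r. tie_lo n r * ?t n r) = expectation (\<lambda>r. tie_lo n r * tie_lo n r)" .
  have i: "integrable P (\<lambda>r. tie_lo n r * tie_lo n r)" "integrable P (\<lambda>r. tie_lo n r * ?t n r)"
  proof -
    show "integrable P (\<lambda>r. tie_lo n r * tie_lo n r)"
      by (rule integrable_AE_bounded, simp, use b1 in eventually_elim) (intro abs_mult_le_one)
    show "integrable P (\<lambda>r. tie_lo n r * ?t n r)"
      by (rule integrable_AE_bounded, simp, use b1 b3 in eventually_elim) (intro abs_mult_le_one)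
  qed
  have "(\<lambda>r. tie_lo n r * (?t n r - tie_lo n r)) = (\<lambda>r. tie_lo n r * ?t n r - tie_lo n r * tie_lo n r)"
    by (auto simp: algebra_simps)
  then have i': "integrable P (\<lambda>r. tie_lo n r * (?t n r - tie_lo n r))"
    and e': "expectation (\<lambda>r. tie_lo n r * (?t n r - tie_lo n r)) = 0"
    using i eq by simp_all
  have "AE r in P. 0 \<le> tie_lo n r * (?t n r - tie_lo n r)"
    using AE_tie_lo[of n] by eventually_elim simp
  from integral_nonneg_eq_0_iff_AE[OF i' this] e'
  have "AE r in P. tie_lo n r * (?t n r - tie_lo n r) = 0" by simp
  then show ?thesis by eventually_elim auto
qed

text \<open>\<open>X n\<close> is \<open>Lw n + tie_lo n\<close> and \<open>Y n\<close> is
  \<open>Up n - tie_hi n\<close>, where both tie frequencies have the same value, either 0 or the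
  full width \<open>Up n - Lw n\<close>.\<close>

lemma AE_ends:
  "AE r in P. \<forall>n. 0 \<le> Lw n r \<and> Lw n r \<le> Up n r \<and> Up n r \<le> 1 \<and>
     ((X n r = Lw n r \<and> Y n r = Up n r) \<or> (X n r = Up n r \<and> Y n r = Lw n r))"
proof -
  have "AE r in P. 0 \<le> Lw n r \<and> Lw n r \<le> Up n r \<and> Up n r \<le> 1 \<and>
     ((X n r = Lw n r \<and> Y n r = Up n r) \<or> (X n r = Up n r \<and> Y n r = Lw n r))" for n
    using AE_tie_lo_extreme[of n] AE_tie_lo_eq_tie_hi[of n] AE_tie_lo[of n] AE_tie_hi[of n]
    by eventually_elim auto
  then show ?thesis by (intro AE_all_countable[THEN iffD2] allI)
qed

text \<open>A statement about a single \<open>k\<close> follows from averages over \<open>k\<close>: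
  a nonnegative product of a two-index indicator and a function of \<open>n\<close> vanishes almost
  surely as soon as its average does. Here \<open>left_mean tied\<close> vanishes where
  \<open>Up n = Lw n\<close>, \<open>tie_lo\<close> vanishes where \<open>X n = Lw n\<close>, and
  the two agree where \<open>X n = Up n\<close>.\<close>

lemma AE_tie_rule:
  "AE r in P. \<forall>k n. k < n \<longrightarrow> S k r = S n r \<longrightarrow> Lw n r < Up n r \<and> ((k, n) \<in> r \<longleftrightarrow> X n r = Up n r)"
proof -
  have "AE r in P. S k r = S n r \<longrightarrow> Lw n r < Up n r \<and> ((k, n) \<in> r \<longleftrightarrow> X n r = Up n r)" if kn: "k < n" for k n
  proof -
    note e1 = equivariant2_tied(1) and e3 = equivariant2_cmp[OF pred_cmp(3)]
    note [measurable] = equivariant2D(1)[OF e1] equivariant2D(1)[OF e3]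
    define G where "G v w n r = (of_bool (v n r = w n r) :: real)" for v w :: "int \<Rightarrow> int rel \<Rightarrow> real" and n r
    have G: "equivariant (G v w)" if "equivariant v" "equivariant w" for v w
    proof -
      have "(\<lambda>p. of_bool (fst p = (snd p :: real)) :: real) \<in> borel_measurable (borel \<Otimes>\<^sub>M borel)"
        by measurable
      from equivariant_comp2[OF that this] show ?thesis by (simp add: G_def[abs_def])
    qed
    have Gb: "AE r in P. \<bar>G v w n r\<bar> \<le> 1" for v w n by (auto simp: G_def)
    have zero: "AE r in P. f r = 0" if "f \<in> borel_measurable P" "\<And>r. 0 \<le> f r" "\<And>r. f r \<le> (1::real)" "expectation f = 0" for f
    proof -
      have "integrable P f" using that by (intro integrable_AE_bounded) auto
      from integral_nonneg_eq_0_iff_AE[OF this] that(2,4) show ?thesis by simp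
    qed
    have g1: "equivariant (G Up Lw)" and g2: "equivariant (G X Up)" and g3: "equivariant (G X Lw)"
      by (intro G equivariant_Up equivariant_Lw equivariant_X)+
    note [measurable] = equivariantD(1)[OF g1] equivariantD(1)[OF g2] equivariantD(1)[OF g3]
    have "expectation (\<lambda>r. tied k n r * G Up Lw n r) = expectation (\<lambda>r. left_mean tied n r * G Up Lw n r)"
      by (rule expectation_left_equivariant[OF e3 g1 Gb kn])
    also have "\<dots> = expectation (\<lambda>r. 0)"
      by (rule integral_cong_AE; (measurable)?) (use AE_tie_lo[of n] in \<open>eventually_elim, auto simp: G_def\<close>)
    finally have "expectation (\<lambda>r. tied k n r * G Up Lw n r) = 0" by simp
    then have z1: "AE r in P. tied k n r * G Up Lw n r = 0"
      by (rule zero[rotated 3]) (auto simp: cmp_def G_def)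
    have "expectation (\<lambda>r. tied_below k n r * G X Lw n r) = expectation (\<lambda>r. tie_lo n r * G X Lw n r)"
      by (rule expectation_left_equivariant[OF e1 g3 Gb kn])
    also have "\<dots> = expectation (\<lambda>r. 0)"
      by (rule integral_cong_AE; (measurable)?) (use AE_tie_lo[of n] in \<open>eventually_elim, auto simp: G_def\<close>)
    finally have "expectation (\<lambda>r. tied_below k n r * G X Lw n r) = 0" by simp
    then have z3: "AE r in P. tied_below k n r * G X Lw n r = 0"
      by (rule zero[rotated 3]) (auto simp: tied_below_def G_def)
    have i: "integrable P (\<lambda>r. tied k n r * G X Up n r)" "integrable P (\<lambda>r. tied_below k n r * G X Up n r)"
      by (intro integrable_AE_bounded; auto simp: cmp_def tied_below_def G_def)+
    have "expectation (\<lambda>r. (tied k n r - tied_below k n r) * G X Up n r) =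
       expectation (\<lambda>r. tied k n r * G X Up n r) - expectation (\<lambda>r. tied_below k n r * G X Up n r)"
      using i by (simp add: left_diff_distrib)
    also have "\<dots> = expectation (\<lambda>r. left_mean tied n r * G X Up n r) - expectation (\<lambda>r. tie_lo n r * G X Up n r)"
      by (simp only: expectation_left_equivariant[OF e1 g2 Gb kn] expectation_left_equivariant[OF e3 g2 Gb kn])
    also have "expectation (\<lambda>r. left_mean tied n r * G X Up n r) = expectation (\<lambda>r. tie_lo n r * G X Up n r)"
      by (rule integral_cong_AE; (measurable)?) (use AE_tie_lo[of n] in \<open>eventually_elim, auto simp: G_def\<close>)
    finally have "expectation (\<lambda>r. (tied k n r - tied_below k n r) * G X Up n r) = 0" by simp
    then have z2: "AE r in P. (tied k n r - tied_below k n r) * G X Up n r = 0"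
      by (rule zero[rotated 3]) (auto simp: tied_below_def cmp_def G_def)
    show ?thesis
      using z1 z2 z3 AE_ends
    proof eventually_elim
      case (elim r)
      show ?case
      proof
        assume t: "S k r = S n r"
        have "Up n r \<noteq> Lw n r" using elim(1) t by (auto simp: cmp_def G_def)
        moreover have "X n r = Up n r \<Longrightarrow> (k, n) \<in> r" using elim(2) t by (auto simp: cmp_def tied_below_def G_def)
        moreover have "X n r = Lw n r \<Longrightarrow> (k, n) \<notin> r" using elim(3) t by (auto simp: tied_below_def G_def)
        ultimately show "Lw n r < Up n r \<and> ((k, n) \<in> r \<longleftrightarrow> X n r = Up n r)"
          using elim(4)[rule_format, of n] by auto
      qed
    qed
  qed
  then have "AE r in P. k < n \<longrightarrow> S k r = S n r \<longrightarrow> Lw n r < Up n r \<and> ((k, n) \<in> r \<longleftrightarrow> X n r = Up n r)" for k n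
    by (cases "k < n") simp_all
  then show ?thesis by (intro AE_all_countable[THEN iffD2] allI)
qed

text \<open>Indices with different \<open>S\<close> are ordered by \<open>S\<close>. For tied ones
  the last clause of \<open>earlier_below\<close> decides: as \<open>Lw n < Up n\<close>, the
  condition \<open>X n = Up n\<close> is the same as \<open>X n > Y n\<close>.\<close>

theorem AE_order_rule:
  "AE r in P. \<forall>m n. m < n \<longrightarrow> ((m, n) \<in> r \<longleftrightarrow> earlier_below (X m r, Y m r) (X n r, Y n r))"
  using AE_chain AE_tie_rule AE_ends AE_space
proof eventually_elim
  case (elim r)
  show ?case
  proof (intro allI impI)
    fix m n :: int assume mn: "m < n"
    have tot: "(m, n) \<in> r \<or> (n, m) \<in> r" "\<not> ((m, n) \<in> r \<and> (n, m) \<in> r)"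
      using elim(4) mn by (auto simp: space_P strict_linear_order_on_def total_on_def irrefl_def dest: transD)
    note c = elim(1)[rule_format, of m n] elim(1)[rule_format, of n m]
    consider "S m r < S n r" | "S n r < S m r" | "S m r = S n r" by linarith
    then show "(m, n) \<in> r \<longleftrightarrow> earlier_below (X m r, Y m r) (X n r, Y n r)"
    proof cases
      case 1
      then have "(m, n) \<in> r" using c(1) by blast
      moreover have "X m r < X n r \<or> Y m r < Y n r" using 1 unfolding S_def by linarith
      ultimately show ?thesis by (auto simp: earlier_below_def)
    next
      case 2
      then have "X n r \<le> X m r" "Y n r \<le> Y m r" "(n, m) \<in> r" using c(2) less_imp_le by blast+
      moreover have "\<not> (X m r = X n r \<and> Y m r = Y n r)" using 2 unfolding S_def by linarith
      ultimately show ?thesis using tot by (auto simp: earlier_below_def)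
    next
      case 3
      then have "X m r = X n r" "Y m r = Y n r" using c(1) by blast+
      moreover have "Lw n r < Up n r" "(m, n) \<in> r \<longleftrightarrow> X n r = Up n r" using elim(2) mn 3 by auto
      ultimately show ?thesis using elim(3)[rule_format, of n] by (auto simp: earlier_below_def)
    qed
  qed
qed

lemma AE_frequencies:
  "AE r in P. \<forall>n. cesaro (\<lambda>i. cmp (<) (1 + int i) n r) \<longlonglongrightarrow> Lw n r \<and> cesaro (\<lambda>i. cmp (\<le>) (1 + int i) n r) \<longlonglongrightarrow> Up n r"
proof -
  have "AE r in P. cesaro (\<lambda>i. cmp Q (1 + int i) n r) \<longlonglongrightarrow> left_mean (cmp Q) n r"
    if Q: "Measurable.pred (borel \<Otimes>\<^sub>M borel) (\<lambda>p. Q (fst p) (snd p))" for Q n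
  proof -
    \<comment> \<open>\<open>cmp_limit\<close> requires indices different from \<open>n\<close>; the
      shift by \<open>nat \<bar>n\<bar>\<close> ensures this and is undone by
      \<open>cesaro_unshift\<close>.\<close>
    have "AE r in P. cesaro (\<lambda>i. cmp Q (1 + int (i + nat \<bar>n\<bar>)) n r) \<longlonglongrightarrow> left_mean (cmp Q) n r"
      by (rule cmp_limit[OF Q]) (auto simp: inj_def)
    then show ?thesis
      by eventually_elim (rule cesaro_unshift)
  qed
  note * = this
  have "AE r in P. cesaro (\<lambda>i. cmp (<) (1 + int i) n r) \<longlonglongrightarrow> Lw n r \<and> cesaro (\<lambda>i. cmp (\<le>) (1 + int i) n r) \<longlonglongrightarrow> Up n r" for n
    using *[OF pred_cmp(1), of n] *[OF pred_cmp(2), of n] by eventually_elim (simp add: Lw_def Up_def)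
  then show ?thesis by (intro AE_all_countable[THEN iffD2] allI)
qed

section \<open>The distribution of the positions\<close>

text \<open>Given \<open>N\<close> indices and one more index \<open>j\<close>, each of the \<open>N + 1\<close> indices is equally likely to be the
  one with the largest \<open>\<sigma>\<close> among those with \<open>U \<le> q\<close>. Averaging over \<open>j\<close> bounds the expected excess
  of the frequency of \<open>U \<le> q\<close> over \<open>q\<close> by \<open>1 / (N + 1)\<close>.\<close>

lemma mean_position_le:
  fixes \<sigma> U :: "int \<Rightarrow> int rel \<Rightarrow> real"
  assumes es: "equivariant \<sigma>" and eU: "equivariant U" and q: "0 \<le> q"
    and lim: "AE r in P. \<forall>n. cesaro (\<lambda>i. of_bool (\<sigma> (1 + int i) r \<le> \<sigma> n r)) \<longlonglongrightarrow> U n r"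
  shows "AE r in P. mean (\<lambda>n r. of_bool (U n r \<le> q)) r \<le> q"
proof -
  define \<phi> where "\<phi> n r = (of_bool (U n r \<le> q) :: real)" for n r
  define h where "h = mean \<phi>"
  \<comment> \<open>The indicator of the event to be excluded. It is invariant, so it can serve as
    the weight in the symmetry argument.\<close>
  define \<psi> where "\<psi> r = (of_bool (q < h r) :: real)" for r
  define w where "w n r = (\<sigma> n r, U n r)" for n r
  note [measurable] = equivariantD(1)[OF es] equivariantD(1)[OF eU]
  have e\<phi>: "equivariant \<phi>"
    unfolding \<phi>_def by (rule equivariant_comp[OF eU]) measurable
  have \<phi>b: "\<bar>\<phi> n r\<bar> \<le> 1" for n r by (simp add: \<phi>_def)
  have ih: "invariant h" unfolding h_def by (rule mean_invariant[OF e\<phi> \<phi>b])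
  note [measurable] = invariantD(1)[OF ih]
  have i\<psi>: "invariant \<psi>" unfolding invariant_def
  proof (intro conjI allI impI)
    show "\<psi> \<in> borel_measurable P" unfolding \<psi>_def by measurable
    fix f :: "int \<Rightarrow> int" assume "strict_mono f"
    from invariantD(2)[OF ih this] show "AE r in P. \<psi> (inv_image r f) = \<psi> r"
      by eventually_elim (simp add: \<psi>_def)
  qed
  note [measurable] = invariantD(1)[OF i\<psi>]
  have \<psi>01: "0 \<le> \<psi> r" "\<psi> r \<le> 1" for r by (auto simp: \<psi>_def)
  have hb: "AE r in P. \<bar>h r\<bar> \<le> 1" unfolding h_def by (rule mean_bound[OF e\<phi> \<phi>b])
  have ew: "equivariant w"
    unfolding w_def by (rule equivariant_comp2[OF es eU]) (simp add: borel_prod)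
  let ?PI = "\<Pi>\<^sub>M n\<in>(UNIV::int set). (borel :: (real \<times> real) measure)"
  \<comment> \<open>\<open>l\<close> satisfies the constraint and strictly exceeds every other
    member of \<open>K\<close> that does. For given \<open>K\<close> this holds for at most one
    \<open>l\<close> in \<open>K\<close>, which yields the factor
    \<open>1 / (real N + 1)\<close>.\<close>
  define A where "A K l = {z \<in> space ?PI. snd (z l) \<le> q \<and> (\<forall>k\<in>K - {l}. snd (z k) \<le> q \<longrightarrow> fst (z k) < fst (z l))}"
    for K and l :: int
  have [measurable]: "(\<lambda>z. fst (z k)) \<in> borel_measurable ?PI" "(\<lambda>z. snd (z k)) \<in> borel_measurable ?PI" for k :: int
    using measurable_compose[OF measurable_component_singleton[of k UNIV "\<lambda>_. borel :: (real \<times> real) measure"], of fst borel]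
      measurable_compose[OF measurable_component_singleton[of k UNIV "\<lambda>_. borel :: (real \<times> real) measure"], of snd borel]
    by (simp_all add: borel_prod[symmetric])
  have A: "A K l \<in> sets ?PI" if "finite K" for K l
  proof -
    have "finite (K - {l})" using that by simp
    then show ?thesis unfolding A_def by measurable
  qed
  have bound: "expectation (\<lambda>r. (h r - q) * \<psi> r) \<le> 1 / (real N + 1)" for N
  proof -
    \<comment> \<open>The extra index runs through \<open>N + 1, N + 2, ...\<close>, so it stays
      outside \<open>I\<close> and can be averaged.\<close>
    define j where "j i = 1 + int (i + N)" for i
    define I where "I = {1..int N}"
    define K where "K i = insert (j i) I" for i
    have finK: "finite (K i)" for i by (simp add: K_def I_def)
    have jI: "j i \<notin> I" for i by (auto simp: j_def I_def)
    define \<zeta> where "\<zeta> i r = (indicator (A (K i) (j i)) (\<lambda>n. w n r) :: real)" for i r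
    define e where "e = expectation (\<lambda>r. \<zeta> 0 r * \<psi> r)"
    have mw: "(\<lambda>r n. w n r) \<in> measurable P ?PI"
      by (rule measurable_PiM_single') (use equivariantD(1)[OF ew] in auto)
    have mind: "(\<lambda>r. indicator (A L l) (\<lambda>n. w n r) :: real) \<in> borel_measurable P" if "finite L" for L l
      using measurable_compose[OF mw borel_measurable_indicator[OF A[OF that]]] .
    have swap: "expectation (\<lambda>r. indicator (A (g ` L) (g l)) (\<lambda>n. w n r) * \<psi> r) = expectation (\<lambda>r. indicator (A L l) (\<lambda>n. w n r) * \<psi> r)"
      if g: "inj g" and L: "finite L" for g L l
    proof -
      have "indicator (A (g ` L) (g l)) (\<lambda>n. w n r) = (indicator (A L l) (\<lambda>n. w (g n) r) :: real)" for r
        using g by (auto simp: A_def indicator_def space_PiM inj_eq)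
      then show ?thesis using exchangeable_under_injection[OF ew i\<psi> \<psi>01 g A[OF L, of l]] by simp
    qed
    \<comment> \<open>Transpositions show that the expectation depends neither on the extra index
      (\<open>e_i\<close>) nor on the member of \<open>K 0\<close> that is singled out
      (\<open>e_l\<close>).\<close>
    have e_i: "expectation (\<lambda>r. \<zeta> i r * \<psi> r) = e" for i
    proof -
      let ?g = "\<lambda>a. if a = j 0 then j i else if a = j i then j 0 else a"
      have g: "inj ?g" by (auto simp: inj_def)
      have gI: "?g ` I = I" by (rule trans[OF image_cong[OF refl, of _ _ "\<lambda>a. a"]]) (use jI in auto)
      have g0: "?g (j 0) = j i" by simp
      have "?g ` (K 0) = K i" by (simp only: K_def image_insert gI g0)
      moreover note g0
      ultimately show ?thesis using swap[OF g finK[of 0], of "j 0"] by (simp add: \<zeta>_def e_def)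
    qed
    have e_l: "expectation (\<lambda>r. indicator (A (K 0) l) (\<lambda>n. w n r) * \<psi> r) = e" if l: "l \<in> K 0" for l
    proof -
      let ?g = "\<lambda>a. if a = j 0 then l else if a = l then j 0 else a"
      have g: "inj ?g" by (auto simp: inj_def)
      have j0: "j 0 \<in> K 0" by (simp add: K_def)
      have "?g ` (K 0) = K 0"
        by (rule endo_inj_surj[OF finK _ inj_on_subset[OF g]]) (use l j0 in auto)
      moreover have "?g (j 0) = l" by simp
      ultimately show ?thesis using swap[OF g finK[of 0], of "j 0"] by (simp add: \<zeta>_def e_def)
    qed
    have cardK: "card (K 0) = N + 1" using jI[of 0] by (simp add: K_def I_def)
    have disj: "(\<Sum>l\<in>K 0. indicator (A (K 0) l) (\<lambda>n. w n r)) \<le> (1::real)" for r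
    proof -
      have "card {l \<in> K 0. (\<lambda>n. w n r) \<in> A (K 0) l} \<le> Suc 0"
      proof (subst card_le_Suc0_iff_eq)
        show "\<forall>a\<in>{l \<in> K 0. (\<lambda>n. w n r) \<in> A (K 0) l}. \<forall>b\<in>{l \<in> K 0. (\<lambda>n. w n r) \<in> A (K 0) l}. a = b"
        proof (intro ballI)
          fix a b assume "a \<in> {l \<in> K 0. (\<lambda>n. w n r) \<in> A (K 0) l}" "b \<in> {l \<in> K 0. (\<lambda>n. w n r) \<in> A (K 0) l}"
          then have ab: "a \<in> K 0" "b \<in> K 0" "(\<lambda>n. w n r) \<in> A (K 0) a" "(\<lambda>n. w n r) \<in> A (K 0) b" by auto
          show "a = b"
          proof (rule ccontr)
            assume "a \<noteq> b"
            then have "fst (w a r) < fst (w b r)" "fst (w b r) < fst (w a r)" using ab by (auto simp: A_def)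
            then show False by simp
          qed
        qed
      qed (use finK in simp)
      then show ?thesis using finK[of 0]
        by (simp add: indicator_def sum.If_cases Int_def)
    qed
    have "(real N + 1) * e = (\<Sum>l\<in>K 0. expectation (\<lambda>r. indicator (A (K 0) l) (\<lambda>n. w n r) * \<psi> r))"
      using e_l cardK by simp
    also have "\<dots> = expectation (\<lambda>r. \<Sum>l\<in>K 0. indicator (A (K 0) l) (\<lambda>n. w n r) * \<psi> r)"
    proof (rule Bochner_Integration.integral_sum[symmetric])
      show "integrable P (\<lambda>r. indicator (A (K 0) l) (\<lambda>n. w n r) * \<psi> r)" for l
        using mind[OF finK] \<psi>01 by (intro integrable_AE_bounded AE_I2) (auto simp: indicator_def)
    qed
    also have "\<dots> = expectation (\<lambda>r. (\<Sum>l\<in>K 0. indicator (A (K 0) l) (\<lambda>n. w n r)) * \<psi> r)"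
      by (simp add: sum_distrib_right)
    also have "\<dots> \<le> expectation (\<lambda>r. 1)"
    proof (rule integral_mono)
      show "integrable P (\<lambda>r. (\<Sum>l\<in>K 0. indicator (A (K 0) l) (\<lambda>n. w n r)) * \<psi> r)"
      proof (rule integrable_AE_bounded)
        show "AE r in P. \<bar>(\<Sum>l\<in>K 0. indicator (A (K 0) l) (\<lambda>n. w n r)) * \<psi> r\<bar> \<le> 1"
        proof (intro AE_I2 abs_mult_le_one)
          show "\<bar>\<Sum>l\<in>K 0. indicat_real (A (K 0) l) (\<lambda>n. w n r)\<bar> \<le> 1" for r
            using disj[of r] sum_nonneg[of "K 0" "\<lambda>l. indicat_real (A (K 0) l) (\<lambda>n. w n r)"] by simp
          show "\<bar>\<psi> r\<bar> \<le> 1" for r using \<psi>01[of r] by simp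
        qed
        show "(\<lambda>r. (\<Sum>l\<in>K 0. indicator (A (K 0) l) (\<lambda>n. w n r)) * \<psi> r) \<in> borel_measurable P"
          using mind[OF finK] by (intro borel_measurable_times borel_measurable_sum) auto
      qed
      show "(\<Sum>l\<in>K 0. indicator (A (K 0) l) (\<lambda>n. w n r)) * \<psi> r \<le> 1" for r
        using disj[of r] \<psi>01[of r] by (intro mult_le_one) auto
    qed simp
    finally have e_le: "e \<le> 1 / (real N + 1)" by (simp add: prob_space field_simps)
    define Z where "Z r = lim (cesaro (\<lambda>i. \<zeta> i r))" for r
    have m\<zeta>: "\<zeta> i \<in> borel_measurable P" for i unfolding \<zeta>_def by (rule mind[OF finK])
    have mZ: "Z \<in> borel_measurable P" unfolding Z_def cesaro_def using m\<zeta> by measurable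
    have "inj (\<lambda>i. 1 + int i)" by (auto simp: inj_def)
    from mean_limit[OF e\<phi> \<phi>b this] lim
    have Zlim: "AE r in P. cesaro (\<lambda>i. \<zeta> i r) \<longlonglongrightarrow> Z r \<and> h r - q \<le> Z r"
    proof eventually_elim
      case (elim r)
      have mono: "U m r \<le> U n r" if "\<sigma> m r \<le> \<sigma> n r" for m n
        by (rule LIMSEQ_le[OF elim(2)[rule_format, of m] elim(2)[rule_format, of n]])
          (use that in \<open>auto intro!: exI[of _ 0] cesaro_mono\<close>)
      define G where "G = {k \<in> I. U k r \<le> q}"
      \<comment> \<open>\<open>\<xi>\<close> marks the extra indices that do not exceed some member
        of \<open>G\<close>; these satisfy the constraint automatically. If \<open>G\<close> is
        nonempty, they are the indices not above a maximal member \<open>\<kappa>\<close>, so their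
        frequency is \<open>U \<kappa> r\<close>, at most \<open>q\<close>. What remains of
        \<open>h\<close> is at least \<open>h - q\<close>.\<close>
      define \<xi> where "\<xi> i = (of_bool (\<exists>k\<in>G. \<sigma> (j i) r \<le> \<sigma> k r) :: real)" for i
      have z: "\<zeta> i r = \<phi> (j i) r - \<xi> i" for i
      proof -
        have "(\<lambda>n. w n r) \<in> A (K i) (j i) \<longleftrightarrow> U (j i) r \<le> q \<and> \<not> (\<exists>k\<in>G. \<sigma> (j i) r \<le> \<sigma> k r)"
          using jI[of i] by (auto simp: A_def space_PiM K_def G_def w_def not_le)
        moreover have "\<exists>k\<in>G. \<sigma> (j i) r \<le> \<sigma> k r \<Longrightarrow> U (j i) r \<le> q"
          using mono by (force simp: G_def)
        ultimately show ?thesis by (auto simp: \<zeta>_def \<phi>_def \<xi>_def indicator_def)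
      qed
      have "\<exists>x. cesaro \<xi> \<longlonglongrightarrow> x \<and> x \<le> q"
      proof (cases "G = {}")
        case True
        then have "\<xi> = (\<lambda>_. 0)" by (auto simp: \<xi>_def)
        then show ?thesis using cesaro_const[of 0] q by auto
      next
        case False
        have finG: "finite G" unfolding G_def by (rule finite_subset[of _ I]) (auto simp: I_def)
        define M where "M = Max ((\<lambda>k. \<sigma> k r) ` G)"
        have "M \<in> (\<lambda>k. \<sigma> k r) ` G" unfolding M_def using finG False by (intro Max_in) auto
        then obtain \<kappa> where \<kappa>: "\<kappa> \<in> G" "\<sigma> \<kappa> r = M" by auto
        have le_M: "\<sigma> k r \<le> M" if "k \<in> G" for k using that finG by (simp add: M_def)
        have "(\<exists>k\<in>G. \<sigma> (j i) r \<le> \<sigma> k r) \<longleftrightarrow> \<sigma> (j i) r \<le> M" for i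
          using \<kappa> order_trans[OF _ le_M] by blast
        then have "\<xi> i = of_bool (\<sigma> (1 + int (i + N)) r \<le> \<sigma> \<kappa> r)" for i
          by (simp add: \<xi>_def \<kappa>(2) j_def)
        then have "\<xi> = (\<lambda>i. of_bool (\<sigma> (1 + int (i + N)) r \<le> \<sigma> \<kappa> r))" by auto
        then have "cesaro \<xi> \<longlonglongrightarrow> U \<kappa> r" using cesaro_shift[OF elim(2)[rule_format, of \<kappa>], of N] by simp
        then show ?thesis using \<kappa> by (auto simp: G_def)
      qed
      then obtain x where x: "cesaro \<xi> \<longlonglongrightarrow> x" "x \<le> q" by auto
      have "cesaro (\<lambda>i. \<phi> (j i) r) \<longlonglongrightarrow> h r"
        unfolding j_def h_def using cesaro_shift[OF elim(1), of N] by simp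
      from tendsto_diff[OF this x(1)] have "cesaro (\<lambda>i. \<zeta> i r) \<longlonglongrightarrow> h r - x"
        unfolding z by (simp add: cesaro_diff[abs_def])
      then show ?case using x(2) by (auto simp: Z_def limI)
    qed
    have "expectation (\<lambda>r. Z r * \<psi> r) = e"
      by (rule expectation_averaged[where \<zeta> = \<zeta>, OF m\<zeta> _ mZ _ _ e_i])
        (use \<psi>01 Zlim in \<open>auto simp: \<zeta>_def indicator_def\<close>)
    moreover have "expectation (\<lambda>r. (h r - q) * \<psi> r) \<le> expectation (\<lambda>r. Z r * \<psi> r)"
    proof (rule integral_mono_AE)
      show "AE r in P. (h r - q) * \<psi> r \<le> Z r * \<psi> r"
        using Zlim by eventually_elim (use \<psi>01 in \<open>auto intro: mult_right_mono\<close>)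
      show "integrable P (\<lambda>r. (h r - q) * \<psi> r)"
      proof (rule integrable_const_bound[where B = "1 + q"])
        show "AE r in P. norm ((h r - q) * \<psi> r) \<le> 1 + q"
          using hb by eventually_elim (use q in \<open>auto simp: \<psi>_def\<close>)
      qed simp
      show "integrable P (\<lambda>r. Z r * \<psi> r)"
      proof (rule integrable_AE_bounded)
        show "AE r in P. \<bar>Z r * \<psi> r\<bar> \<le> 1"
          using Zlim
        proof eventually_elim
          case (elim r)
          have "\<bar>Z r\<bar> \<le> 1"
            using elim by (intro LIMSEQ_le_const2[OF tendsto_rabs]) (auto intro!: cesaro_abs_le simp: \<zeta>_def indicator_def)
          then show ?case using \<psi>01[of r] by (intro abs_mult_le_one) auto
        qed
      qed (use mZ in simp)
    qed
    ultimately show ?thesis using e_le by simp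
  qed
  have int: "integrable P (\<lambda>r. (h r - q) * \<psi> r)"
  proof (rule integrable_const_bound[where B = "1 + q"])
    show "AE r in P. norm ((h r - q) * \<psi> r) \<le> 1 + q"
      using hb by eventually_elim (use q in \<open>auto simp: \<psi>_def\<close>)
  qed simp
  have nn: "0 \<le> (h r - q) * \<psi> r" for r by (simp add: \<psi>_def)
  have "expectation (\<lambda>r. (h r - q) * \<psi> r) \<le> 0"
  proof (rule LIMSEQ_le_const)
    have "(\<lambda>N::nat. 1 / (real N + 1)) \<longlonglongrightarrow> 0" by real_asymp
    then show "(\<lambda>N::nat. 1 / (real N + 1)) \<longlonglongrightarrow> 0" .
  qed (use bound in auto)
  moreover have "0 \<le> expectation (\<lambda>r. (h r - q) * \<psi> r)" using nn by simp
  ultimately have "expectation (\<lambda>r. (h r - q) * \<psi> r) = 0" by simp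
  with integral_nonneg_eq_0_iff_AE[OF int] nn have "AE r in P. (h r - q) * \<psi> r = 0" by simp
  then show ?thesis
    unfolding h_def \<phi>_def[symmetric, abs_def]
    by eventually_elim (auto simp: \<psi>_def h_def \<phi>_def[abs_def])
qed

lemma equivariant_of_bool_le:
  "equivariant w \<Longrightarrow> equivariant (\<lambda>n r. of_bool (w n r \<le> (q::real)) :: real)"
  by (rule equivariant_comp) measurable

lemma AE_Up_frequency:
  assumes "0 \<le> q"
  shows "AE r in P. \<exists>l\<le>q. cesaro (\<lambda>i. of_bool (Up (1 + int i) r \<le> q)) \<longlonglongrightarrow> l"
proof -
  have "AE r in P. mean (\<lambda>n r. of_bool (Up n r \<le> q)) r \<le> q"
  proof (rule mean_position_le[OF equivariant_S equivariant_Up assms])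
    show "AE r in P. \<forall>n. cesaro (\<lambda>i. of_bool (S (1 + int i) r \<le> S n r)) \<longlonglongrightarrow> Up n r"
      using AE_frequencies by eventually_elim (simp add: cmp_def)
  qed
  moreover have "AE r in P. cesaro (\<lambda>i. of_bool (Up (1 + int i) r \<le> q)) \<longlonglongrightarrow> mean (\<lambda>n r. of_bool (Up n r \<le> q)) r"
    by (rule mean_limit[OF equivariant_of_bool_le[OF equivariant_Up]]) (auto simp: inj_def)
  ultimately show ?thesis by eventually_elim blast
qed

text \<open>The bound for the reversed order: \<open>- S\<close> has the position
  \<open>1 - Lw\<close>, and the level becomes \<open>1 - q\<close>. Taking complements turns the
  weak inequality into the strict one.\<close>

lemma AE_Lw_frequency:
  assumes "q \<le> 1"
  shows "AE r in P. \<exists>l\<ge>q. cesaro (\<lambda>i. of_bool (Lw (1 + int i) r < q)) \<longlonglongrightarrow> l"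
proof -
  have e: "equivariant (\<lambda>n r. 1 - Lw n r)" by (rule equivariant_comp[OF equivariant_Lw]) simp
  have "AE r in P. mean (\<lambda>n r. of_bool (1 - Lw n r \<le> 1 - q)) r \<le> 1 - q"
  proof (rule mean_position_le[OF _ e])
    show "equivariant (\<lambda>n r. - S n r)" by (rule equivariant_comp[OF equivariant_S]) simp
    show "AE r in P. \<forall>n. cesaro (\<lambda>i. of_bool (- S (1 + int i) r \<le> - S n r)) \<longlonglongrightarrow> 1 - Lw n r"
      using AE_frequencies
    proof eventually_elim
      case (elim r)
      show ?case
      proof
        fix n
        have "(\<lambda>i. of_bool (- S (1 + int i) r \<le> - S n r)) = (\<lambda>i. 1 - cmp (<) (1 + int i) n r)"
          by (auto simp: cmp_def)
        then show "cesaro (\<lambda>i. of_bool (- S (1 + int i) r \<le> - S n r)) \<longlonglongrightarrow> 1 - Lw n r"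
          using tendsto_diff[OF cesaro_const[of 1]] elim by (simp add: cesaro_diff[abs_def])
      qed
    qed
  qed (use assms in simp)
  moreover have "AE r in P. cesaro (\<lambda>i. of_bool (1 - Lw (1 + int i) r \<le> 1 - q)) \<longlonglongrightarrow> mean (\<lambda>n r. of_bool (1 - Lw n r \<le> 1 - q)) r"
    by (rule mean_limit[OF equivariant_of_bool_le[OF e]]) (auto simp: inj_def)
  ultimately show ?thesis
  proof eventually_elim
    case (elim r)
    have "(\<lambda>i. of_bool (Lw (1 + int i) r < q)) = (\<lambda>i. 1 - of_bool (1 - Lw (1 + int i) r \<le> 1 - q) :: real)"
      by auto
    then have "cesaro (\<lambda>i. of_bool (Lw (1 + int i) r < q)) \<longlonglongrightarrow> 1 - mean (\<lambda>n r. of_bool (1 - Lw n r \<le> 1 - q)) r"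
      using tendsto_diff[OF cesaro_const[of 1] elim(2)] by (simp add: cesaro_diff[abs_def])
    then show ?case using elim(1) by (intro exI[of _ "1 - mean (\<lambda>n r. of_bool (1 - Lw n r \<le> 1 - q)) r"]) simp
  qed
qed

end

section \<open>Disjoint intervals and frequencies on a single path\<close>

definition interval_ends :: "(int \<Rightarrow> real) \<Rightarrow> (int \<Rightarrow> real) \<Rightarrow> bool" where
  "interval_ends x y \<longleftrightarrow>
     (\<forall>n. 0 \<le> x n \<and> x n \<le> 1 \<and> 0 \<le> y n \<and> y n \<le> 1) \<and>
     (\<forall>m n. (x m = x n \<and> y m = y n) \<or> max (x m) (y m) \<le> min (x n) (y n) \<or> max (x n) (y n) \<le> min (x m) (y m))"

text \<open>If \<open>q\<close> lies between the two ends at \<open>n\<close>, then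
  \<open>x \<le> q\<close> counts the strictly lower indices, and also those tied with
  \<open>n\<close> when \<open>x n\<close> is the lower end; either way the frequency is the
  opposite end \<open>y n\<close>. The interval is closed on the left because the comparison with
  \<open>q\<close> is weak.\<close>

definition frequencies_at :: "(int \<Rightarrow> real) \<Rightarrow> (int \<Rightarrow> real) \<Rightarrow> real \<Rightarrow> bool" where
  "frequencies_at x y q \<longleftrightarrow>
     (\<exists>a b. cesaro (\<lambda>i. of_bool (x (1 + int i) \<le> q)) \<longlonglongrightarrow> a \<and> cesaro (\<lambda>i. of_bool (y (1 + int i) \<le> q)) \<longlonglongrightarrow> b \<and>
        ((\<exists>n. min (x n) (y n) \<le> q \<and> q < max (x n) (y n) \<and> a = y n \<and> b = x n) \<or>
         ((\<forall>n. \<not> (min (x n) (y n) \<le> q \<and> q < max (x n) (y n))) \<and> a = q \<and> b = q)))"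

context spreadable_order
begin

lemma AE_Up_le_Lw: "AE r in P. \<forall>m n. S m r < S n r \<longrightarrow> Up m r \<le> Lw n r"
  using AE_frequencies
proof eventually_elim
  case (elim r)
  show ?case
  proof (intro allI impI)
    fix m n assume mn: "S m r < S n r"
    show "Up m r \<le> Lw n r"
      by (rule LIMSEQ_le[OF elim[rule_format, THEN conjunct2, of m] elim[rule_format, THEN conjunct1, of n]])
        (use mn in \<open>auto simp: cmp_def intro!: exI[of _ 0] cesaro_mono\<close>)
  qed
qed

lemma AE_interval_ends: "AE r in P. interval_ends (\<lambda>n. X n r) (\<lambda>n. Y n r)"
  using AE_Up_le_Lw AE_ends AE_chain
proof eventually_elim
  case (elim r)
  have mm: "max (X n r) (Y n r) = Up n r" "min (X n r) (Y n r) = Lw n r" for n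
    using elim(2)[rule_format, of n] by auto
  have "(X m r = X n r \<and> Y m r = Y n r) \<or> Up m r \<le> Lw n r \<or> Up n r \<le> Lw m r" for m n
    using elim(1)[rule_format, of m n] elim(1)[rule_format, of n m] elim(3)[rule_format, of m n]
    by (meson linorder_neqE)
  moreover have "0 \<le> X n r \<and> X n r \<le> 1 \<and> 0 \<le> Y n r \<and> Y n r \<le> 1" for n
    using elim(2)[rule_format, of n] by auto
  ultimately show ?case unfolding interval_ends_def mm by blast
qed

lemma AE_frequencies_at:
  assumes q: "0 \<le> q" "q \<le> 1"
  shows "AE r in P. frequencies_at (\<lambda>n. X n r) (\<lambda>n. Y n r) q"
  using AE_Up_le_Lw AE_ends AE_chain AE_frequencies AE_Up_frequency[OF q(1)] AE_Lw_frequency[OF q(2)]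
proof eventually_elim
  case (elim r)
  have mm: "max (X n r) (Y n r) = Up n r" "min (X n r) (Y n r) = Lw n r" for n
    using elim(2)[rule_format, of n] by auto
  have lu: "Lw n r \<le> Up n r" for n using elim(2)[rule_format, of n] by auto
  let ?x = "\<lambda>i. of_bool (X (1 + int i) r \<le> q) :: real"
  let ?y = "\<lambda>i. of_bool (Y (1 + int i) r \<le> q) :: real"
  show ?case
  proof (cases "\<exists>n. Lw n r \<le> q \<and> q < Up n r")
    case True
    then obtain n where n: "Lw n r \<le> q" "q < Up n r" by auto
    have lt: "S k r < S n r \<Longrightarrow> X k r \<le> q \<and> Y k r \<le> q" for k
      using elim(1)[rule_format, of k n] elim(2)[rule_format, of k] n by auto
    have gt: "S n r < S k r \<Longrightarrow> q < X k r \<and> q < Y k r" for k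
      using elim(1)[rule_format, of n k] elim(2)[rule_format, of k] n by auto
    have eq: "S k r = S n r \<Longrightarrow> X k r = X n r \<and> Y k r = Y n r" for k
      using elim(3)[rule_format, of k n] by blast
    have cL: "cesaro (\<lambda>i. cmp (<) (1 + int i) n r) \<longlonglongrightarrow> Lw n r"
      and cU: "cesaro (\<lambda>i. cmp (\<le>) (1 + int i) n r) \<longlonglongrightarrow> Up n r" using elim(4) by auto
    consider "X n r = Lw n r" "Y n r = Up n r" | "X n r = Up n r" "Y n r = Lw n r"
      using elim(2)[rule_format, of n] by auto
    then have "cesaro ?x \<longlonglongrightarrow> Y n r \<and> cesaro ?y \<longlonglongrightarrow> X n r"
    proof cases
      case 1
      have "?x = (\<lambda>i. cmp (\<le>) (1 + int i) n r)"
      proof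
        fix i show "?x i = cmp (\<le>) (1 + int i) n r"
          using lt[of "1 + int i"] gt[of "1 + int i"] eq[of "1 + int i"] n 1
          by (cases "S (1 + int i) r" "S n r" rule: linorder_cases) (auto simp: cmp_def)
      qed
      moreover have "?y = (\<lambda>i. cmp (<) (1 + int i) n r)"
      proof
        fix i show "?y i = cmp (<) (1 + int i) n r"
          using lt[of "1 + int i"] gt[of "1 + int i"] eq[of "1 + int i"] n 1
          by (cases "S (1 + int i) r" "S n r" rule: linorder_cases) (auto simp: cmp_def)
      qed
      ultimately show ?thesis using cL cU 1 by simp
    next
      case 2
      have "?x = (\<lambda>i. cmp (<) (1 + int i) n r)"
      proof
        fix i show "?x i = cmp (<) (1 + int i) n r"
          using lt[of "1 + int i"] gt[of "1 + int i"] eq[of "1 + int i"] n 2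
          by (cases "S (1 + int i) r" "S n r" rule: linorder_cases) (auto simp: cmp_def)
      qed
      moreover have "?y = (\<lambda>i. cmp (\<le>) (1 + int i) n r)"
      proof
        fix i show "?y i = cmp (\<le>) (1 + int i) n r"
          using lt[of "1 + int i"] gt[of "1 + int i"] eq[of "1 + int i"] n 2
          by (cases "S (1 + int i) r" "S n r" rule: linorder_cases) (auto simp: cmp_def)
      qed
      ultimately show ?thesis using cL cU 2 by simp
    qed
    then show ?thesis unfolding frequencies_at_def mm using n by blast
  next
    case False
    \<comment> \<open>Off the intervals \<open>Lw \<le> q\<close> and \<open>Up \<le> q\<close> are
      the same condition, so the upper bound for the frequency of \<open>Up \<le> q\<close> and the
      lower bound for that of \<open>Lw < q\<close> squeeze it to \<open>q\<close>.\<close>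
    obtain u where u: "u \<le> q" "cesaro (\<lambda>i. of_bool (Up (1 + int i) r \<le> q)) \<longlonglongrightarrow> u" using elim(5) by blast
    obtain l where l: "q \<le> l" "cesaro (\<lambda>i. of_bool (Lw (1 + int i) r < q)) \<longlonglongrightarrow> l" using elim(6) by blast
    have ul: "(Up n r \<le> q) = (Lw n r \<le> q)" for n using False lu[of n] by (meson leI order_trans)
    have xy: "(X n r \<le> q) = (Up n r \<le> q)" "(Y n r \<le> q) = (Up n r \<le> q)" for n
      using ul[of n] elim(2)[rule_format, of n] by auto
    have "l \<le> u"
      by (rule LIMSEQ_le[OF l(2) u(2)]) (auto simp: ul intro!: exI[of _ 0] cesaro_mono)
    then have "u = q" using u l by simp
    then have "cesaro ?x \<longlonglongrightarrow> q" "cesaro ?y \<longlonglongrightarrow> q" using u(2) by (simp_all add: xy)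
    then show ?thesis unfolding frequencies_at_def mm using False by blast
  qed
qed

end

section \<open>Gaps of a closed set\<close>

text \<open>Without the end points, as \<open>quantile_le_iff\<close> requires; they form a null
  set.\<close>

abbreviation unit_interval :: "real measure" where
  "unit_interval \<equiv> restrict_space lborel {0<..<1}"

lemma prob_space_unit_interval: "prob_space unit_interval"
  by (auto simp: emeasure_restrict_space space_restrict_space intro!: prob_spaceI)

lemma borel_measurable_unit_interval: "f \<in> borel_measurable borel \<Longrightarrow> f \<in> borel_measurable unit_interval"
  by (rule measurable_restrict_space1) simp

text \<open>Up to the ends of the unit interval, the set lies between \<open>{0<..<c}\<close> and
  \<open>{0<..c}\<close>. Its behaviour at \<open>c\<close> is left open, so weak and strict
  inequalities are covered alike.\<close>

lemma measure_unit_interval_downset: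
  assumes c: "0 \<le> c" "c \<le> 1" and D: "\<And>v. 0 < v \<Longrightarrow> v < 1 \<Longrightarrow> v < c \<Longrightarrow> v \<in> D"
    "\<And>v. 0 < v \<Longrightarrow> v < 1 \<Longrightarrow> v \<in> D \<Longrightarrow> v \<le> c"
    and m: "{v \<in> space unit_interval. v \<in> D} \<in> sets unit_interval"
  shows "measure unit_interval {v \<in> space unit_interval. v \<in> D} = c"
proof -
  interpret prob_space unit_interval by (rule prob_space_unit_interval)
  have sp: "space unit_interval = {0<..<1}" by (simp add: space_restrict_space)
  have s: "{0<..<1} \<inter> {..<c} \<in> sets unit_interval" "{0<..<1} \<inter> {..c} \<in> sets unit_interval"
    by (simp_all add: sets_restrict_space_iff)
  have "{0<..<1} \<inter> {..<c} = {0<..<c}" using c by auto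
  moreover have "measure unit_interval ({0<..<1} \<inter> {..<c}) = measure lborel ({0<..<1} \<inter> {..<c})"
    by (subst measure_restrict_space) auto
  ultimately have 1: "measure unit_interval ({0<..<1} \<inter> {..<c}) = c" using c by (simp only:) simp
  have "measure unit_interval ({0<..<1} \<inter> {..c}) = measure lborel ({0<..<1} \<inter> {..c})"
    by (subst measure_restrict_space) auto
  also have "\<dots> \<le> c"
  proof -
    have "measure lborel ({0<..<1} \<inter> {..c}) \<le> measure lborel {0..c}"
      by (rule measure_mono_fmeasurable) (auto simp: fmeasurable_def emeasure_lborel_Icc_eq)
    then show ?thesis using c by simp
  qed
  finally have 2: "measure unit_interval ({0<..<1} \<inter> {..c}) \<le> c" .
  have "measure unit_interval ({0<..<1} \<inter> {..<c}) \<le> measure unit_interval {v \<in> space unit_interval. v \<in> D}"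
    by (rule finite_measure_mono) (use D(1) m in \<open>auto simp: sp\<close>)
  moreover have "measure unit_interval {v \<in> space unit_interval. v \<in> D} \<le> measure unit_interval ({0<..<1} \<inter> {..c})"
    by (rule finite_measure_mono) (use D(2) s in \<open>auto simp: sp\<close>)
  ultimately show ?thesis using 1 2 by simp
qed

lemma (in prob_space) measure_Int_nested:
  assumes "A \<subseteq> B \<or> B \<subseteq> A" "A \<in> events" "B \<in> events"
  shows "measure M (A \<inter> B) = min (measure M A) (measure M B)"
  using assms finite_measure_mono[of A B] finite_measure_mono[of B A]
  by (auto simp: Int_absorb1 Int_absorb2 min_def)

locale gap_choice =
  fixes F :: "real set" and x :: "real set \<Rightarrow> real"
  assumes closed_F: "closed F" and F_sub: "F \<subseteq> {0..1}" and F_ends: "0 \<in> F" "1 \<in> F"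
    and x_end: "\<And>G. G \<in> gaps F \<Longrightarrow> x G = Inf G \<or> x G = Sup G"
begin

lemma open_complement: "open ({0..1} - F)"
proof -
  have "{0..1} - F = {0<..<1} - F"
  proof (intro set_eqI iffI)
    fix u assume u: "u \<in> {0..1} - F"
    then have "u \<noteq> 0" "u \<noteq> 1" using F_ends by auto
    then show "u \<in> {0<..<1} - F" using u by auto
  qed auto
  then show ?thesis using closed_F by (simp add: open_Diff)
qed

text \<open>An open connected subset of the line is an open interval; an end point outside
  \<open>F\<close> could be added to the component, contradicting maximality.\<close>

lemma gap_interval:
  assumes "G \<in> gaps F"
  shows "G = {Inf G<..<Sup G}" "Inf G < Sup G" "Inf G \<in> F" "Sup G \<in> F"
proof -
  let ?O = "{0..1} - F"
  have G: "G \<in> components ?O" using assms by (simp add: gaps_def)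
  have ne: "G \<noteq> {}" and conn: "connected G" and sub: "G \<subseteq> ?O" and op: "open G"
    using in_components_nonempty[OF G] in_components_connected[OF G] in_components_subset[OF G]
      open_components[OF open_complement G] by auto
  have bdd: "bdd_below G" "bdd_above G" using sub by (auto intro!: bdd_belowI[of _ 0] bdd_aboveI[of _ 1])
  have inner: "Inf G < u \<and> u < Sup G" if u: "u \<in> G" for u
  proof -
    obtain e where e: "e > 0" "ball u e \<subseteq> G" using op u by (meson openE)
    have "u - e / 2 \<in> G" "u + e / 2 \<in> G" using e by (auto simp: dist_real_def intro!: subsetD[OF e(2)])
    then have "Inf G \<le> u - e / 2" "u + e / 2 \<le> Sup G" using bdd by (auto intro: cInf_lower cSup_upper)
    then show ?thesis using e by linarith
  qed
  have ic: "{a..b} \<subseteq> G" if "a \<in> G" "b \<in> G" for a b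
    using conn that by (simp add: connected_contains_Icc)
  show eq: "G = {Inf G<..<Sup G}"
  proof (intro set_eqI iffI)
    fix u assume "u \<in> {Inf G<..<Sup G}"
    then obtain a b where "a \<in> G" "a < u" "b \<in> G" "u < b"
      using cInf_lessD[OF ne, of u] less_cSupD[OF ne, of u] by auto
    then show "u \<in> G" using ic[of a b] by auto
  qed (use inner in auto)
  obtain c where c: "c \<in> G" using ne by auto
  show lt: "Inf G < Sup G" using inner[OF c] by simp
  have c': "Inf G < c" "c < Sup G" using inner[OF c] by auto
  have bounds: "0 \<le> Inf G" "Sup G \<le> 1" using sub ne by (auto intro!: cInf_greatest cSup_least)
  show "Inf G \<in> F"
  proof (rule ccontr)
    assume "Inf G \<notin> F"
    moreover have "{Inf G..c} \<subseteq> insert (Inf G) G" using eq c' by auto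
    ultimately have "{Inf G..c} \<subseteq> ?O" using sub bounds lt by auto
    moreover have "G \<inter> {Inf G..c} \<noteq> {}" using c c' by auto
    ultimately have "{Inf G..c} \<subseteq> G" by (intro components_maximal[OF G connected_Icc])
    then have "Inf G \<in> G" using c' by auto
    then show False using inner by auto
  qed
  show "Sup G \<in> F"
  proof (rule ccontr)
    assume "Sup G \<notin> F"
    moreover have "{c..Sup G} \<subseteq> insert (Sup G) G" using eq c' by auto
    ultimately have "{c..Sup G} \<subseteq> ?O" using sub bounds lt by auto
    moreover have "G \<inter> {c..Sup G} \<noteq> {}" using c c' by auto
    ultimately have "{c..Sup G} \<subseteq> G" by (intro components_maximal[OF G connected_Icc])
    then have "Sup G \<in> G" using c' by auto
    then show False using inner by auto
  qed
qed

lemma gap_mem: "G \<in> gaps F \<Longrightarrow> u \<in> G \<longleftrightarrow> Inf G < u \<and> u < Sup G"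
  using gap_interval(1)[of G] by (metis greaterThanLessThan_iff)

lemma gap_bounds: "G \<in> gaps F \<Longrightarrow> 0 \<le> Inf G \<and> Sup G \<le> 1"
  using gap_interval(3,4)[of G] F_sub by (meson atLeastAtMost_iff subsetD)

lemma gap_disjoint_F: "G \<in> gaps F \<Longrightarrow> u \<in> G \<Longrightarrow> u \<notin> F"
  using in_components_subset[of G "{0..1} - F"] by (auto simp: gaps_def)

lemma gap_separated:
  assumes "G \<in> gaps F" "H \<in> gaps F" "u \<in> G" "v \<in> H" "u < v" "G \<noteq> H"
  shows "Sup G \<le> Inf H"
proof (rule ccontr)
  assume "\<not> Sup G \<le> Inf H"
  then have lt: "Inf H < Sup G" by simp
  have u: "Inf G < u" "u < Sup G" using gap_mem[OF assms(1)] assms(3) by blast+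
  have v: "Inf H < v" "v < Sup H" using gap_mem[OF assms(2)] assms(4) by blast+
  define w where "w = (max (Inf G) (Inf H) + min (Sup G) (Sup H)) / 2"
  have "max (Inf G) (Inf H) < min (Sup G) (Sup H)" using u v lt assms(5) by auto
  then have "w \<in> {Inf G<..<Sup G}" "w \<in> {Inf H<..<Sup H}" by (auto simp: w_def)
  then have "w \<in> G \<inter> H" using gap_interval(1)[OF assms(1)] gap_interval(1)[OF assms(2)] by blast
  then show False using assms components_nonoverlap[of G "{0..1} - F" H] by (auto simp: gaps_def)
qed

definition gap_of :: "real \<Rightarrow> real set" where "gap_of u = connected_component_set ({0..1} - F) u"

lemma gap_of_in: "u \<in> {0..1} \<Longrightarrow> u \<notin> F \<Longrightarrow> gap_of u \<in> gaps F \<and> u \<in> gap_of u"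
  unfolding gap_of_def gaps_def by (simp add: componentsI)

lemma gap_of_eq: "G \<in> gaps F \<Longrightarrow> u \<in> G \<Longrightarrow> gap_of u = G"
  unfolding gap_of_def gaps_def by (erule componentsE) (simp add: connected_component_eq)

definition T :: "real \<Rightarrow> real \<times> real" where
  "T u = (if u \<in> F then (u, u) else (x (gap_of u), other_end x (gap_of u)))"

definition lo :: "real \<Rightarrow> real" where "lo u = (if u \<in> F then u else Inf (gap_of u))"
definition hi :: "real \<Rightarrow> real" where "hi u = (if u \<in> F then u else Sup (gap_of u))"

lemma lo_hi: assumes "u \<in> {0<..<1}" shows "lo u \<le> u" "u \<le> hi u" "0 \<le> lo u" "hi u \<le> 1" "lo u \<in> F" "hi u \<in> F"
proof -
  have "lo u \<le> u \<and> u \<le> hi u \<and> 0 \<le> lo u \<and> hi u \<le> 1 \<and> lo u \<in> F \<and> hi u \<in> F"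
  proof (cases "u \<in> F")
    case True
    then show ?thesis using assms by (auto simp: lo_def hi_def)
  next
    case False
    then have G: "gap_of u \<in> gaps F" "u \<in> gap_of u" using gap_of_in[of u] assms by auto
    show ?thesis using gap_interval(3,4)[OF G(1)] gap_mem[OF G(1), of u] G(2) gap_bounds[OF G(1)] False
      by (simp add: lo_def hi_def)
  qed
  then show "lo u \<le> u" "u \<le> hi u" "0 \<le> lo u" "hi u \<le> 1" "lo u \<in> F" "hi u \<in> F" by auto
qed

lemma T_ends:
  assumes "u \<in> {0<..<1}"
  shows "(fst (T u) = lo u \<and> snd (T u) = hi u) \<or> (fst (T u) = hi u \<and> snd (T u) = lo u)"
proof (cases "u \<in> F")
  case False
  then have G: "gap_of u \<in> gaps F" using gap_of_in[of u] assms by auto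
  show ?thesis using x_end[OF G] False by (auto simp: T_def lo_def hi_def other_end_def)
qed (auto simp: T_def lo_def hi_def)

lemma separated:
  assumes "u \<in> {0<..<1}" "v \<in> {0<..<1}" "u < v"
  shows "hi u \<le> lo v \<or> (T u = T v \<and> u \<notin> F \<and> v \<notin> F \<and> gap_of u = gap_of v)"
proof (cases "u \<in> F"; cases "v \<in> F")
  assume "u \<in> F" "v \<in> F"
  then show ?thesis using assms by (auto simp: lo_def hi_def)
next
  assume u: "u \<in> F" and v: "v \<notin> F"
  then have G: "gap_of v \<in> gaps F" "v \<in> gap_of v" using gap_of_in[of v] assms by auto
  have "u \<notin> gap_of v" using gap_disjoint_F[OF G(1)] u by auto
  then have "u \<le> Inf (gap_of v)" using gap_interval(1)[OF G(1)] G(2) assms(3)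
    by (metis greaterThanLessThan_iff less_trans not_le)
  then show ?thesis using u v by (auto simp: lo_def hi_def)
next
  assume u: "u \<notin> F" and v: "v \<in> F"
  then have G: "gap_of u \<in> gaps F" "u \<in> gap_of u" using gap_of_in[of u] assms by auto
  have "v \<notin> gap_of u" using gap_disjoint_F[OF G(1)] v by auto
  then have "Sup (gap_of u) \<le> v" using gap_interval(1)[OF G(1)] G(2) assms(3)
    by (metis greaterThanLessThan_iff less_trans not_le)
  then show ?thesis using u v by (auto simp: lo_def hi_def)
next
  assume u: "u \<notin> F" and v: "v \<notin> F"
  then have G: "gap_of u \<in> gaps F" "u \<in> gap_of u" "gap_of v \<in> gaps F" "v \<in> gap_of v"
    using gap_of_in[of u] gap_of_in[of v] assms by auto
  show ?thesis
  proof (cases "gap_of u = gap_of v")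
    case True
    then show ?thesis using u v by (simp add: T_def)
  next
    case False
    then show ?thesis using gap_separated[OF G(1,3,2,4) assms(3)] u v by (simp add: lo_def hi_def)
  qed
qed

text \<open>Distinct blocks, points of \<open>F\<close> or gaps, are separated by
  \<open>hi u \<le> lo v\<close>, and on one gap \<open>T\<close> is constant. Both coordinates are
  therefore monotone whichever ends are chosen, which gives measurability and makes them
  comonotone.\<close>

lemma T_mono:
  assumes "u \<in> {0<..<1}" "v \<in> {0<..<1}" "u \<le> v"
  shows "fst (T u) \<le> fst (T v) \<and> snd (T u) \<le> snd (T v)"
proof (cases "u = v")
  case False
  then have "hi u \<le> lo v \<or> T u = T v" using separated[OF assms(1,2)] assms(3) by auto
  then show ?thesis using T_ends[OF assms(1)] T_ends[OF assms(2)] lo_hi[OF assms(1)] lo_hi[OF assms(2)] by auto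
qed simp

lemma T_measurable:
  "(\<lambda>u. fst (T u)) \<in> borel_measurable unit_interval" "(\<lambda>u. snd (T u)) \<in> borel_measurable unit_interval"
proof -
  have "(\<lambda>u. fst (T u)) \<in> borel_measurable (restrict_space borel {0<..<1})"
    "(\<lambda>u. snd (T u)) \<in> borel_measurable (restrict_space borel {0<..<1})"
    using T_mono by (auto intro!: borel_measurable_mono_on_fnc mono_onI)
  moreover have "sets (restrict_space borel {0<..<1}) = sets unit_interval" by (rule sets_restrict_space_cong) simp
  ultimately show "(\<lambda>u. fst (T u)) \<in> borel_measurable unit_interval" "(\<lambda>u. snd (T u)) \<in> borel_measurable unit_interval"
    using measurable_cong_sets by blast+
qed

lemma T_measurable_pair [measurable]: "T \<in> borel_measurable unit_interval"
proof -
  have "(\<lambda>u. (fst (T u), snd (T u))) \<in> borel_measurable unit_interval"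
    using T_measurable by (intro borel_measurable_Pair)
  then show ?thesis by simp
qed

lemma T_on_gap: "G \<in> gaps F \<Longrightarrow> u \<in> G \<Longrightarrow> T u = (x G, other_end x G)"
  using gap_of_eq[of G u] gap_disjoint_F[of G u] by (simp add: T_def)

lemma countable_gaps: "countable (gaps F)"
proof (rule countable_disjoint_open_subsets)
  show "open G" if "G \<in> gaps F" for G using that open_components[OF open_complement] by (auto simp: gaps_def)
  show "pairwise disjnt (gaps F)"
    using pairwise_disjoint_components[of "{0..1} - F"] unfolding gaps_def pairwise_def disjnt_def .
qed

text \<open>\<open>T\<close> is constant on each gap, so the preimage of \<open>A\<close> consists,
  up to the two end points, of the points of \<open>F\<close> with \<open>(t, t)\<close> in
  \<open>A\<close> and of whole gaps, of which there are countably many.\<close>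

lemma emeasure_distr_T:
  assumes A: "A \<in> sets borel"
  shows "emeasure (distr unit_interval borel T) A =
    emeasure lborel {t \<in> F. (t, t) \<in> A} +
    (\<integral>\<^sup>+ G. emeasure lborel G * indicator A (x G, other_end x G) \<partial>count_space (gaps F))"
proof -
  define X where "X G = (if (x G, other_end x G) \<in> A then G else {})" for G :: "real set"
  let ?D = "{t \<in> F. (t, t) \<in> A}"
  have op: "open G" if "G \<in> gaps F" for G using that open_components[OF open_complement] by (auto simp: gaps_def)
  have [measurable]: "F \<in> sets borel" using closed_F by (rule borel_closed)
  have "(\<lambda>t::real. (t, t)) \<in> borel_measurable borel" by (intro borel_measurable_Pair) auto
  then have "(\<lambda>t::real. (t, t)) -` A \<inter> space borel \<in> sets borel" by (rule measurable_sets) (rule A)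
  then have mD: "?D \<in> sets borel"
  proof -
    have "?D = F \<inter> ((\<lambda>t::real. (t, t)) -` A \<inter> space borel)" by auto
    then show ?thesis using \<open>(\<lambda>t. (t, t)) -` A \<inter> space borel \<in> sets borel\<close> by simp
  qed
  have G01: "u \<in> {0<..<1}" if "G \<in> gaps F" "u \<in> G" for G u
  proof -
    have "Inf G < u" "u < Sup G" using gap_mem[OF that(1)] that(2) by blast+
    then show ?thesis using gap_bounds[OF that(1)] by simp
  qed
  have Teq: "T -` A \<inter> {0<..<1} = (?D \<inter> {0<..<1}) \<union> (\<Union>G\<in>gaps F. X G)"
  proof (intro set_eqI iffI)
    fix u assume u: "u \<in> T -` A \<inter> {0<..<1}"
    show "u \<in> (?D \<inter> {0<..<1}) \<union> (\<Union>G\<in>gaps F. X G)"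
    proof (cases "u \<in> F")
      case True
      then show ?thesis using u by (auto simp: T_def)
    next
      case False
      then have "gap_of u \<in> gaps F" "u \<in> gap_of u" using gap_of_in[of u] u by auto
      moreover have "u \<in> X (gap_of u)" using calculation u False by (auto simp: X_def T_def)
      ultimately show ?thesis by blast
    qed
  next
    fix u assume "u \<in> (?D \<inter> {0<..<1}) \<union> (\<Union>G\<in>gaps F. X G)"
    then show "u \<in> T -` A \<inter> {0<..<1}"
    proof
      assume "u \<in> (\<Union>G\<in>gaps F. X G)"
      then obtain G where G: "G \<in> gaps F" "u \<in> X G" by auto
      then have "u \<in> G" "(x G, other_end x G) \<in> A" by (auto simp: X_def split: if_splits)
      then show ?thesis using G01[OF G(1)] T_on_gap[OF G(1)] by auto
    qed (auto simp: T_def)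
  qed
  have mX: "X G \<in> sets borel" if "G \<in> gaps F" for G using op[OF that] by (auto simp: X_def)
  have mU: "(\<Union>G\<in>gaps F. X G) \<in> sets borel" by (rule sets.countable_UN'[OF countable_gaps]) (use mX in blast)
  have "emeasure (distr unit_interval borel T) A = emeasure unit_interval (T -` A \<inter> space unit_interval)"
    using A by (intro emeasure_distr) auto
  also have "T -` A \<inter> space unit_interval = T -` A \<inter> {0<..<1}" by (simp add: space_restrict_space)
  also have "emeasure unit_interval \<dots> = emeasure lborel (T -` A \<inter> {0<..<1})"
    by (subst emeasure_restrict_space) auto
  also have "\<dots> = emeasure lborel (?D \<inter> {0<..<1}) + emeasure lborel (\<Union>G\<in>gaps F. X G)"
    unfolding Teq
  proof (rule plus_emeasure[symmetric])
    show "(?D \<inter> {0<..<1}) \<inter> (\<Union>G\<in>gaps F. X G) = {}"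
      using gap_disjoint_F by (auto simp: X_def split: if_splits)
  qed (use mD mU in auto)
  also have "emeasure lborel (?D \<inter> {0<..<1}) = emeasure lborel ?D"
  proof (rule emeasure_eq_AE)
    have "AE t in lborel. t \<noteq> 0 \<and> t \<noteq> (1::real)" using AE_lborel_singleton[of 0] AE_lborel_singleton[of 1] by eventually_elim simp
    then show "AE t in lborel. t \<in> ?D \<inter> {0<..<1} \<longleftrightarrow> t \<in> ?D"
      by eventually_elim (use F_sub in auto)
  qed (use mD in auto)
  also have "emeasure lborel (\<Union>G\<in>gaps F. X G) = (\<integral>\<^sup>+ G. emeasure lborel (X G) \<partial>count_space (gaps F))"
  proof (rule emeasure_UN_countable[OF _ countable_gaps])
    have "G \<inter> H = {}" if "G \<in> gaps F" "H \<in> gaps F" "G \<noteq> H" for G H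
      using components_nonoverlap[of G "{0..1} - F" H] that by (simp add: gaps_def)
    then show "disjoint_family_on X (gaps F)"
      unfolding disjoint_family_on_def X_def by simp
  qed (use mX in auto)
  also have "\<dots> = (\<integral>\<^sup>+ G. emeasure lborel G * indicator A (x G, other_end x G) \<partial>count_space (gaps F))"
    by (rule nn_integral_cong) (auto simp: X_def)
  finally show ?thesis .
qed

text \<open>\<open>measure_of\<close> reproduces a set function only if that is a measure.
  Identifying it with the values of an image measure settles countable additivity.\<close>

lemma pair_law_eq: "pair_law F x = distr unit_interval borel T"
proof -
  let ?N = "distr unit_interval borel T"
  have "pair_law F x = measure_of UNIV (sets borel) (emeasure ?N)"
    unfolding pair_law_def
  proof (rule measure_of_eq)
    show "sets (borel :: (real \<times> real) measure) \<subseteq> Pow UNIV" by simp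
    fix A assume "A \<in> sigma_sets UNIV (sets (borel :: (real \<times> real) measure))"
    then have "A \<in> sets borel" using sets.sigma_sets_eq[of "borel :: (real \<times> real) measure"] by simp
    from emeasure_distr_T[OF this]
    show "emeasure lborel {t \<in> F. (t, t) \<in> A} +
      (\<integral>\<^sup>+ G. emeasure lborel G * indicator A (x G, other_end x G) \<partial>count_space (gaps F)) = emeasure ?N A" by simp
  qed
  also have "\<dots> = ?N" using measure_of_of_measure[of ?N] by simp
  finally show ?thesis .
qed

lemma decomposition_iff:
  "decomposition \<mu> F x \<longleftrightarrow> \<mu> = distr unit_interval borel (\<lambda>u. fst (T u))"
proof -
  have eq: "emeasure (distr unit_interval borel (\<lambda>u. fst (T u))) A = emeasure lborel (A \<inter> F) +
        (\<integral>\<^sup>+ G. emeasure lborel G * indicator A (x G) \<partial>count_space (gaps F))" if A: "A \<in> sets borel" for A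
  proof -
    have m: "A \<times> UNIV \<in> sets (borel :: (real \<times> real) measure)"
      unfolding borel_prod[symmetric] using A by auto
    have "emeasure (distr unit_interval borel (\<lambda>u. fst (T u))) A = emeasure (distr unit_interval borel T) (A \<times> UNIV)"
      using A m T_measurable(1) by (simp add: emeasure_distr vimage_def mem_Times_iff)
    also have "\<dots> = emeasure lborel {t \<in> F. (t, t) \<in> A \<times> (UNIV :: real set)} +
      (\<integral>\<^sup>+ G. emeasure lborel G * indicator (A \<times> UNIV) (x G, other_end x G) \<partial>count_space (gaps F))"
      by (rule emeasure_distr_T[OF m])
    finally have *: "emeasure (distr unit_interval borel (\<lambda>u. fst (T u))) A =
      emeasure lborel {t \<in> F. (t, t) \<in> A \<times> (UNIV :: real set)} +
      (\<integral>\<^sup>+ G. emeasure lborel G * indicator (A \<times> UNIV) (x G, other_end x G) \<partial>count_space (gaps F))" .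
    have "{t \<in> F. (t, t) \<in> A \<times> (UNIV :: real set)} = A \<inter> F" by auto
    moreover have "indicator (A \<times> (UNIV :: real set)) (x G, other_end x G) = (indicator A (x G) :: ennreal)" for G
      by (auto simp: indicator_def)
    ultimately show ?thesis using * by (simp only:)
  qed
  show ?thesis
  proof
    assume "decomposition \<mu> F x"
    then show "\<mu> = distr unit_interval borel (\<lambda>u. fst (T u))"
      by (intro measure_eqI) (auto simp: decomposition_def eq)
  next
    assume "\<mu> = distr unit_interval borel (\<lambda>u. fst (T u))"
    then show "decomposition \<mu> F x"
      using closed_F F_sub F_ends x_end by (auto simp: decomposition_def eq)
  qed
qed

lemma fst_T_events: "{v \<in> space unit_interval. fst (T v) \<le> q} \<in> sets unit_interval"
  and snd_T_events: "{v \<in> space unit_interval. snd (T v) \<le> q} \<in> sets unit_interval"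
  using T_measurable by measurable

text \<open>Points to the left of \<open>G\<close> are sent to values at most \<open>q\<close>,
  points to the right to values above \<open>q\<close>. The gap itself is counted exactly if
  \<open>x G\<close> is its left end, so the mass reaches up to the opposite end.\<close>

lemma fst_T_frequency_gap:
  assumes G: "G \<in> gaps F" and q: "Inf G \<le> q" "q < Sup G"
  shows "measure unit_interval {v \<in> space unit_interval. fst (T v) \<le> q} = other_end x G"
proof -
  note I = gap_interval[OF G] and B = gap_bounds[OF G]
  have below: "hi v \<le> Inf G" if "v \<in> {0<..<1}" "v \<le> Inf G" for v
  proof (cases "v \<in> F")
    case False
    then have H: "gap_of v \<in> gaps F" "v \<in> gap_of v" using gap_of_in[of v] that by auto
    have "v \<notin> G" using I(1) that(2) by (metis greaterThanLessThan_iff not_le)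
    then have ne: "gap_of v \<noteq> G" using H by auto
    obtain w where w: "w \<in> G" using I(1,2) dense by (metis greaterThanLessThan_iff)
    then have "v < w" using I(1) that(2) by (metis greaterThanLessThan_iff le_less_trans)
    from gap_separated[OF H(1) G H(2) w this ne] show ?thesis using False by (simp add: hi_def)
  qed (use that in \<open>simp add: hi_def\<close>)
  have above: "Sup G \<le> lo v" if "v \<in> {0<..<1}" "Sup G \<le> v" for v
  proof (cases "v \<in> F")
    case False
    then have H: "gap_of v \<in> gaps F" "v \<in> gap_of v" using gap_of_in[of v] that by auto
    have "v \<notin> G" using I(1) that(2) by (metis greaterThanLessThan_iff not_le)
    then have ne: "G \<noteq> gap_of v" using H by auto
    obtain w where w: "w \<in> G" using I(1,2) dense by (metis greaterThanLessThan_iff)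
    then have "w < v" using I(1) that(2) by (metis greaterThanLessThan_iff less_le_trans)
    from gap_separated[OF G H(1) w H(2) this ne] show ?thesis using False by (simp add: lo_def)
  qed (use that in \<open>simp add: lo_def\<close>)
  have T_below: "fst (T v) \<le> q" if v: "v \<in> {0<..<1}" "v \<le> Inf G" for v
    using T_ends[OF v(1)] lo_hi[OF v(1)] below[OF v] q by auto
  have T_above: "q < fst (T v)" if v: "v \<in> {0<..<1}" "Sup G \<le> v" for v
    using T_ends[OF v(1)] lo_hi[OF v(1)] above[OF v] q by auto
  have T_in: "fst (T v) = x G" if "Inf G < v" "v < Sup G" for v
    using T_on_gap[OF G, of v] I(1) that by (metis fst_conv greaterThanLessThan_iff)
  have sp: "{v \<in> space unit_interval. fst (T v) \<le> q} = {v \<in> space unit_interval. v \<in> {v. fst (T v) \<le> q}}" by simp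
  show ?thesis
  proof (cases "x G = Inf G")
    case True
    then have "other_end x G = Sup G" by (simp add: other_end_def)
    moreover have "measure unit_interval {v \<in> space unit_interval. v \<in> {v. fst (T v) \<le> q}} = Sup G"
    proof (rule measure_unit_interval_downset)
      show "v \<in> {v. fst (T v) \<le> q}" if "0 < v" "v < 1" "v < Sup G" for v
        using T_below[of v] T_in[of v] True q that by (cases "v \<le> Inf G") auto
      show "v \<le> Sup G" if "0 < v" "v < 1" "v \<in> {v. fst (T v) \<le> q}" for v
        using T_above[of v] that by (cases "v \<le> Sup G") auto
    qed (use B I(2) fst_T_events in auto)
    ultimately show ?thesis by simp
  next
    case False
    then have x: "x G = Sup G" "other_end x G = Inf G" using x_end[OF G] by (auto simp: other_end_def)
    moreover have "measure unit_interval {v \<in> space unit_interval. v \<in> {v. fst (T v) \<le> q}} = Inf G"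
    proof (rule measure_unit_interval_downset)
      show "v \<in> {v. fst (T v) \<le> q}" if "0 < v" "v < 1" "v < Inf G" for v
        using T_below[of v] that by auto
      show "v \<le> Inf G" if "0 < v" "v < 1" "v \<in> {v. fst (T v) \<le> q}" for v
        using T_above[of v] T_in[of v] x q that by (cases "v \<le> Inf G"; cases "v < Sup G") auto
    qed (use B I(2) fst_T_events in auto)
    ultimately show ?thesis by simp
  qed
qed

text \<open>A point \<open>q\<close> of \<open>F\<close> is not crossed by \<open>T\<close>. Left
  ends are excluded because a gap with \<open>x G = Inf G\<close> sends all its points there and
  would be counted as well.\<close>

lemma fst_T_frequency_F:
  assumes q: "q \<in> F" "\<And>G. G \<in> gaps F \<Longrightarrow> Inf G \<noteq> q"
  shows "measure unit_interval {v \<in> space unit_interval. fst (T v) \<le> q} = q"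
proof -
  have q01: "0 \<le> q" "q \<le> 1" using q(1) F_sub by auto
  have "measure unit_interval {v \<in> space unit_interval. v \<in> {v. fst (T v) \<le> q}} = q"
  proof (rule measure_unit_interval_downset[OF q01])
    show "v \<in> {v. fst (T v) \<le> q}" if v: "0 < v" "v < 1" "v < q" for v
    proof -
      have v': "v \<in> {0<..<1}" using v by simp
      have "hi v \<le> q"
      proof (cases "q = 1")
        case False
        then have "q \<in> {0<..<1}" using v q01 by auto
        from separated[OF v' this v(3)] show ?thesis using q(1) by (auto simp: lo_def)
      qed (use lo_hi[OF v'] in auto)
      then show ?thesis using T_ends[OF v'] lo_hi[OF v'] by auto
    qed
    show "v \<le> q" if v: "0 < v" "v < 1" "v \<in> {v. fst (T v) \<le> q}" for v
    proof (rule ccontr)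
      assume "\<not> v \<le> q"
      then have qv: "q < v" by simp
      have v': "v \<in> {0<..<1}" using v by simp
      have ql: "q \<le> lo v"
      proof (cases "q = 0")
        case False
        then have "q \<in> {0<..<1}" using v q01 qv by auto
        from separated[OF this v' qv] show ?thesis using q(1) by (auto simp: hi_def)
      qed (use lo_hi[OF v'] in auto)
      then have "lo v = q" using T_ends[OF v'] lo_hi[OF v'] v(3) by auto
      then have "v \<notin> F" "Inf (gap_of v) = q" using qv by (auto simp: lo_def split: if_splits)
      then show False using q(2) gap_of_in[of v] v by auto
    qed
  qed (use fst_T_events in simp)
  then show ?thesis by simp
qed

text \<open>This makes the conjugate law an explicit function of the law of its first coordinate: see
  \<open>conjugate_kernel\<close> below. The exceptional points are the left ends of the gaps.\<close>

lemma snd_T_eq_cdf: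
  "AE u in unit_interval. snd (T u) = cdf (distr unit_interval borel (\<lambda>u. fst (T u))) u"
proof -
  have cdf: "cdf (distr unit_interval borel (\<lambda>u. fst (T u))) u = measure unit_interval {v \<in> space unit_interval. fst (T v) \<le> u}" for u
    unfolding cdf_def using T_measurable(1) by (subst measure_distr) (auto intro!: arg_cong2[where f = measure])
  have "AE u in lborel. u \<notin> Inf ` gaps F"
    by (rule AE_not_in) (rule countable_imp_null_set_lborel[OF countable_image[OF countable_gaps]])
  then have "AE u in lborel. u \<in> {0<..<1} \<longrightarrow> snd (T u) = cdf (distr unit_interval borel (\<lambda>u. fst (T u))) u"
  proof eventually_elim
    case (elim u)
    show ?case unfolding cdf
    proof
      assume u: "u \<in> {0<..<1}"
      show "snd (T u) = measure unit_interval {v \<in> space unit_interval. fst (T v) \<le> u}"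
      proof (cases "u \<in> F")
        case True
        have "\<And>G. G \<in> gaps F \<Longrightarrow> Inf G \<noteq> u" using elim by blast
        from fst_T_frequency_F[OF True this] have "measure unit_interval {v \<in> space unit_interval. fst (T v) \<le> u} = u" .
        moreover have "snd (T u) = u" by (simp add: T_def True)
        ultimately show ?thesis by (simp only:)
      next
        case False
        then have G: "gap_of u \<in> gaps F" "u \<in> gap_of u" using gap_of_in[of u] u by auto
        have "Inf (gap_of u) \<le> u" "u < Sup (gap_of u)" using gap_mem[OF G(1)] G(2) by auto
        note fst_T_frequency_gap[OF G(1) this]
        moreover have "snd (T u) = other_end x (gap_of u)" by (simp add: T_def False)
        ultimately show ?thesis by (simp only:)
      qed
    qed
  qed
  then show ?thesis by (subst AE_restrict_space_iff) auto
qed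

text \<open>By \<open>T_mono\<close> the two events are initial segments of the interval, hence
  nested.\<close>

lemma T_cdf_min:
  "measure (distr unit_interval borel T) {..(p, q)} =
     min (measure unit_interval {v \<in> space unit_interval. fst (T v) \<le> p})
         (measure unit_interval {v \<in> space unit_interval. snd (T v) \<le> q})"
proof -
  interpret prob_space unit_interval by (rule prob_space_unit_interval)
  let ?A = "{v \<in> space unit_interval. fst (T v) \<le> p}" and ?B = "{v \<in> space unit_interval. snd (T v) \<le> q}"
  have "{..(p, q)} = {..p} \<times> {..q}" by auto
  then have "{..(p, q)} \<in> sets (borel :: (real \<times> real) measure)" unfolding borel_prod[symmetric] by simp
  then have "measure (distr unit_interval borel T) {..(p, q)} = measure unit_interval (?A \<inter> ?B)"
    by (subst measure_distr) (auto intro!: arg_cong2[where f = measure] simp: less_eq_prod_def)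
  also have "\<dots> = min (measure unit_interval ?A) (measure unit_interval ?B)"
  proof (rule measure_Int_nested)
    show "?A \<subseteq> ?B \<or> ?B \<subseteq> ?A"
    proof (rule ccontr)
      assume "\<not> (?A \<subseteq> ?B \<or> ?B \<subseteq> ?A)"
      then obtain u v where u: "u \<in> ?A" "u \<notin> ?B" and v: "v \<in> ?B" "v \<notin> ?A" by blast
      then have uv: "u \<in> {0<..<1}" "v \<in> {0<..<1}" by (auto simp: space_restrict_space)
      show False
        using T_mono[OF uv] T_mono[OF uv(2,1)] u v by (cases "u \<le> v") auto
    qed
  qed (use fst_T_events snd_T_events in auto)
  finally show ?thesis .
qed

text \<open>The first coordinate of \<open>T\<close> takes values in \<open>F\<close> and moves
  nothing across a point \<open>q\<close> of \<open>F\<close>: what lies left of \<open>q\<close>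
  stays at most \<open>q\<close>, what lies right stays at least \<open>q\<close>. Hence every point
  of \<open>F\<close> satisfies the two inequalities.\<close>

lemma quasi_uniform_distr: "quasi_uniform (distr unit_interval borel (\<lambda>u. fst (T u)))"
proof -
  interpret U: prob_space unit_interval by (rule prob_space_unit_interval)
  let ?\<mu> = "distr unit_interval borel (\<lambda>u. fst (T u))"
  note T_measurable(1)[measurable]
  interpret real_distribution ?\<mu>
    by (rule U.real_distribution_distr) measurable
  have meas: "measure ?\<mu> A = measure unit_interval {v \<in> space unit_interval. fst (T v) \<in> A}" if "A \<in> sets borel" for A
    using that by (subst measure_distr) (auto intro!: arg_cong2[where f = measure])
  have sp: "space unit_interval = {0<..<1}" by (simp add: space_restrict_space)
  have TF: "fst (T v) \<in> F" if "v \<in> {0<..<1}" for v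
    using T_ends[OF that] lo_hi[OF that] by auto
  have F1: "measure ?\<mu> F = 1"
  proof -
    have "measure ?\<mu> F = measure unit_interval {v \<in> space unit_interval. fst (T v) \<in> F}"
      by (rule meas) (use closed_F in simp)
    also have "{v \<in> space unit_interval. fst (T v) \<in> F} = space unit_interval" using TF by (auto simp: sp)
    finally show ?thesis unfolding U.prob_space .
  qed
  let ?Q = "{x \<in> {0..1}. measure ?\<mu> {0..<x} \<le> x \<and> x \<le> measure ?\<mu> {0..x}}"
  have "mono (\<lambda>x. measure ?\<mu> {0..<x})" "mono (\<lambda>x. measure ?\<mu> {0..x})"
    by (auto intro!: monoI finite_measure_mono)
  then have [measurable]: "(\<lambda>x. measure ?\<mu> {0..<x}) \<in> borel_measurable borel" "(\<lambda>x. measure ?\<mu> {0..x}) \<in> borel_measurable borel"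
    by (auto intro: borel_measurable_mono)
  have mQ: "?Q \<in> sets borel" by measurable
  have FQ: "F \<subseteq> ?Q"
  proof
    fix q assume qF: "q \<in> F"
    then have q01: "0 \<le> q" "q \<le> 1" using F_sub by auto
    have ql: "q \<le> lo v" if v: "v \<in> {0<..<1}" "q \<le> v" for v
    proof (cases "q = 0 \<or> q = v")
      case False
      then have "q \<in> {0<..<1}" "q < v" using v q01 by auto
      from separated[OF this(1) v(1) this(2)] show ?thesis using qF by (auto simp: hi_def)
    qed (use lo_hi[OF v(1)] qF in \<open>auto simp: lo_def\<close>)
    have hq: "hi v \<le> q" if v: "v \<in> {0<..<1}" "v \<le> q" for v
    proof (cases "q = 1 \<or> q = v")
      case False
      then have "q \<in> {0<..<1}" "v < q" using v q01 by auto
      from separated[OF v(1) this] show ?thesis using qF by (auto simp: lo_def)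
    qed (use lo_hi[OF v(1)] qF in \<open>auto simp: hi_def\<close>)
    have dq: "measure unit_interval {v \<in> space unit_interval. v \<in> {..<q}} = q"
      "measure unit_interval {v \<in> space unit_interval. v \<in> {..q}} = q"
      by (rule measure_unit_interval_downset[OF q01]; (auto simp: sp sets_restrict_space_iff)?)+
    have "measure ?\<mu> {0..<q} \<le> measure unit_interval {v \<in> space unit_interval. v \<in> {..<q}}"
    proof (subst meas, simp, rule U.finite_measure_mono)
      show "{v \<in> space unit_interval. fst (T v) \<in> {0..<q}} \<subseteq> {v \<in> space unit_interval. v \<in> {..<q}}"
      proof safe
        fix v assume v: "v \<in> space unit_interval" "fst (T v) \<in> {0..<q}"
        then have v': "v \<in> {0<..<1}" by (simp add: sp)
        show "v < q"
        proof (rule ccontr)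
          assume "\<not> v < q"
          then have "q \<le> lo v" using ql[OF v'] by simp
          then show False using T_ends[OF v'] lo_hi[OF v'] v(2) by auto
        qed
      qed
    qed (auto simp: sp sets_restrict_space_iff)
    moreover have "measure unit_interval {v \<in> space unit_interval. v \<in> {..q}} \<le> measure ?\<mu> {0..q}"
    proof (subst meas, simp, rule U.finite_measure_mono)
      show "{v \<in> space unit_interval. v \<in> {..q}} \<subseteq> {v \<in> space unit_interval. fst (T v) \<in> {0..q}}"
      proof safe
        fix v assume v: "v \<in> space unit_interval" "v \<le> q"
        then have v': "v \<in> {0<..<1}" by (simp add: sp)
        show "fst (T v) \<in> {0..q}" using T_ends[OF v'] lo_hi[OF v'] hq[OF v' v(2)] by auto
      qed
    qed measurable
    ultimately show "q \<in> ?Q" using dq q01 by auto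
  qed
  have "measure ?\<mu> F \<le> measure ?\<mu> ?Q" by (rule finite_measure_mono[OF FQ]) (use mQ in simp)
  moreover have "measure ?\<mu> F \<le> measure ?\<mu> {0..1}" by (rule finite_measure_mono[OF F_sub]) simp
  ultimately show ?thesis
    unfolding F1 quasi_uniform_def by (intro conjI real_distribution_axioms antisym prob_le_1)
qed

end

section \<open>Empirical distributions\<close>

lemma integral_empirical_measure:
  fixes f :: "real \<Rightarrow> real"
  assumes "f \<in> borel_measurable borel"
  shows "(\<integral>t. f t \<partial>empirical_measure z N) = cesaro (\<lambda>i. f (z (1 + int i))) N"
proof -
  have "(\<integral>t. f t \<partial>empirical_measure z N) = (\<integral>k. f (z k) \<partial>uniform_count_measure {1..int N})"
    unfolding empirical_measure_def by (rule integral_distr) (use assms in \<open>auto simp: uniform_count_measure_def\<close>)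
  also have "\<dots> = (\<Sum>k\<in>{1..int N}. f (z k)) / real (card {1..int N})"
    by (rule integral_uniform_count_measure) simp
  also have "(\<Sum>k\<in>{1..int N}. f (z k)) = (\<Sum>i<N. f (z (1 + int i)))"
    by (rule sum.reindex_bij_witness[where j = "\<lambda>k. nat (k - 1)" and i = "\<lambda>i. 1 + int i"]) auto
  finally show ?thesis by (simp add: cesaro_def)
qed

text \<open>For \<open>N = 0\<close> the empirical measure is null, so the sequence is shifted by
  one wherever every member has to be a probability measure.\<close>

lemma real_distribution_empirical: "real_distribution (empirical_measure z (Suc N))"
proof -
  interpret prob_space "uniform_count_measure {1..int (Suc N)}"
    by (rule prob_space_uniform_count_measure) auto
  show ?thesis unfolding empirical_measure_def
    by (rule real_distribution_distr) (auto simp: uniform_count_measure_def)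
qed

lemma cdf_empirical_measure: "cdf (empirical_measure z N) q = cesaro (\<lambda>i. of_bool (z (1 + int i) \<le> q)) N"
proof -
  have "cdf (empirical_measure z N) q = (\<integral>t. indicator {..q} t \<partial>empirical_measure z N)"
    by (simp add: cdf_def empirical_measure_def)
  also have "\<dots> = cesaro (\<lambda>i. indicator {..q} (z (1 + int i))) N"
    by (rule integral_empirical_measure) simp
  finally show ?thesis by (simp add: indicator_def of_bool_def)
qed

lemma weak_conv_m_Suc_iff: "weak_conv_m (\<lambda>n. A (Suc n)) \<mu> \<longleftrightarrow> weak_conv_m A \<mu>"
  unfolding weak_conv_m_def weak_conv_def by (simp add: filterlim_sequentially_Suc[of "\<lambda>n. cdf (A n) _"])

lemma has_empirical_distribution_Suc:
  "has_empirical_distribution z \<mu> \<longleftrightarrow> real_distribution \<mu> \<and> weak_conv_m (\<lambda>n. empirical_measure z (Suc n)) \<mu>"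
  by (simp add: has_empirical_distribution_def weak_conv_m_Suc_iff)

lemma has_empirical_distribution_unique:
  assumes "has_empirical_distribution z \<mu>" "has_empirical_distribution z \<nu>"
  shows "\<mu> = \<nu>"
proof (rule Levy_uniqueness)
  show "char \<mu> = char \<nu>"
  proof
    fix t
    have "(\<lambda>n. char (empirical_measure z (Suc n)) t) \<longlonglongrightarrow> char \<mu> t" "(\<lambda>n. char (empirical_measure z (Suc n)) t) \<longlonglongrightarrow> char \<nu> t"
      using assms unfolding has_empirical_distribution_Suc by (auto intro!: levy_continuity1 real_distribution_empirical)
    then show "char \<mu> t = char \<nu> t" by (rule LIMSEQ_unique)
  qed
qed (use assms in \<open>auto simp: has_empirical_distribution_def\<close>)

lemma empirical_distribution_eqI:
  "has_empirical_distribution z \<mu> \<Longrightarrow> empirical_distribution z = \<mu>"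
  unfolding empirical_distribution_def using has_empirical_distribution_unique by (auto intro!: the_equality)

lemma has_empirical_distribution_cts_step:
  assumes "has_empirical_distribution z \<mu>" "a < b"
  shows "cesaro (\<lambda>i. cts_step a b (z (1 + int i))) \<longlonglongrightarrow> (\<integral>t. cts_step a b t \<partial>\<mu>)"
proof -
  have c: "continuous_on UNIV (cts_step a b)"
    using cts_step_uniformly_continuous[OF assms(2)] by (rule uniformly_continuous_imp_continuous)
  then have m: "cts_step a b \<in> borel_measurable borel" by (rule borel_measurable_continuous_onI)
  have "(\<lambda>n. \<integral>t. cts_step a b t \<partial>empirical_measure z (Suc n)) \<longlonglongrightarrow> (\<integral>t. cts_step a b t \<partial>\<mu>)"
  proof (rule weak_conv_imp_integral_bdd_continuous_conv[where B = 1])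
    show "isCont (cts_step a b) t" for t using c by (simp add: continuous_on_eq_continuous_at)
    show "norm (cts_step a b t) \<le> 1" for t using assms(2) by (auto simp: cts_step_def)
  qed (use assms(1) in \<open>auto simp: has_empirical_distribution_Suc real_distribution_empirical\<close>)
  then show ?thesis
    unfolding integral_empirical_measure[OF m] by (simp add: filterlim_sequentially_Suc[of "cesaro _"])
qed

lemma cts_step_borel: "a < b \<Longrightarrow> cts_step a b \<in> borel_measurable borel"
  unfolding cts_step_def[abs_def] by measurable

lemma cdf_le_of_above:
  assumes "real_distribution \<nu>" "\<And>y. x < y \<Longrightarrow> c \<le> cdf \<nu> y"
  shows "c \<le> cdf \<nu> x"
proof -
  interpret real_distribution \<nu> by fact
  have "(cdf \<nu> \<longlongrightarrow> cdf \<nu> x) (at_right x)" using cdf_is_right_cont[of x] by (simp add: continuous_within)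
  then show ?thesis
    by (rule tendsto_lowerbound) (use assms(2) in \<open>auto simp: eventually_at_filter\<close>)
qed

lemma cdf_eqI_Rats:
  assumes "real_distribution \<mu>" "real_distribution \<nu>" and eq: "\<And>q. q \<in> \<rat> \<Longrightarrow> cdf \<mu> q = cdf \<nu> q"
  shows "\<mu> = \<nu>"
proof (rule cdf_unique)
  have le: "cdf \<mu> x \<le> cdf \<nu> x" if rd: "real_distribution \<mu>" "real_distribution \<nu>"
    and eq: "\<And>q. q \<in> \<rat> \<Longrightarrow> cdf \<mu> q = cdf \<nu> q" for \<mu> \<nu> x
  proof (rule cdf_le_of_above[OF rd(2)])
    fix y assume "x < y"
    then obtain q where q: "q \<in> \<rat>" "x < q" "q < y" using Rats_dense_in_real by blast
    interpret m: real_distribution \<mu> by fact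
    interpret n: real_distribution \<nu> by fact
    show "cdf \<mu> x \<le> cdf \<nu> y"
      using m.cdf_nondecreasing[of x q] n.cdf_nondecreasing[of q y] eq[OF q(1)] q by simp
  qed
  show "cdf \<mu> = cdf \<nu>"
    by (intro ext antisym le[OF assms(1,2) eq] le[OF assms(2,1) eq[symmetric]])
qed (use assms in auto)

text \<open>The integral of \<open>cts_step a b\<close> lies between the values of the distribution
  function at \<open>a\<close> and at \<open>b\<close>; right continuity closes the remaining
  distance.\<close>

lemma cdf_eqI_cts_step:
  assumes "real_distribution \<mu>" "real_distribution \<nu>"
    and eq: "\<And>a b. a \<in> \<rat> \<Longrightarrow> b \<in> \<rat> \<Longrightarrow> a < b \<Longrightarrow> (\<integral>t. cts_step a b t \<partial>\<mu>) = (\<integral>t. cts_step a b t \<partial>\<nu>)"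
  shows "\<mu> = \<nu>"
proof (rule cdf_unique)
  have le: "cdf \<mu> x \<le> cdf \<nu> x" if "real_distribution \<mu>" "real_distribution \<nu>"
    and eq: "\<And>a b. a \<in> \<rat> \<Longrightarrow> b \<in> \<rat> \<Longrightarrow> a < b \<Longrightarrow> (\<integral>t. cts_step a b t \<partial>\<mu>) = (\<integral>t. cts_step a b t \<partial>\<nu>)" for \<mu> \<nu> x
  proof -
    interpret m: real_distribution \<mu> by fact
    interpret n: real_distribution \<nu> by fact
    show ?thesis
    proof (rule cdf_le_of_above[OF that(2)])
      fix y assume xy: "x < y"
      obtain a where a: "a \<in> \<rat>" "x < a" "a < y" using Rats_dense_in_real[OF xy] by auto
      obtain b where b: "b \<in> \<rat>" "a < b" "b < y" using Rats_dense_in_real[OF a(3)] by auto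
      have "cdf \<mu> x \<le> cdf \<mu> a" using a by (intro m.cdf_nondecreasing) simp
      also have "\<dots> \<le> (\<integral>t. cts_step a b t \<partial>\<mu>)" by (rule m.cdf_cts_step(1)[OF b(2)])
      also have "\<dots> = (\<integral>t. cts_step a b t \<partial>\<nu>)" by (rule eq[OF a(1) b(1,2)])
      also have "\<dots> \<le> cdf \<nu> b" by (rule n.cdf_cts_step(2)[OF b(2)])
      also have "\<dots> \<le> cdf \<nu> y" using b by (intro n.cdf_nondecreasing) simp
      finally show "cdf \<mu> x \<le> cdf \<nu> y" .
    qed
  qed
  show "cdf \<mu> = cdf \<nu>"
    by (intro ext antisym le[OF assms(1,2) eq] le[OF assms(2,1) eq[symmetric]])
qed (use assms in auto)

text \<open>Boundedness gives tightness, and the limits for rational steps identify all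
  subsequential limits. As the criterion involves countably many test functions, the existence of an
  empirical distribution becomes a measurable event.\<close>

lemma ex_empirical_distribution:
  assumes b: "\<And>k. \<bar>z k\<bar> \<le> B"
    and conv: "\<And>a b. a \<in> \<rat> \<Longrightarrow> b \<in> \<rat> \<Longrightarrow> a < b \<Longrightarrow> convergent (cesaro (\<lambda>i. cts_step a b (z (1 + int i))))"
  shows "\<exists>\<mu>. has_empirical_distribution z \<mu>"
proof -
  let ?\<mu> = "\<lambda>n. empirical_measure z (Suc n)"
  have B: "0 \<le> B" using b[of 0] by linarith
  have tight: "tight ?\<mu>"
    unfolding tight_def
  proof (intro conjI allI impI)
    fix \<epsilon> :: real assume "0 < \<epsilon>"
    \<comment> \<open>The interval is open on the left, so \<open>- B - 1\<close> in place of
      \<open>- B\<close> keeps the value \<open>- B\<close> inside.\<close>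
    have "measure (?\<mu> n) {- B - 1<..B} = 1" for n
    proof -
      have "measure (?\<mu> n) {- B - 1<..B} = (\<integral>t. indicator {- B - 1<..B} t \<partial>?\<mu> n)"
        by (simp add: empirical_measure_def)
      also have "\<dots> = cesaro (\<lambda>i. indicator {- B - 1<..B} (z (1 + int i))) (Suc n)"
        by (rule integral_empirical_measure) simp
      also have "(\<lambda>i. indicator {- B - 1<..B} (z (1 + int i))) = (\<lambda>i. 1 :: real)"
        using b by (auto simp: indicator_def fun_eq_iff abs_le_iff) (smt (verit))
      finally show ?thesis by (simp add: cesaro_def)
    qed
    then show "\<exists>a b. a < b \<and> (\<forall>n. 1 - \<epsilon> < measure (?\<mu> n) {a<..b})"
      using \<open>0 < \<epsilon>\<close> B by (intro exI[of _ "- B - 1"] exI[of _ B]) auto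
  qed (rule real_distribution_empirical)
  obtain r \<mu> where r: "strict_mono (r :: nat \<Rightarrow> nat)" "real_distribution \<mu>" "weak_conv_m (?\<mu> \<circ> id \<circ> r) \<mu>"
    using tight_imp_convergent_subsubsequence[OF tight strict_mono_id] by blast
  have lim: "(\<integral>t. cts_step a b t \<partial>\<nu>) = lim (cesaro (\<lambda>i. cts_step a b (z (1 + int i))))"
    if s: "strict_mono s" "real_distribution \<nu>" "weak_conv_m (?\<mu> \<circ> s) \<nu>" and ab: "a \<in> \<rat>" "b \<in> \<rat>" "a < b" for s \<nu> a b
  proof -
    have c: "continuous_on UNIV (cts_step a b)"
      using cts_step_uniformly_continuous[OF ab(3)] by (rule uniformly_continuous_imp_continuous)
    have "(\<lambda>n. \<integral>t. cts_step a b t \<partial>(?\<mu> \<circ> s) n) \<longlonglongrightarrow> (\<integral>t. cts_step a b t \<partial>\<nu>)"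
    proof (rule weak_conv_imp_integral_bdd_continuous_conv[where B = 1])
      show "isCont (cts_step a b) t" for t using c by (simp add: continuous_on_eq_continuous_at)
      show "norm (cts_step a b t) \<le> 1" for t using ab(3) by (auto simp: cts_step_def)
      show "weak_conv_m (?\<mu> \<circ> s) \<nu>" by (rule s(3))
    qed (use s(2) in \<open>simp_all add: real_distribution_empirical\<close>)
    then have 1: "(\<lambda>n. cesaro (\<lambda>i. cts_step a b (z (1 + int i))) (Suc (s n))) \<longlonglongrightarrow> (\<integral>t. cts_step a b t \<partial>\<nu>)"
      by (simp add: integral_empirical_measure[OF cts_step_borel[OF ab(3)]])
    have "strict_mono (\<lambda>n. Suc (s n))" using s(1) by (simp add: strict_mono_def)
    then have "(\<lambda>n. cesaro (\<lambda>i. cts_step a b (z (1 + int i))) (Suc (s n))) \<longlonglongrightarrow> lim (cesaro (\<lambda>i. cts_step a b (z (1 + int i))))"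
      using LIMSEQ_subseq_LIMSEQ[OF convergent_LIMSEQ_iff[THEN iffD1, OF conv[OF ab]]] by (simp add: o_def)
    with 1 show ?thesis by (rule LIMSEQ_unique)
  qed
  have "weak_conv_m ?\<mu> \<mu>"
  proof (rule tight_subseq_weak_converge[OF real_distribution_empirical r(2) tight])
    fix s \<nu> assume s: "strict_mono s" "real_distribution \<nu>" "weak_conv_m (?\<mu> \<circ> s) \<nu>"
    have "\<nu> = \<mu>"
    proof (rule cdf_eqI_cts_step[OF s(2) r(2)])
      fix a b :: real assume ab: "a \<in> \<rat>" "b \<in> \<rat>" "a < b"
      show "(\<integral>t. cts_step a b t \<partial>\<nu>) = (\<integral>t. cts_step a b t \<partial>\<mu>)"
        using lim[OF s ab] lim[OF r(1,2) _ ab] r(3) by (simp add: o_def)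
    qed
    then show "weak_conv_m (?\<mu> \<circ> s) \<mu>" using s(3) by simp
  qed
  then show ?thesis using r(2) by (auto simp: has_empirical_distribution_Suc)
qed

lemma weak_conv_m_of_dense:
  assumes "real_distribution \<mu>" and mono: "\<And>n. mono (cdf (A n))"
    and conv: "\<And>q. q \<in> \<rat> \<Longrightarrow> (\<lambda>n. cdf (A n) q) \<longlonglongrightarrow> cdf \<mu> q"
  shows "weak_conv_m A \<mu>"
  unfolding weak_conv_m_def weak_conv_def
proof (intro allI impI)
  interpret real_distribution \<mu> by fact
  fix x assume cont: "isCont (cdf \<mu>) x"
  show "(\<lambda>n. cdf (A n) x) \<longlonglongrightarrow> cdf \<mu> x"
  proof (rule tendstoI)
    fix e :: real assume e: "0 < e"
    then have "\<exists>d>0. \<forall>y. dist y x < d \<longrightarrow> dist (cdf \<mu> y) (cdf \<mu> x) < e / 2"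
      using cont unfolding continuous_at_eps_delta by (meson half_gt_zero)
    then obtain d where d: "d > 0" "\<And>y. dist y x < d \<Longrightarrow> dist (cdf \<mu> y) (cdf \<mu> x) < e / 2" by auto
    obtain p where p: "p \<in> \<rat>" "x - d < p" "p < x" using Rats_dense_in_real[of "x - d" x] d by auto
    obtain q where q: "q \<in> \<rat>" "x < q" "q < x + d" using Rats_dense_in_real[of x "x + d"] d by auto
    have pe: "dist (cdf \<mu> p) (cdf \<mu> x) < e / 2" "dist (cdf \<mu> q) (cdf \<mu> x) < e / 2"
      using d(2)[of p] d(2)[of q] p q by (simp_all add: dist_real_def)
    have "eventually (\<lambda>n. dist (cdf (A n) p) (cdf \<mu> p) < e / 2) sequentially"
      "eventually (\<lambda>n. dist (cdf (A n) q) (cdf \<mu> q) < e / 2) sequentially"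
      using e tendstoD[OF conv[OF p(1)], of "e / 2"] tendstoD[OF conv[OF q(1)], of "e / 2"] by simp_all
    then show "eventually (\<lambda>n. dist (cdf (A n) x) (cdf \<mu> x) < e) sequentially"
    proof eventually_elim
      case (elim n)
      have "cdf (A n) p \<le> cdf (A n) x" "cdf (A n) x \<le> cdf (A n) q" 
        using monoD[OF mono[of n], of p x] monoD[OF mono[of n], of x q] p q by simp_all
      then show ?case using elim pe unfolding dist_real_def abs_less_iff by linarith
    qed
  qed
qed

section \<open>The conjugate law as a kernel\<close>

lemma measure_pair_eqI_atMost:
  fixes N1 N2 :: "(real \<times> real) measure"
  assumes s: "sets N1 = sets borel" "sets N2 = sets borel"
    and eq: "\<And>p q. emeasure N1 {..(p, q)} = emeasure N2 {..(p, q)}"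
    and fin: "finite_measure N1"
  shows "N1 = N2"
proof (rule measure_eqI_generator_eq[where A = "\<lambda>n. {..(real n, real n)}" and E = "range atMost" and \<Omega> = UNIV])
  show "Int_stable (range atMost :: (real \<times> real) set set)" by (rule Int_stable_range_atMost)
  show "sets N1 = sigma_sets UNIV (range atMost)" "sets N2 = sigma_sets UNIV (range atMost)"
    unfolding s by (subst borel_eq_atMost, simp)+
  show "(\<Union>i. {..(real i, real i)}) = UNIV"
  proof (intro set_eqI iffI UNIV_I)
    fix z :: "real \<times> real"
    obtain n where "max (fst z) (snd z) \<le> real n" using real_arch_simple by blast
    then show "z \<in> (\<Union>i. {..(real i, real i)})" by (auto simp: less_eq_prod_def intro!: exI[of _ n])
  qed
  show "emeasure N1 {..(real i, real i)} \<noteq> \<infinity>" for i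
    using finite_measure.emeasure_finite[OF fin] by simp
  fix X :: "(real \<times> real) set" assume "X \<in> range atMost"
  then obtain p q where "X = {..(p, q)}" by auto
  then show "emeasure N1 X = emeasure N2 X" using eq by simp
qed auto

definition quantile :: "real measure \<Rightarrow> real \<Rightarrow> real" where
  "quantile \<mu> u = Inf {z. u \<le> cdf \<mu> z}"

text \<open>Comonotone like \<open>T\<close>: the quantile reproduces \<open>\<mu>\<close>, and
  \<open>cdf \<mu> u\<close> stands for the opposite end. The formula makes sense for every
  distribution on the line, so it defines a kernel without reference to \<open>F\<close>.\<close>

definition conjugate_kernel :: "real measure \<Rightarrow> (real \<times> real) measure" where
  "conjugate_kernel \<mu> = distr unit_interval borel (\<lambda>u. (quantile \<mu> u, cdf \<mu> u))"

definition conjugate_cdf :: "real measure \<Rightarrow> real \<Rightarrow> real" where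
  "conjugate_cdf \<mu> q = measure unit_interval {u \<in> space unit_interval. cdf \<mu> u \<le> q}"

lemma quantile_measurable:
  assumes "real_distribution \<mu>"
  shows "quantile \<mu> \<in> borel_measurable unit_interval" "cdf \<mu> \<in> borel_measurable unit_interval"
proof -
  interpret cdf_distribution \<mu> unfolding cdf_distribution_def by fact
  have s: "sets unit_interval = sets (restrict_space borel {0<..<1})" by (rule sets_restrict_space_cong) simp
  show "quantile \<mu> \<in> borel_measurable unit_interval"
    unfolding quantile_def measurable_cong_sets[OF s refl] by (rule measurable_CI)
  show "cdf \<mu> \<in> borel_measurable unit_interval"
    using measurable_C by (intro borel_measurable_unit_interval)
qed

lemma quantile_le_iff:
  assumes "real_distribution \<mu>" "0 < u" "u < 1"
  shows "quantile \<mu> u \<le> p \<longleftrightarrow> u \<le> cdf \<mu> p"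
proof -
  interpret cdf_distribution \<mu> unfolding cdf_distribution_def by fact
  show ?thesis unfolding quantile_def by (rule pseudoinverse[OF assms(2,3), symmetric])
qed

lemma prob_space_conjugate_kernel: "real_distribution \<mu> \<Longrightarrow> prob_space (conjugate_kernel \<mu>)"
  unfolding conjugate_kernel_def
  by (rule prob_space.prob_space_distr[OF prob_space_unit_interval borel_measurable_Pair[OF quantile_measurable]])

text \<open>Both coordinates are nondecreasing in \<open>u\<close>, so the two events are nested
  initial segments. The first has length \<open>cdf \<mu> p\<close> because \<open>quantile\<close>
  and \<open>cdf\<close> form a Galois connection.\<close>

lemma conjugate_kernel_atMost:
  assumes "real_distribution \<mu>"
  shows "measure (conjugate_kernel \<mu>) {..(p, q)} = min (cdf \<mu> p) (conjugate_cdf \<mu> q)"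
proof -
  interpret \<mu>: real_distribution \<mu> by fact
  interpret prob_space unit_interval by (rule prob_space_unit_interval)
  have sp: "space unit_interval = {0<..<1}" by (simp add: space_restrict_space)
  note [measurable] = quantile_measurable[OF assms]
  let ?A = "{u \<in> space unit_interval. quantile \<mu> u \<le> p}" and ?B = "{u \<in> space unit_interval. cdf \<mu> u \<le> q}"
  have ev: "?A \<in> sets unit_interval" "?B \<in> sets unit_interval" by measurable
  have "{..(p, q)} = {..p} \<times> {..q}" by auto
  then have m: "{..(p, q)} \<in> sets (borel :: (real \<times> real) measure)" unfolding borel_prod[symmetric] by simp
  have "(\<lambda>u. (quantile \<mu> u, cdf \<mu> u)) \<in> borel_measurable unit_interval" by (rule borel_measurable_Pair[OF quantile_measurable[OF assms]])
  then have "measure (conjugate_kernel \<mu>) {..(p, q)} = measure unit_interval (?A \<inter> ?B)"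
    unfolding conjugate_kernel_def using m
    by (subst measure_distr) (auto intro!: arg_cong2[where f = measure] simp: less_eq_prod_def)
  also have "\<dots> = min (measure unit_interval ?A) (measure unit_interval ?B)"
  proof (rule measure_Int_nested[OF _ ev])
    have "u \<in> ?A" if "v \<in> ?A" "u \<in> space unit_interval" "u \<le> v" for u v
      using that quantile_le_iff[OF assms, of u p] quantile_le_iff[OF assms, of v p] by (auto simp: sp)
    moreover have "u \<in> ?B" if "v \<in> ?B" "u \<in> space unit_interval" "u \<le> v" for u v
      using that \<mu>.cdf_nondecreasing[of u v] by auto
    ultimately show "?A \<subseteq> ?B \<or> ?B \<subseteq> ?A"
      by (smt (verit, ccfv_threshold) mem_Collect_eq subsetI)
  qed
  also have "measure unit_interval ?A = cdf \<mu> p"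
  proof -
    have "?A = {u \<in> space unit_interval. u \<in> {u. u \<le> cdf \<mu> p}}" using quantile_le_iff[OF assms] by (auto simp: sp)
    moreover have "measure unit_interval {u \<in> space unit_interval. u \<in> {u. u \<le> cdf \<mu> p}} = cdf \<mu> p"
      by (rule measure_unit_interval_downset)
        (auto simp: \<mu>.cdf_nonneg \<mu>.cdf_bounded_prob sp sets_restrict_space_iff)
    ultimately show ?thesis by simp
  qed
  finally show ?thesis by (simp add: conjugate_cdf_def)
qed

context gap_choice
begin

lemma snd_T_frequency:
  "measure unit_interval {v \<in> space unit_interval. snd (T v) \<le> q} = conjugate_cdf (distr unit_interval borel (\<lambda>u. fst (T u))) q"
  unfolding conjugate_cdf_def
proof (rule measure_eq_AE)
  let ?\<mu> = "distr unit_interval borel (\<lambda>u. fst (T u))"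
  interpret U: prob_space unit_interval by (rule prob_space_unit_interval)
  have "real_distribution ?\<mu>" by (rule U.real_distribution_distr[OF T_measurable(1)])
  note [measurable] = quantile_measurable(2)[OF this]
  show "AE u in unit_interval. u \<in> {v \<in> space unit_interval. snd (T v) \<le> q} \<longleftrightarrow> u \<in> {u \<in> space unit_interval. cdf ?\<mu> u \<le> q}"
    using snd_T_eq_cdf by eventually_elim (simp only: mem_Collect_eq)
  show "{u \<in> space unit_interval. cdf ?\<mu> u \<le> q} \<in> sets unit_interval" by measurable
qed (rule snd_T_events)

text \<open>Both sides couple their coordinates monotonically, so the joint distribution functions
  are minima of the marginal ones; the second marginals agree by
  \<open>snd_T_frequency\<close>.\<close>

lemma pair_law_eq_kernel: "pair_law F x = conjugate_kernel (distr unit_interval borel (\<lambda>u. fst (T u)))"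
proof -
  let ?\<mu> = "distr unit_interval borel (\<lambda>u. fst (T u))"
  interpret U: prob_space unit_interval by (rule prob_space_unit_interval)
  have rd: "real_distribution ?\<mu>" by (rule U.real_distribution_distr[OF T_measurable(1)])
  interpret N: prob_space "pair_law F x"
    unfolding pair_law_eq by (rule U.prob_space_distr) measurable
  interpret K: prob_space "conjugate_kernel ?\<mu>" by (rule prob_space_conjugate_kernel[OF rd])
  have cdf: "cdf ?\<mu> p = measure unit_interval {v \<in> space unit_interval. fst (T v) \<le> p}" for p
    unfolding cdf_def using T_measurable(1) by (subst measure_distr) (auto intro!: arg_cong2[where f = measure])
  show ?thesis
  proof (rule measure_pair_eqI_atMost)
    fix p q
    have "measure (pair_law F x) {..(p, q)} = min (cdf ?\<mu> p) (conjugate_cdf ?\<mu> q)"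
      unfolding pair_law_eq T_cdf_min snd_T_frequency cdf by (rule refl)
    then show "emeasure (pair_law F x) {..(p, q)} = emeasure (conjugate_kernel ?\<mu>) {..(p, q)}"
      unfolding N.emeasure_eq_measure K.emeasure_eq_measure conjugate_kernel_atMost[OF rd] by (rule arg_cong)
  qed (unfold_locales, auto simp: pair_law_eq conjugate_kernel_def)
qed

end

lemma decomposition_gap_choice: "decomposition \<mu> F x \<Longrightarrow> gap_choice F x"
  by unfold_locales (auto simp: decomposition_def)

text \<open>Every decomposition of \<open>\<mu>\<close> has the pair law
  \<open>conjugate_kernel \<mu>\<close>, so the result of the choice is determined without comparing
  different \<open>F\<close> and \<open>x\<close>.\<close>

lemma conjugate_law_eq_kernel:
  assumes "decomposition \<mu> F x"
  shows "conjugate_law \<mu> = conjugate_kernel \<mu>"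
proof -
  have *: "pair_law F x = conjugate_kernel \<mu>" if d: "decomposition \<mu> F x" for F x
  proof -
    interpret gap_choice F x by (rule decomposition_gap_choice[OF d])
    have eq: "\<mu> = distr unit_interval borel (\<lambda>u. fst (T u))" by (rule decomposition_iff[THEN iffD1, OF d])
    show ?thesis unfolding eq by (rule pair_law_eq_kernel)
  qed
  have "\<exists>F x. decomposition \<mu> F x \<and> conjugate_law \<mu> = pair_law F x"
    unfolding conjugate_law_def by (rule someI[of "\<lambda>N. \<exists>F x. decomposition \<mu> F x \<and> N = pair_law F x" "pair_law F x"]) (use assms in blast)
  then show ?thesis using * by auto
qed

lemma space_prob_algebra_borel: "\<mu> \<in> space (prob_algebra borel) \<longleftrightarrow> real_distribution \<mu>"
  by (auto simp: space_prob_algebra real_distribution_def real_distribution_axioms_def)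

lemma conjugate_cdf_measurable: "(\<lambda>\<mu>. conjugate_cdf \<mu> q) \<in> borel_measurable (prob_algebra borel)"
proof -
  interpret U: prob_space unit_interval by (rule prob_space_unit_interval)
  let ?M = "prob_algebra (borel :: real measure) \<Otimes>\<^sub>M unit_interval"
  have idb[measurable]: "(\<lambda>u. u) \<in> borel_measurable unit_interval" by (rule borel_measurable_unit_interval) simp
  \<comment> \<open>Joint measurability in the measure and the point, so that integrating over the
    point leaves a measurable function of the measure.\<close>
  have c[measurable]: "(\<lambda>p. cdf (fst p) (snd p)) \<in> borel_measurable ?M"
    unfolding cdf_def
  proof (rule measure_measurable_prob_algebra2)
    have "{w \<in> space (?M \<Otimes>\<^sub>M borel). snd w \<le> snd (fst w)} \<in> sets (?M \<Otimes>\<^sub>M (borel :: real measure))"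
    proof (rule borel_measurable_le)
      have "(\<lambda>w. snd (fst w)) \<in> ?M \<Otimes>\<^sub>M (borel :: real measure) \<rightarrow>\<^sub>M unit_interval"
        by (rule measurable_compose[OF measurable_fst measurable_snd])
      from measurable_compose[OF this idb]
      show "(\<lambda>w. snd (fst w)) \<in> borel_measurable (?M \<Otimes>\<^sub>M (borel :: real measure))" .
    qed (rule measurable_snd)
    moreover have "Sigma (space ?M) (\<lambda>p. {..snd p}) = {w \<in> space (?M \<Otimes>\<^sub>M borel). snd w \<le> snd (fst w)}"
      by (auto simp: space_pair_measure)
    ultimately show "Sigma (space ?M) (\<lambda>p. {..snd p}) \<in> sets (?M \<Otimes>\<^sub>M (borel :: real measure))" by simp
  qed (rule measurable_fst)
  have "(\<lambda>\<mu>. enn2real (\<integral>\<^sup>+u. indicator {..q} (cdf \<mu> u) \<partial>unit_interval)) \<in> borel_measurable (prob_algebra borel)"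
  proof (intro borel_measurable_enn2real U.borel_measurable_nn_integral)
    have "(\<lambda>p. indicator {..q} (cdf (fst p) (snd p)) :: ennreal) \<in> borel_measurable ?M"
      by (rule measurable_compose[OF c]) simp
    then show "(\<lambda>(\<mu>, u). indicator {..q} (cdf \<mu> u) :: ennreal) \<in> borel_measurable ?M" by (simp add: case_prod_beta')
  qed
  moreover have "enn2real (\<integral>\<^sup>+u. indicator {..q} (cdf \<mu> u) \<partial>unit_interval) = conjugate_cdf \<mu> q"
    if "\<mu> \<in> space (prob_algebra borel)" for \<mu>
  proof -
    have "real_distribution \<mu>" using that by (simp add: space_prob_algebra_borel)
    note [measurable] = quantile_measurable(2)[OF this]
    have "(\<integral>\<^sup>+u. indicator {..q} (cdf \<mu> u) \<partial>unit_interval) = (\<integral>\<^sup>+u. indicator {u \<in> space unit_interval. cdf \<mu> u \<le> q} u \<partial>unit_interval)"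
      by (rule nn_integral_cong) (simp add: indicator_def)
    also have "\<dots> = emeasure unit_interval {u \<in> space unit_interval. cdf \<mu> u \<le> q}"
      by (rule nn_integral_indicator) measurable
    finally show ?thesis by (simp add: conjugate_cdf_def measure_def)
  qed
  ultimately show ?thesis by (subst measurable_cong[where g = "\<lambda>\<mu>. enn2real (\<integral>\<^sup>+u. indicator {..q} (cdf \<mu> u) \<partial>unit_interval)"]) auto
qed

lemma conjugate_kernel_measurable [measurable]:
  "conjugate_kernel \<in> prob_algebra borel \<rightarrow>\<^sub>M prob_algebra borel"
proof (rule measurable_prob_algebra_generated[where \<Omega> = UNIV and G = "range atMost"])
  show "sets (borel :: (real \<times> real) measure) = sigma_sets UNIV (range atMost)" by (subst borel_eq_atMost) simp
  show "Int_stable (range atMost :: (real \<times> real) set set)" by (rule Int_stable_range_atMost)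
  show "prob_space (conjugate_kernel \<mu>)" if "\<mu> \<in> space (prob_algebra borel)" for \<mu>
    using that by (simp add: space_prob_algebra_borel prob_space_conjugate_kernel)
  fix A :: "(real \<times> real) set" assume "A \<in> range atMost"
  then obtain p q where A: "A = {..(p, q)}" by auto
  have "emeasure (conjugate_kernel \<mu>) A = ennreal (min (cdf \<mu> p) (conjugate_cdf \<mu> q))"
    if "\<mu> \<in> space (prob_algebra borel)" for \<mu>
  proof -
    have rd: "real_distribution \<mu>" using that by (simp add: space_prob_algebra_borel)
    interpret prob_space "conjugate_kernel \<mu>" by (rule prob_space_conjugate_kernel[OF rd])
    show ?thesis unfolding A emeasure_eq_measure conjugate_kernel_atMost[OF rd] ..
  qed
  moreover have "(\<lambda>\<mu>. ennreal (min (cdf \<mu> p) (conjugate_cdf \<mu> q))) \<in> borel_measurable (prob_algebra borel)"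
    unfolding cdf_def using conjugate_cdf_measurable[of q] by measurable
  ultimately show "(\<lambda>\<mu>. emeasure (conjugate_kernel \<mu>) A) \<in> borel_measurable (prob_algebra borel)"
    by (subst measurable_cong) auto
qed (auto simp: conjugate_kernel_def)

section \<open>The gaps spanned by the conjugate pairs\<close>

text \<open>One path of the pairs: \<open>a\<close> and \<open>b\<close> stand for the values of
  \<open>X\<close> and \<open>Y\<close>, and everything in this locale is deterministic.\<close>

locale interval_family =
  fixes a b :: "int \<Rightarrow> real"
  assumes ends: "interval_ends a b"
begin

definition J :: "int \<Rightarrow> real set" where "J n = {min (a n) (b n)<..<max (a n) (b n)}"

definition F\<^sub>0 :: "real set" where "F\<^sub>0 = {0..1} - (\<Union>n. J n)"

text \<open>Several \<open>n\<close> may span the same gap; by \<open>J_disjoint\<close> they have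
  the same ends, so the choice does not matter. The condition \<open>a n \<noteq> b n\<close> keeps
  out empty intervals.\<close>

definition x\<^sub>0 :: "real set \<Rightarrow> real" where "x\<^sub>0 G = a (SOME n. a n \<noteq> b n \<and> J n = G)"

lemma range01: "0 \<le> a n" "a n \<le> 1" "0 \<le> b n" "b n \<le> 1"
  using ends by (auto simp: interval_ends_def)

lemma tied_or_separated:
  "(a m = a n \<and> b m = b n) \<or> max (a m) (b m) \<le> min (a n) (b n) \<or> max (a n) (b n) \<le> min (a m) (b m)"
  using ends by (auto simp: interval_ends_def)

lemma J_disjoint: "u \<in> J m \<Longrightarrow> u \<in> J n \<Longrightarrow> a m = a n \<and> b m = b n"
  using tied_or_separated[of m n] by (auto simp: J_def)

lemma J_nonempty: "a n \<noteq> b n \<Longrightarrow> (a n + b n) / 2 \<in> J n"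
  by (auto simp: J_def min_def max_def field_simps)

lemma Inf_J: "a n \<noteq> b n \<Longrightarrow> Inf (J n) = min (a n) (b n)"
  and Sup_J: "a n \<noteq> b n \<Longrightarrow> Sup (J n) = max (a n) (b n)"
  unfolding J_def by (auto intro!: cInf_greaterThanLessThan cSup_greaterThanLessThan simp: min_def max_def)

text \<open>Disjoint nonempty connected open sets whose union is the complement of
  \<open>F\<^sub>0\<close> must be its components.\<close>

lemma gaps_F0: "gaps F\<^sub>0 = J ` {n. a n \<noteq> b n}"
  unfolding gaps_def
proof (rule components_open_unique)
  show "pairwise disjnt (J ` {n. a n \<noteq> b n})"
  proof (rule pairwiseI)
    fix G H assume "G \<in> J ` {n. a n \<noteq> b n}" "H \<in> J ` {n. a n \<noteq> b n}" and ne: "G \<noteq> H"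
    then obtain m n where "G = J m" "H = J n" by blast
    have "\<not> (u \<in> J m \<and> u \<in> J n)" for u
    proof
      assume "u \<in> J m \<and> u \<in> J n"
      then have "a m = a n" "b m = b n" using J_disjoint by blast+
      then have "J m = J n" by (simp only: J_def)
      then show False using ne \<open>G = J m\<close> \<open>H = J n\<close> by simp
    qed
    then show "disjnt G H" using \<open>G = J m\<close> \<open>H = J n\<close> by (auto simp: disjnt_def)
  qed
  show "\<Union> (J ` {n. a n \<noteq> b n}) = {0..1} - F\<^sub>0"
  proof -
    have "J n \<subseteq> {0..1}" for n using range01[of n] by (auto simp: J_def)
    moreover have "J n = {}" if "a n = b n" for n using that by (simp add: J_def)
    ultimately show ?thesis unfolding F\<^sub>0_def by fastforce
  qed
  show "open G \<and> connected G \<and> G \<noteq> {}" if "G \<in> J ` {n. a n \<noteq> b n}" for G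
    using that J_nonempty by (auto simp: J_def)
qed

lemma x0_J: "a n \<noteq> b n \<Longrightarrow> x\<^sub>0 (J n) = a n"
proof -
  assume n: "a n \<noteq> b n"
  define k where "k = (SOME k. a k \<noteq> b k \<and> J k = J n)"
  have k: "a k \<noteq> b k \<and> J k = J n" unfolding k_def by (rule someI[of _ n]) (use n in simp)
  then have "(a n + b n) / 2 \<in> J k" using J_nonempty[OF n] by simp
  then have "a k = a n" using J_disjoint[OF _ J_nonempty[OF n]] by blast
  then show ?thesis by (simp add: x\<^sub>0_def k_def)
qed

lemma other_end_x0_J: "a n \<noteq> b n \<Longrightarrow> other_end x\<^sub>0 (J n) = b n"
  by (simp add: other_end_def x0_J Inf_J Sup_J min_def max_def)

sublocale gap_choice F\<^sub>0 x\<^sub>0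
proof
  have "open (J n)" for n by (simp add: J_def)
  then show "closed F\<^sub>0" unfolding F\<^sub>0_def by (intro closed_Diff closed_atLeastAtMost open_UN) auto
  show "F\<^sub>0 \<subseteq> {0..1}" by (auto simp: F\<^sub>0_def)
  show "0 \<in> F\<^sub>0" "1 \<in> F\<^sub>0" using range01 by (auto simp: F\<^sub>0_def J_def min_def max_def not_less)
  fix G assume "G \<in> gaps F\<^sub>0"
  then obtain n where n: "a n \<noteq> b n" "G = J n" by (auto simp: gaps_F0)
  then show "x\<^sub>0 G = Inf G \<or> x\<^sub>0 G = Sup G" by (auto simp: x0_J Inf_J Sup_J min_def max_def)
qed

end

context gap_choice
begin

text \<open>Reversing the choice at every gap exchanges the two coordinates of \<open>T\<close>, so
  the frequency lemmas for the first coordinate carry over to the second.\<close>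

lemma swap_gap_choice: "gap_choice F (other_end x)"
  using closed_F F_sub F_ends x_end by unfold_locales (auto simp: other_end_def)

lemma snd_T_swap: "gap_choice.T F (other_end x) u = (snd (T u), (if u \<in> F then u else other_end (other_end x) (gap_of u)))"
  unfolding gap_choice.T_def[OF swap_gap_choice] gap_choice.gap_of_def[OF swap_gap_choice]
  by (simp add: T_def gap_of_def)

lemma other_end_other_end: "G \<in> gaps F \<Longrightarrow> other_end (other_end x) G = x G"
  using x_end[of G] gap_interval(2)[of G] by (auto simp: other_end_def)

lemma snd_T_frequency_gap:
  assumes "G \<in> gaps F" "Inf G \<le> q" "q < Sup G"
  shows "measure unit_interval {v \<in> space unit_interval. snd (T v) \<le> q} = x G"
  using gap_choice.fst_T_frequency_gap[OF swap_gap_choice assms] other_end_other_end[OF assms(1)]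
  unfolding snd_T_swap by simp

lemma snd_T_frequency_F:
  assumes "q \<in> F" "\<And>G. G \<in> gaps F \<Longrightarrow> Inf G \<noteq> q"
  shows "measure unit_interval {v \<in> space unit_interval. snd (T v) \<le> q} = q"
  using gap_choice.fst_T_frequency_F[OF swap_gap_choice assms] unfolding snd_T_swap by simp

lemma T_range: "u \<in> {0<..<1} \<Longrightarrow> fst (T u) \<in> {0..1} \<and> snd (T u) \<in> {0..1}"
  using T_ends[of u] lo_hi[of u] by auto

abbreviation "first_law \<equiv> distr unit_interval borel (\<lambda>u. fst (T u))"

lemma cdf_first_law: "cdf first_law q = measure unit_interval {v \<in> space unit_interval. fst (T v) \<le> q}"
  unfolding cdf_def using T_measurable(1) by (subst measure_distr) (auto intro!: arg_cong2[where f = measure])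

lemma cdf_outside:
  "q < 0 \<Longrightarrow> cdf first_law q = 0 \<and> conjugate_cdf first_law q = 0"
  "1 \<le> q \<Longrightarrow> cdf first_law q = 1 \<and> conjugate_cdf first_law q = 1"
proof -
  interpret U: prob_space unit_interval by (rule prob_space_unit_interval)
  have sp: "space unit_interval = {0<..<1}" by (simp add: space_restrict_space)
  show "cdf first_law q = 0 \<and> conjugate_cdf first_law q = 0" if "q < 0"
  proof -
    have "\<not> fst (T v) \<le> q \<and> \<not> snd (T v) \<le> q" if "v \<in> space unit_interval" for v
      using T_range[of v] that \<open>q < 0\<close> by (simp add: sp)
    then have e: "{v \<in> space unit_interval. fst (T v) \<le> q} = {}" "{v \<in> space unit_interval. snd (T v) \<le> q} = {}"
      by blast+
    show ?thesis unfolding cdf_first_law snd_T_frequency[symmetric] e by simp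
  qed
  show "cdf first_law q = 1 \<and> conjugate_cdf first_law q = 1" if "1 \<le> q"
  proof -
    have "fst (T v) \<le> q \<and> snd (T v) \<le> q" if "v \<in> space unit_interval" for v
      using T_range[of v] that \<open>1 \<le> q\<close> by (simp add: sp)
    then have e: "{v \<in> space unit_interval. fst (T v) \<le> q} = space unit_interval"
      "{v \<in> space unit_interval. snd (T v) \<le> q} = space unit_interval" by blast+
    show ?thesis unfolding cdf_first_law snd_T_frequency[symmetric] e U.prob_space by simp
  qed
qed

end

context interval_family
begin

text \<open>The two cases of \<open>frequencies_at\<close> are those of
  \<open>fst_T_frequency_gap\<close> and \<open>fst_T_frequency_F\<close> with their counterparts
  for the second coordinate. The half-open intervals match: a \<open>q\<close> in the unit interval
  outside all of them is a point of \<open>F\<^sub>0\<close> that is no left end.\<close>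

lemma frequencies_cdf:
  assumes f: "0 \<le> q \<Longrightarrow> q \<le> 1 \<Longrightarrow> frequencies_at a b q"
  shows "cesaro (\<lambda>i. of_bool (a (1 + int i) \<le> q)) \<longlonglongrightarrow> cdf first_law q \<and>
    cesaro (\<lambda>i. of_bool (b (1 + int i) \<le> q)) \<longlonglongrightarrow> conjugate_cdf first_law q"
proof -
  consider "q < 0" | "1 < q" | "0 \<le> q" "q \<le> 1" by linarith
  then show ?thesis
  proof cases
    case 1
    then have "\<not> a n \<le> q" "\<not> b n \<le> q" for n using range01[of n] by auto
    then show ?thesis using cesaro_const[of 0] cdf_outside(1)[OF 1] by simp
  next
    case 2
    then have "a n \<le> q" "b n \<le> q" for n using range01[of n] by auto
    then show ?thesis using cesaro_const[of 1] cdf_outside(2)[of q] 2 by simp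
  next
    case 3
    obtain A B where AB: "cesaro (\<lambda>i. of_bool (a (1 + int i) \<le> q)) \<longlonglongrightarrow> A" "cesaro (\<lambda>i. of_bool (b (1 + int i) \<le> q)) \<longlonglongrightarrow> B"
      and c: "(\<exists>n. min (a n) (b n) \<le> q \<and> q < max (a n) (b n) \<and> A = b n \<and> B = a n) \<or>
         ((\<forall>n. \<not> (min (a n) (b n) \<le> q \<and> q < max (a n) (b n))) \<and> A = q \<and> B = q)"
      using f[OF 3] by (auto simp: frequencies_at_def)
    from c have "A = cdf first_law q \<and> B = conjugate_cdf first_law q"
      unfolding cdf_first_law snd_T_frequency[symmetric]
    proof
      assume "\<exists>n. min (a n) (b n) \<le> q \<and> q < max (a n) (b n) \<and> A = b n \<and> B = a n"
      then obtain n where n: "min (a n) (b n) \<le> q" "q < max (a n) (b n)" "A = b n" "B = a n" by auto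
      then have ne: "a n \<noteq> b n" by auto
      then have G: "J n \<in> gaps F\<^sub>0" "Inf (J n) \<le> q" "q < Sup (J n)" using n by (auto simp: gaps_F0 Inf_J Sup_J)
      show "A = measure unit_interval {v \<in> space unit_interval. fst (T v) \<le> q} \<and>
          B = measure unit_interval {v \<in> space unit_interval. snd (T v) \<le> q}"
        unfolding fst_T_frequency_gap[OF G] snd_T_frequency_gap[OF G] x0_J[OF ne] other_end_x0_J[OF ne]
        using n by simp
    next
      assume "(\<forall>n. \<not> (min (a n) (b n) \<le> q \<and> q < max (a n) (b n))) \<and> A = q \<and> B = q"
      then have n: "\<And>n. \<not> (min (a n) (b n) \<le> q \<and> q < max (a n) (b n))" "A = q" "B = q" by auto
      have "q \<in> F\<^sub>0" using n(1) 3 by (auto simp: F\<^sub>0_def J_def)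
      moreover have "Inf G \<noteq> q" if "G \<in> gaps F\<^sub>0" for G
      proof -
        from that obtain m where "a m \<noteq> b m" "G = J m" by (auto simp: gaps_F0)
        then show ?thesis using n(1)[of m] by (auto simp: Inf_J)
      qed
      ultimately show "A = measure unit_interval {v \<in> space unit_interval. fst (T v) \<le> q} \<and>
          B = measure unit_interval {v \<in> space unit_interval. snd (T v) \<le> q}"
        using fst_T_frequency_F snd_T_frequency_F n by simp
    qed
    then show ?thesis using AB by simp
  qed
qed

lemma has_empirical_distribution_first_law:
  assumes f: "\<And>q. q \<in> \<rat> \<Longrightarrow> 0 \<le> q \<Longrightarrow> q \<le> 1 \<Longrightarrow> frequencies_at a b q"
  shows "has_empirical_distribution a first_law"
proof -
  interpret U: prob_space unit_interval by (rule prob_space_unit_interval)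
  have rd: "real_distribution first_law" by (rule U.real_distribution_distr[OF T_measurable(1)])
  have "weak_conv_m (empirical_measure a) first_law"
  proof (rule weak_conv_m_of_dense[OF rd])
    show "mono (cdf (empirical_measure a n))" for n
      unfolding cdf_empirical_measure by (intro monoI cesaro_mono) (auto simp: of_bool_def)
    fix q :: real assume "q \<in> \<rat>"
    then have "cesaro (\<lambda>i. of_bool (a (1 + int i) \<le> q)) \<longlonglongrightarrow> cdf first_law q"
      using frequencies_cdf f by blast
    then show "(\<lambda>n. cdf (empirical_measure a n) q) \<longlonglongrightarrow> cdf first_law q"
      unfolding cdf_empirical_measure .
  qed
  then show ?thesis using rd by (simp add: has_empirical_distribution_def)
qed

text \<open>On a chain of pairs the conditions \<open>a n \<le> p\<close> and
  \<open>b n \<le> q\<close> are nested, just as for \<open>T\<close>, so the rarer one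
  decides.\<close>

lemma joint_frequency:
  assumes A: "cesaro (\<lambda>i. of_bool (a (1 + int i) \<le> p)) \<longlonglongrightarrow> A" and B: "cesaro (\<lambda>i. of_bool (b (1 + int i) \<le> q)) \<longlonglongrightarrow> B"
  shows "cesaro (\<lambda>i. of_bool (a (1 + int i) \<le> p \<and> b (1 + int i) \<le> q)) \<longlonglongrightarrow> min A B"
proof -
  have "(\<forall>n. a n \<le> p \<longrightarrow> b n \<le> q) \<or> (\<forall>n. b n \<le> q \<longrightarrow> a n \<le> p)"
  proof (rule ccontr)
    assume "\<not> ((\<forall>n. a n \<le> p \<longrightarrow> b n \<le> q) \<or> (\<forall>n. b n \<le> q \<longrightarrow> a n \<le> p))"
    then obtain m n where "a m \<le> p" "\<not> b m \<le> q" "b n \<le> q" "\<not> a n \<le> p" by auto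
    then show False using tied_or_separated[of m n] by auto
  qed
  then show ?thesis
  proof
    assume h: "\<forall>n. a n \<le> p \<longrightarrow> b n \<le> q"
    then have "A \<le> B" by (intro LIMSEQ_le[OF A B]) (auto intro!: exI[of _ 0] cesaro_mono)
    moreover have "(\<lambda>i. of_bool (a (1 + int i) \<le> p \<and> b (1 + int i) \<le> q)) = (\<lambda>i. of_bool (a (1 + int i) \<le> p) :: real)"
      using h by (auto simp: fun_eq_iff)
    ultimately show ?thesis using A by (simp add: min_def)
  next
    assume h: "\<forall>n. b n \<le> q \<longrightarrow> a n \<le> p"
    then have "B \<le> A" by (intro LIMSEQ_le[OF B A]) (auto intro!: exI[of _ 0] cesaro_mono)
    moreover have "(\<lambda>i. of_bool (a (1 + int i) \<le> p \<and> b (1 + int i) \<le> q)) = (\<lambda>i. of_bool (b (1 + int i) \<le> q) :: real)"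
      using h by (auto simp: fun_eq_iff)
    ultimately show ?thesis using B by (simp add: min_def)
  qed
qed

end

section \<open>Measurability of the empirical distribution\<close>

lemma real_distribution_empirical_distribution: "real_distribution (empirical_distribution z)"
proof (cases "\<exists>\<mu>. has_empirical_distribution z \<mu>")
  case True
  then obtain \<mu> where "has_empirical_distribution z \<mu>" by auto
  then show ?thesis using empirical_distribution_eqI[of z \<mu>] by (simp add: has_empirical_distribution_def)
next
  case False
  then have "empirical_distribution z = return borel 0" by (simp add: empirical_distribution_def)
  moreover have "real_distribution (return borel (0::real))"
    by (auto simp: real_distribution_def real_distribution_axioms_def intro: prob_space_return)
  ultimately show ?thesis by simp
qed

text \<open>This exhibits the distribution function as an iterated limit of finite averages, hence
  as a measurable function of the sequence. The steps shrink to the indicator of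
  \<open>{..x}\<close> from the right.\<close>

lemma cdf_eq_lim_cts_step:
  assumes "has_empirical_distribution z \<mu>"
  shows "cdf \<mu> x = lim (\<lambda>k. lim (cesaro (\<lambda>i. cts_step x (x + 1 / real (Suc k)) (z (1 + int i)))))"
proof -
  interpret real_distribution \<mu> using assms by (simp add: has_empirical_distribution_def)
  have lim: "lim (cesaro (\<lambda>i. cts_step x (x + 1 / real (Suc k)) (z (1 + int i)))) = (\<integral>t. cts_step x (x + 1 / real (Suc k)) t \<partial>\<mu>)" for k
    by (rule limI[OF has_empirical_distribution_cts_step[OF assms]]) simp
  have "(\<lambda>k. \<integral>t. cts_step x (x + 1 / real (Suc k)) t \<partial>\<mu>) \<longlonglongrightarrow> cdf \<mu> x"
  proof (rule tendsto_sandwich[OF _ _ tendsto_const])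
    show "\<forall>\<^sub>F k in sequentially. cdf \<mu> x \<le> (\<integral>t. cts_step x (x + 1 / real (Suc k)) t \<partial>\<mu>)"
      by (intro always_eventually allI cdf_cts_step(1)) simp
    show "\<forall>\<^sub>F k in sequentially. (\<integral>t. cts_step x (x + 1 / real (Suc k)) t \<partial>\<mu>) \<le> cdf \<mu> (x + 1 / real (Suc k))"
      by (intro always_eventually allI cdf_cts_step(2)) simp
    have "filterlim (\<lambda>k. x + 1 / real (Suc k)) (at_right x) sequentially"
      unfolding filterlim_at
    proof
      show "\<forall>\<^sub>F k in sequentially. x + 1 / real (Suc k) \<in> {x<..} \<and> x + 1 / real (Suc k) \<noteq> x"
        by (rule always_eventually) simp
      show "(\<lambda>k. x + 1 / real (Suc k)) \<longlonglongrightarrow> x" by real_asymp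
    qed
    moreover have "(cdf \<mu> \<longlongrightarrow> cdf \<mu> x) (at_right x)" using cdf_is_right_cont[of x] by (simp add: continuous_within)
    ultimately show "(\<lambda>k. cdf \<mu> (x + 1 / real (Suc k))) \<longlonglongrightarrow> cdf \<mu> x" by (rule filterlim_compose[rotated])
  qed
  then show ?thesis unfolding lim by (rule limI[symmetric])
qed

text \<open>Countably many Cauchy conditions decide whether an empirical distribution exists; where
  they hold, \<open>cdf_eq_lim_cts_step\<close> computes it on half-lines, elsewhere it is the fixed
  default. The bound is pointwise because \<open>E_iff\<close> is used at every
  \<open>\<omega>\<close>.\<close>

lemma empirical_distribution_measurable:
  fixes Z :: "'a \<Rightarrow> int \<Rightarrow> real"
  assumes [measurable]: "\<And>n. (\<lambda>\<omega>. Z \<omega> n) \<in> borel_measurable N" and b: "\<And>\<omega> n. \<bar>Z \<omega> n\<bar> \<le> B"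
  shows "(\<lambda>\<omega>. empirical_distribution (Z \<omega>)) \<in> N \<rightarrow>\<^sub>M prob_algebra borel"
proof (rule measurable_prob_algebra_generated[where \<Omega> = UNIV and G = "range atMost"])
  define C where "C p q \<omega> = cesaro (\<lambda>i. cts_step p q (Z \<omega> (1 + int i)))" for p q \<omega>
  define E where "E \<omega> \<longleftrightarrow> (\<forall>p\<in>\<rat>. \<forall>q\<in>\<rat>. p < q \<longrightarrow> Cauchy (C p q \<omega>))" for \<omega>
  have mC: "(\<lambda>\<omega>. C p q \<omega> n) \<in> borel_measurable N" if "p < q" for p q n
  proof -
    note [measurable] = cts_step_borel[OF that]
    show ?thesis unfolding C_def cesaro_def by measurable
  qed
  have E_iff: "E \<omega> \<longleftrightarrow> (\<exists>\<mu>. has_empirical_distribution (Z \<omega>) \<mu>)" for \<omega>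
  proof
    assume E: "E \<omega>"
    show "\<exists>\<mu>. has_empirical_distribution (Z \<omega>) \<mu>"
      by (rule ex_empirical_distribution[OF b])
        (use E in \<open>auto simp: E_def C_def Cauchy_convergent_iff\<close>)
  next
    assume "\<exists>\<mu>. has_empirical_distribution (Z \<omega>) \<mu>"
    then show "E \<omega>" unfolding E_def C_def
      using has_empirical_distribution_cts_step LIMSEQ_imp_Cauchy by blast
  qed
  have mE: "{\<omega> \<in> space N. E \<omega>} \<in> sets N"
  proof -
    have "{\<omega> \<in> space N. p < q \<longrightarrow> Cauchy (C p q \<omega>)} \<in> sets N" for p q
      by (cases "p < q") (auto intro!: sets_Collect_Cauchy mC)
    then show ?thesis unfolding E_def
      by (intro sets.sets_Collect_countable_All' countable_rat)
  qed
  show "sets (borel :: real measure) = sigma_sets UNIV (range atMost)" by (subst borel_eq_atMost) simp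
  show "Int_stable (range atMost :: real set set)" by (rule Int_stable_range_atMost)
  fix A :: "real set" assume "A \<in> range atMost"
  then obtain x where A: "A = {..x}" by auto
  define L where "L \<omega> = lim (\<lambda>k. lim (C x (x + 1 / real (Suc k)) \<omega>))" for \<omega>
  have [measurable]: "L \<in> borel_measurable N"
    unfolding L_def by (intro borel_measurable_lim_metric mC) simp
  have "emeasure (empirical_distribution (Z \<omega>)) A = (if E \<omega> then ennreal (L \<omega>) else indicator A 0)" for \<omega>
  proof (cases "E \<omega>")
    case True
    then obtain \<mu> where \<mu>: "has_empirical_distribution (Z \<omega>) \<mu>" using E_iff by auto
    interpret real_distribution \<mu> using \<mu> by (simp add: has_empirical_distribution_def)
    have "cdf \<mu> x = L \<omega>" using cdf_eq_lim_cts_step[OF \<mu>, of x] by (simp add: L_def C_def)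
    then show ?thesis using True by (simp add: empirical_distribution_eqI[OF \<mu>] A emeasure_eq_measure cdf_def)
  next
    case False
    then have "empirical_distribution (Z \<omega>) = return borel 0" unfolding E_iff by (simp add: empirical_distribution_def)
    then show ?thesis using False by (simp add: A)
  qed
  then have "(\<lambda>\<omega>. emeasure (empirical_distribution (Z \<omega>)) A) = (\<lambda>\<omega>. if E \<omega> then ennreal (L \<omega>) else indicator A 0)" by auto
  moreover have "(\<lambda>\<omega>. if E \<omega> then ennreal (L \<omega>) else indicator A 0) \<in> borel_measurable N"
    by (rule measurable_If[OF _ _ mE]) simp_all
  ultimately show "(\<lambda>\<omega>. emeasure (empirical_distribution (Z \<omega>)) A) \<in> borel_measurable N" by simp
next
  fix \<omega>
  show "prob_space (empirical_distribution (Z \<omega>))" "sets (empirical_distribution (Z \<omega>)) = sets borel"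
    using real_distribution_empirical_distribution[of "Z \<omega>"]
    by (auto simp: real_distribution_def real_distribution_axioms_def)
qed simp

text \<open>Where the averages do not converge, \<open>lim\<close> has one and the same value.\<close>

lemma lim_left_average_bounded: "\<bar>lim (left_average r n)\<bar> \<le> 1 + \<bar>THE x :: real. False\<bar>"
proof (cases "convergent (left_average r n)")
  case True
  then have lim: "left_average r n \<longlonglongrightarrow> lim (left_average r n)" by (simp add: convergent_LIMSEQ_iff)
  have up: "(\<lambda>N. 1 + (\<bar>real_of_int n\<bar> + 1) / real N) \<longlonglongrightarrow> 1 + 0" by (intro tendsto_intros lim_const_over_n)
  have "\<bar>lim (left_average r n)\<bar> \<le> 1 + 0"
  proof (rule LIMSEQ_le[OF tendsto_rabs[OF lim] up], intro exI[of _ 1] allI impI)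
    fix N :: nat assume N: "1 \<le> N"
    have "\<bar>\<Sum>k = - int N..n. of_bool ((k, n) \<in> r)\<bar> \<le> (\<Sum>k = - int N..n. 1 :: real)"
      by (rule order_trans[OF sum_abs sum_mono]) auto
    also have "\<dots> = real (nat (n + int N + 1))" by simp
    also have "\<dots> \<le> real N + \<bar>real_of_int n\<bar> + 1" by linarith
    finally show "\<bar>left_average r n N\<bar> \<le> 1 + (\<bar>real_of_int n\<bar> + 1) / real N"
      using N by (simp add: left_average_def abs_divide field_simps)
  qed
  then show ?thesis by simp
next
  case False
  then have "\<not> (left_average r n \<longlonglongrightarrow> L)" for L by (auto simp: convergent_def)
  then have "lim (left_average r n) = (THE x. False)" by (simp add: lim_def)
  then show ?thesis by simp
qed

section \<open>Sequences of independent conjugate pairs\<close>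

abbreviation pair_sequences :: "(int \<Rightarrow> real \<times> real) measure" where
  "pair_sequences \<equiv> \<Pi>\<^sub>M n\<in>UNIV. borel"

definition iid_pairs :: "real measure \<Rightarrow> (int \<Rightarrow> real \<times> real) measure" where
  "iid_pairs \<mu> = (\<Pi>\<^sub>M n\<in>UNIV. conjugate_kernel \<mu>)"

lemma sets_conjugate_kernel [simp]: "sets (conjugate_kernel \<mu>) = sets borel"
  by (simp add: conjugate_kernel_def)

lemma space_conjugate_kernel [simp]: "space (conjugate_kernel \<mu>) = UNIV"
  by (simp add: conjugate_kernel_def)

lemma sets_iid_pairs [simp]: "sets (iid_pairs \<mu>) = sets pair_sequences"
  unfolding iid_pairs_def by (rule sets_PiM_cong) simp_all

lemma prob_space_iid_pairs: "real_distribution \<mu> \<Longrightarrow> prob_space (iid_pairs \<mu>)"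
  unfolding iid_pairs_def by (intro prob_space_PiM prob_space_conjugate_kernel)

lemma emeasure_iid_pairs:
  assumes "real_distribution \<mu>" "finite I"
  shows "emeasure (iid_pairs \<mu>) {z. \<forall>j\<in>I. z j \<le> a j} = (\<Prod>j\<in>I. emeasure (conjugate_kernel \<mu>) {..a j})"
proof -
  have "{z. \<forall>j\<in>I. z j \<le> a j} = prod_emb UNIV (\<lambda>_. conjugate_kernel \<mu>) I (\<Pi>\<^sub>E j\<in>I. {..a j})"
    by (auto simp: prod_emb_def PiE_def extensional_def restrict_def Pi_def)
  then show ?thesis unfolding iid_pairs_def
    using assms by (simp only:) (intro emeasure_PiM_emb prob_space_conjugate_kernel, simp_all)
qed

lemma iid_pairs_measurable: "iid_pairs \<in> prob_algebra borel \<rightarrow>\<^sub>M prob_algebra pair_sequences"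
proof (rule measurable_prob_algebra_generated[where \<Omega> = UNIV and G = lower_cylinders])
  show "sets pair_sequences = sigma_sets UNIV lower_cylinders" by (rule sets_PiM_atMost)
  show "prob_space (iid_pairs \<mu>)" if "\<mu> \<in> space (prob_algebra borel)" for \<mu>
    using that by (intro prob_space_iid_pairs) (simp add: space_prob_algebra_borel)
  fix C :: "(int \<Rightarrow> real \<times> real) set" assume "C \<in> lower_cylinders"
  then obtain I a where I: "finite I" "C = {z. \<forall>j\<in>I. z j \<le> a j}" by (rule lower_cylindersE)
  have "(\<lambda>\<mu>. \<Prod>j\<in>I. emeasure (conjugate_kernel \<mu>) {..a j}) \<in> borel_measurable (prob_algebra borel)"
  proof (rule borel_measurable_prod_ennreal)
    fix j
    have "{..a j} \<in> sets borel" by simp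
    then have "(\<lambda>N. emeasure N {..a j}) \<in> borel_measurable (subprob_algebra borel)"
      by (rule measurable_emeasure_subprob_algebra)
    from measurable_compose[OF measurable_prob_algebraD[OF conjugate_kernel_measurable] this]
    show "(\<lambda>\<mu>. emeasure (conjugate_kernel \<mu>) {..a j}) \<in> borel_measurable (prob_algebra borel)" .
  qed
  moreover have "emeasure (iid_pairs \<mu>) C = (\<Prod>j\<in>I. emeasure (conjugate_kernel \<mu>) {..a j})"
    if "\<mu> \<in> space (prob_algebra borel)" for \<mu>
    unfolding I(2) using that I(1) by (intro emeasure_iid_pairs) (simp_all add: space_prob_algebra_borel)
  ultimately show "(\<lambda>\<mu>. emeasure (iid_pairs \<mu>) C) \<in> borel_measurable (prob_algebra borel)"
    by (subst measurable_cong) auto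
qed (simp_all add: Int_stable_lower_cylinders)

definition order_of :: "(int \<Rightarrow> real \<times> real) \<Rightarrow> int rel" where
  "order_of z = (if strict_linear_order (pairs_rel z) then pairs_rel z else {(m, n). m < n})"

lemma strict_linear_order_less: "strict_linear_order {(m, n). m < (n::int)}"
  by (auto simp: strict_linear_order_on_def trans_def irrefl_def total_on_def)

lemma order_of_measurable: "order_of \<in> pair_sequences \<rightarrow>\<^sub>M order_space"
proof (rule measurable_order_spaceI)
  show "strict_linear_order (order_of z)" for z
    using strict_linear_order_less by (simp add: order_of_def)
  fix m n
  have c: "(\<lambda>z. z k) \<in> pair_sequences \<rightarrow>\<^sub>M borel" for k :: int by (rule measurable_component_singleton) simp
  define f s where "f k z = fst (z k)" and "s k z = snd (z k)" for k :: int and z :: "int \<Rightarrow> real \<times> real"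
  have fs: "f k \<in> borel_measurable pair_sequences" "s k \<in> borel_measurable pair_sequences" for k
    using measurable_compose[OF c[of k], of fst borel] measurable_compose[OF c[of k], of snd borel]
    unfolding f_def s_def by (simp_all add: borel_prod[symmetric])
  have cmp: "Measurable.pred pair_sequences (\<lambda>z. u z < v z)" "Measurable.pred pair_sequences (\<lambda>z. u z = v z)"
    if "u \<in> borel_measurable pair_sequences" "v \<in> borel_measurable pair_sequences" for u v :: "_ \<Rightarrow> real"
    using borel_measurable_less[OF that] borel_measurable_eq[OF that] by (simp_all add: pred_def)
  have [measurable]: "Measurable.pred pair_sequences (\<lambda>z. earlier_below (z m) (z n))" for m n :: int
    unfolding earlier_below_def f_def[symmetric] s_def[symmetric] by (intro pred_intros_logic cmp fs)
  have [measurable]: "Measurable.pred pair_sequences (\<lambda>z. (m, n) \<in> pairs_rel z)" for m n :: int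
    unfolding pairs_rel_def by simp
  have [measurable]: "Measurable.pred pair_sequences (\<lambda>z. strict_linear_order (pairs_rel z))"
    unfolding strict_linear_order_on_def trans_def irrefl_def total_on_def by measurable
  have "(\<lambda>z. (m, n) \<in> order_of z) = (\<lambda>z. if strict_linear_order (pairs_rel z) then (m, n) \<in> pairs_rel z else m < n)"
    by (auto simp: order_of_def)
  then show "Measurable.pred pair_sequences (\<lambda>z. (m, n) \<in> order_of z)" by simp
qed

text \<open>Where a decomposition exists, the law built from \<open>conjugate_law\<close> is
  expressed through \<open>iid_pairs\<close>, which depends measurably on
  \<open>\<mu>\<close>.\<close>

lemma ordering_law_eq:
  assumes "decomposition \<mu> F x" and A: "A \<in> sets order_space"
  shows "measure (ordering_law \<mu>) A = measure (iid_pairs \<mu>) (order_of -` A \<inter> space pair_sequences)"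
proof -
  have "ordering_law \<mu> = distr (iid_pairs \<mu>) order_space order_of"
    unfolding ordering_law_def iid_pairs_def conjugate_law_eq_kernel[OF assms(1)] order_of_def ..
  moreover have "order_of \<in> iid_pairs \<mu> \<rightarrow>\<^sub>M order_space"
    using order_of_measurable by (simp add: measurable_cong_sets[OF sets_iid_pairs refl])
  moreover have "space (iid_pairs \<mu>) = space pair_sequences"
    by (rule sets_eq_imp_space_eq) simp
  ultimately show ?thesis using A by (simp add: measure_distr)
qed

section \<open>The conditional law of the ordering\<close>

context spreadable_order
begin

definition emp :: "int rel \<Rightarrow> real measure" where
  "emp r = empirical_distribution (\<lambda>n. X n r)"

lemma emp_measurable [measurable]: "emp \<in> P \<rightarrow>\<^sub>M prob_algebra borel"
  unfolding emp_def
  by (rule empirical_distribution_measurable[where B = "1 + \<bar>THE x :: real. False\<bar>"])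
    (use lim_left_average_bounded in \<open>auto simp: X_def\<close>, simp add: X_def[symmetric])

lemma real_distribution_emp: "real_distribution (emp r)"
  unfolding emp_def by (rule real_distribution_empirical_distribution)

lemma AE_rational_frequencies:
  "AE r in P. \<forall>q\<in>\<rat>. 0 \<le> q \<longrightarrow> q \<le> 1 \<longrightarrow> frequencies_at (\<lambda>n. X n r) (\<lambda>n. Y n r) q"
proof (subst AE_ball_countable[OF countable_rat], intro ballI)
  fix q :: real
  show "AE r in P. 0 \<le> q \<longrightarrow> q \<le> 1 \<longrightarrow> frequencies_at (\<lambda>n. X n r) (\<lambda>n. Y n r) q"
    using AE_frequencies_at[of q] by (cases "0 \<le> q \<and> q \<le> 1") auto
qed

lemma AE_emp:
  "AE r in P. has_empirical_distribution (\<lambda>n. X n r) (emp r) \<and> quasi_uniform (emp r) \<and>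
     (\<exists>F x. decomposition (emp r) F x)"
  using AE_interval_ends AE_rational_frequencies
proof eventually_elim
  case (elim r)
  interpret interval_family "\<lambda>n. X n r" "\<lambda>n. Y n r" by unfold_locales (rule elim(1))
  have h: "has_empirical_distribution (\<lambda>n. X n r) first_law"
    by (rule has_empirical_distribution_first_law) (use elim(2) in auto)
  have "emp r = first_law" unfolding emp_def by (rule empirical_distribution_eqI[OF h])
  moreover have "decomposition first_law F\<^sub>0 x\<^sub>0" by (rule decomposition_iff[THEN iffD2, OF refl])
  ultimately show ?case using h quasi_uniform_distr by auto
qed

text \<open>The claim includes jumps of the distribution function, where weak convergence alone
  would not give the limit. Hence \<open>frequencies_at\<close> is used at \<open>q\<close> itself,
  besides the rational points that identify \<open>emp r\<close>.\<close>

lemma AE_frequencies_emp: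
  "AE r in P. cesaro (\<lambda>i. of_bool (X (1 + int i) r \<le> q)) \<longlonglongrightarrow> cdf (emp r) q \<and>
     cesaro (\<lambda>i. of_bool (Y (1 + int i) r \<le> q)) \<longlonglongrightarrow> conjugate_cdf (emp r) q"
proof -
  have "AE r in P. 0 \<le> q \<longrightarrow> q \<le> 1 \<longrightarrow> frequencies_at (\<lambda>n. X n r) (\<lambda>n. Y n r) q"
    using AE_frequencies_at[of q] by (cases "0 \<le> q \<and> q \<le> 1") auto
  then show ?thesis using AE_interval_ends AE_rational_frequencies
  proof eventually_elim
    case (elim r)
    interpret interval_family "\<lambda>n. X n r" "\<lambda>n. Y n r" by unfold_locales (rule elim(2))
    have h: "has_empirical_distribution (\<lambda>n. X n r) first_law"
      by (rule has_empirical_distribution_first_law) (use elim(3) in auto)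
    have "emp r = first_law" unfolding emp_def by (rule empirical_distribution_eqI[OF h])
    moreover have "cesaro (\<lambda>i. of_bool (X (1 + int i) r \<le> q)) \<longlonglongrightarrow> cdf first_law q \<and>
       cesaro (\<lambda>i. of_bool (Y (1 + int i) r \<le> q)) \<longlonglongrightarrow> conjugate_cdf first_law q"
      by (rule frequencies_cdf) (use elim(1) in auto)
    ultimately show ?case by (simp only:)
  qed
qed

definition w :: "int \<Rightarrow> int rel \<Rightarrow> real \<times> real" where "w n r = (X n r, Y n r)"

lemma equivariant_w: "equivariant w"
  unfolding w_def by (rule equivariant_comp2[OF equivariant_X equivariant_Y]) (simp add: borel_prod)

text \<open>Both sides are the same minimum, by \<open>joint_frequency\<close> on the path and by
  \<open>conjugate_kernel_atMost\<close> for the kernel. This identifies the directing measure of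
  the exchangeable pairs.\<close>

lemma AE_mean_w: "AE r in P. mean (\<lambda>n r. indicator {..c} (w n r)) r = measure (conjugate_kernel (emp r)) {..c}"
  using AE_interval_ends AE_frequencies_emp[of "fst c"] AE_frequencies_emp[of "snd c"]
proof eventually_elim
  case (elim r)
  interpret interval_family "\<lambda>n. X n r" "\<lambda>n. Y n r" by unfold_locales (rule elim(1))
  have "cesaro (\<lambda>i. of_bool (X (1 + int i) r \<le> fst c \<and> Y (1 + int i) r \<le> snd c)) \<longlonglongrightarrow> min (cdf (emp r) (fst c)) (conjugate_cdf (emp r) (snd c))"
    by (rule joint_frequency) (use elim in auto)
  moreover have "(\<lambda>i. indicator {..c} (w (1 + int i) r)) = (\<lambda>i. of_bool (X (1 + int i) r \<le> fst c \<and> Y (1 + int i) r \<le> snd c) :: real)"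
    by (auto simp: w_def indicator_def less_eq_prod_def)
  ultimately have "mean (\<lambda>n r. indicator {..c} (w n r)) r = min (cdf (emp r) (fst c)) (conjugate_cdf (emp r) (snd c))"
    unfolding mean_def by (simp add: limI)
  then show ?case using conjugate_kernel_atMost[OF real_distribution_emp, of r "fst c" "snd c"] by simp
qed

text \<open>\<open>emp r\<close> is determined by its distribution function at the rationals, and
  each of these values is almost surely the mean of an equivariant family, hence invariant.\<close>

lemma AE_emp_invariant:
  assumes f: "strict_mono f"
  shows "AE r in P. emp (inv_image r f) = emp r"
proof -
  define \<phi> where "\<phi> q n r = (of_bool (X n r \<le> q) :: real)" for q n r
  have m: "AE r in P. mean (\<phi> q) r = cdf (emp r) q" for q
    using AE_frequencies_emp[of q] by eventually_elim (auto simp: mean_def \<phi>_def limI)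
  have "AE r in P. \<forall>q\<in>\<rat>. cdf (emp (inv_image r f)) q = cdf (emp r) q"
  proof (subst AE_ball_countable[OF countable_rat], intro ballI)
    fix q :: real
    have "invariant (mean (\<phi> q))"
      unfolding \<phi>_def by (rule mean_invariant[OF equivariant_of_bool_le[OF equivariant_X]]) simp
    from invariantD(2)[OF this f] AE_transport[OF f m[of q]] m[of q]
    show "AE r in P. cdf (emp (inv_image r f)) q = cdf (emp r) q" by eventually_elim simp
  qed
  then show ?thesis
    by eventually_elim (intro cdf_eqI_Rats real_distribution_emp, simp)
qed

lemma invariant_indicator_emp:
  assumes B: "B \<in> sets (prob_algebra borel)"
  shows "invariant (\<lambda>r. indicator B (emp r) :: real)"
  unfolding invariant_def
proof (intro conjI allI impI)
  show "(\<lambda>r. indicator B (emp r) :: real) \<in> borel_measurable P"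
    by (rule measurable_compose[OF emp_measurable borel_measurable_indicator[OF B]])
  fix f :: "int \<Rightarrow> int" assume "strict_mono f"
  from AE_emp_invariant[OF this]
  show "AE r in P. indicator B (emp (inv_image r f)) = (indicator B (emp r) :: real)" by eventually_elim simp
qed

lemma w_measurable: "(\<lambda>r n. w n r) \<in> P \<rightarrow>\<^sub>M pair_sequences"
  by (rule measurable_PiM_single') (use equivariantD(1)[OF equivariant_w] in auto)

lemma iid_emp_measurable: "(\<lambda>r. iid_pairs (emp r)) \<in> P \<rightarrow>\<^sub>M prob_algebra pair_sequences"
  by (rule measurable_compose[OF emp_measurable iid_pairs_measurable])

lemma measure_iid_emp_measurable:
  "A \<in> sets pair_sequences \<Longrightarrow> (\<lambda>r. measure (iid_pairs (emp r)) A) \<in> borel_measurable P"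
  by (rule measurable_compose[OF iid_emp_measurable measurable_measure_prob_algebra])

lemma measure_iid_emp_le: "measure (iid_pairs (emp r)) A \<le> 1"
  using prob_space.prob_le_1[OF prob_space_iid_pairs[OF real_distribution_emp]] .

text \<open>The indicator of an event of the empirical distribution is an invariant weight
  \<open>G\<close>. \<open>N1\<close> is the weighted law of the pairs and \<open>N2\<close> the
  weighted mixture of product laws; on lower cylinders both are the integral of \<open>G\<close>
  times a product of means, by \<open>expectation_prod\<close> and \<open>AE_mean_w\<close>.\<close>

theorem conditionally_iid_pairs:
  assumes A: "A \<in> sets pair_sequences" and B: "B \<in> sets (prob_algebra borel)"
  shows "expectation (\<lambda>r. indicator A (\<lambda>n. w n r) * indicator B (emp r)) =
    expectation (\<lambda>r. measure (iid_pairs (emp r)) A * indicator B (emp r))"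
proof -
  define G where "G r = (indicator B (emp r) :: real)" for r
  have iG: "invariant G" unfolding G_def by (rule invariant_indicator_emp[OF B])
  have G01: "0 \<le> G r" "G r \<le> 1" for r by (auto simp: G_def)
  note [measurable] = invariantD(1)[OF iG] w_measurable
  let ?D = "density P (\<lambda>r. ennreal (G r))"
  define N1 where "N1 = distr ?D pair_sequences (\<lambda>r n. w n r)"
  define N2 where "N2 = ?D \<bind> (\<lambda>r. iid_pairs (emp r))"
  have mD: "(\<lambda>r. iid_pairs (emp r)) \<in> ?D \<rightarrow>\<^sub>M subprob_algebra pair_sequences"
    using measurable_prob_algebraD[OF iid_emp_measurable] by simp
  have neD: "space ?D \<noteq> {}" using not_empty by simp
  have mind: "(\<lambda>r. indicator C (\<lambda>n. w n r) :: real) \<in> borel_measurable P" if "C \<in> sets pair_sequences" for C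
    by (rule measurable_compose[OF w_measurable borel_measurable_indicator[OF that]])
  have e1: "emeasure N1 C = ennreal (expectation (\<lambda>r. indicator C (\<lambda>n. w n r) * G r))"
    if C: "C \<in> sets pair_sequences" for C
  proof -
    have "emeasure N1 C = emeasure ?D ((\<lambda>r n. w n r) -` C \<inter> space P)"
      unfolding N1_def using C by (subst emeasure_distr) auto
    also have "\<dots> = (\<integral>\<^sup>+r. ennreal (G r) * indicator ((\<lambda>r n. w n r) -` C \<inter> space P) r \<partial>P)"
      using measurable_sets[OF w_measurable C] by (subst emeasure_density) auto
    also have "\<dots> = (\<integral>\<^sup>+r. ennreal (indicator C (\<lambda>n. w n r) * G r) \<partial>P)"
      by (rule nn_integral_cong) (auto simp: indicator_def)
    also have "\<dots> = ennreal (expectation (\<lambda>r. indicator C (\<lambda>n. w n r) * G r))"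
      using mind[OF C] G01 by (intro nn_integral_eq_integral integrable_bounded_real[where B = 1])
        (auto simp: indicator_def)
    finally show ?thesis .
  qed
  have e2: "emeasure N2 C = ennreal (expectation (\<lambda>r. measure (iid_pairs (emp r)) C * G r))"
    if C: "C \<in> sets pair_sequences" for C
  proof -
    note [measurable] = measure_iid_emp_measurable[OF C]
    have "emeasure N2 C = (\<integral>\<^sup>+r. emeasure (iid_pairs (emp r)) C \<partial>?D)"
      unfolding N2_def by (rule emeasure_bind[OF neD mD C])
    also have "\<dots> = (\<integral>\<^sup>+r. ennreal (measure (iid_pairs (emp r)) C) \<partial>?D)"
    proof (rule nn_integral_cong)
      fix r
      interpret Q: prob_space "iid_pairs (emp r)" by (rule prob_space_iid_pairs[OF real_distribution_emp])
      show "emeasure (iid_pairs (emp r)) C = ennreal (measure (iid_pairs (emp r)) C)" by (rule Q.emeasure_eq_measure)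
    qed
    also have "\<dots> = (\<integral>\<^sup>+r. ennreal (G r) * ennreal (measure (iid_pairs (emp r)) C) \<partial>P)"
      by (rule nn_integral_density) simp_all
    also have "\<dots> = (\<integral>\<^sup>+r. ennreal (measure (iid_pairs (emp r)) C * G r) \<partial>P)"
      using G01 by (intro nn_integral_cong) (simp add: ennreal_mult'[symmetric] mult.commute)
    also have "\<dots> = ennreal (expectation (\<lambda>r. measure (iid_pairs (emp r)) C * G r))"
      using measure_iid_emp_le G01
      by (intro nn_integral_eq_integral integrable_bounded_real[where B = 1] AE_I2 mult_nonneg_nonneg abs_mult_le_one) auto
    finally show ?thesis .
  qed
  have "N1 = N2"
  proof (rule measure_eqI_PiM_atMost)
    show "sets N1 = sets pair_sequences" by (simp add: N1_def)
    show "sets N2 = sets pair_sequences" unfolding N2_def by (rule sets_bind[OF _ neD]) simp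
    have "UNIV \<in> sets pair_sequences" using sets.top[of pair_sequences] by (simp add: space_PiM)
    from e1[OF this] show "emeasure N1 UNIV \<noteq> \<infinity>" by simp
    fix I :: "int set" and a :: "int \<Rightarrow> real \<times> real" assume I: "finite I"
    let ?C = "{z. \<forall>j\<in>I. z j \<le> a j}"
    have C: "?C \<in> sets pair_sequences"
      unfolding sets_PiM_atMost using I by (intro sigma_sets.Basic lower_cylindersI)
    have ind: "indicator ?C (\<lambda>n. w n r) = (\<Prod>j\<in>I. indicator {..a j} (w j r) :: real)" for r
      using I by (auto simp: indicator_def prod_eq_1_iff intro!: prod_zero)
    have eq: "equivariant (\<lambda>n r. indicator {..a j} (w n r) :: real)" for j
      by (rule equivariant_comp[OF equivariant_w]) simp
    have "expectation (\<lambda>r. indicator ?C (\<lambda>n. w n r) * G r) =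
       expectation (\<lambda>r. (\<Prod>j\<in>I. mean (\<lambda>n r. indicator {..a j} (w n r)) r) * G r)"
      unfolding ind by (rule expectation_prod[OF I, where g = "\<lambda>j. j"]) (use eq iG G01 in \<open>auto simp: indicator_def\<close>)
    also have "\<dots> = expectation (\<lambda>r. measure (iid_pairs (emp r)) ?C * G r)"
    proof (rule integral_cong_AE)
      have "AE r in P. \<forall>j\<in>I. mean (\<lambda>n r. indicator {..a j} (w n r)) r = measure (conjugate_kernel (emp r)) {..a j}"
        using I AE_mean_w by (intro AE_finite_allI) auto
      then show "AE r in P. (\<Prod>j\<in>I. mean (\<lambda>n r. indicator {..a j} (w n r)) r) * G r = measure (iid_pairs (emp r)) ?C * G r"
      proof eventually_elim
        case (elim r)
        interpret K: prob_space "conjugate_kernel (emp r)" by (rule prob_space_conjugate_kernel[OF real_distribution_emp])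
        interpret Q: prob_space "iid_pairs (emp r)" by (rule prob_space_iid_pairs[OF real_distribution_emp])
        have "ennreal (measure (iid_pairs (emp r)) ?C) = ennreal (\<Prod>j\<in>I. measure (conjugate_kernel (emp r)) {..a j})"
          using emeasure_iid_pairs[OF real_distribution_emp I, of r a]
          by (simp add: Q.emeasure_eq_measure K.emeasure_eq_measure prod_ennreal)
        then have "measure (iid_pairs (emp r)) ?C = (\<Prod>j\<in>I. measure (conjugate_kernel (emp r)) {..a j})"
          by (subst (asm) ennreal_inj) (auto intro: prod_nonneg)
        moreover have "(\<Prod>j\<in>I. mean (\<lambda>n r. indicator {..a j} (w n r)) r) = (\<Prod>j\<in>I. measure (conjugate_kernel (emp r)) {..a j})"
          by (rule prod.cong[OF refl]) (use elim in blast)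
        ultimately show ?case by simp
      qed
      show "(\<lambda>r. (\<Prod>j\<in>I. mean (\<lambda>n r. indicator {..a j} (w n r)) r) * G r) \<in> borel_measurable P"
        using mean_measurable[OF eq] by (intro borel_measurable_times borel_measurable_prod) auto
      show "(\<lambda>r. measure (iid_pairs (emp r)) ?C * G r) \<in> borel_measurable P"
        using measure_iid_emp_measurable[OF C] by (intro borel_measurable_times) auto
    qed
    finally show "emeasure N1 ?C = emeasure N2 ?C" unfolding e1[OF C] e2[OF C] by simp
  qed
  then have "ennreal (expectation (\<lambda>r. indicator A (\<lambda>n. w n r) * G r)) = ennreal (expectation (\<lambda>r. measure (iid_pairs (emp r)) A * G r))"
    by (simp only: e1[OF A, symmetric] e2[OF A, symmetric])
  moreover have "0 \<le> expectation (\<lambda>r. indicator A (\<lambda>n. w n r) * G r)" "0 \<le> expectation (\<lambda>r. measure (iid_pairs (emp r)) A * G r)"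
    using G01 by (auto intro!: integral_nonneg_AE)
  ultimately show ?thesis unfolding G_def by (subst (asm) ennreal_inj)
qed

lemma AE_order_of_w: "AE r in P. order_of (\<lambda>n. w n r) = r"
  using AE_order_rule AE_space
proof eventually_elim
  case (elim r)
  have slo: "strict_linear_order r" using elim(2) by (simp add: space_P)
  then have r: "(n, n) \<notin> r" "m \<noteq> n \<Longrightarrow> (m, n) \<in> r \<longleftrightarrow> (n, m) \<notin> r" for m n
    by (auto simp: strict_linear_order_on_def trans_def irrefl_def total_on_def)
  have "(m, n) \<in> pairs_rel (\<lambda>n. w n r) \<longleftrightarrow> (m, n) \<in> r" for m n
  proof (cases m n rule: linorder_cases)
    case less
    then show ?thesis using elim(1)[rule_format, OF less] by (simp add: pairs_rel_def w_def)
  next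
    case equal
    then show ?thesis using r(1)[of n] by (simp add: pairs_rel_def)
  next
    case greater
    then show ?thesis using elim(1)[rule_format, OF greater] r(2)[of m n] by (simp add: pairs_rel_def w_def)
  qed
  then have "pairs_rel (\<lambda>n. w n r) = r" by auto
  then show ?case using slo by (simp add: order_of_def)
qed

lemma conditional_ordering_law:
  assumes A: "A \<in> sets order_space" and B: "B \<in> sets (prob_algebra borel)"
  shows "expectation (\<lambda>r. indicator A r * indicator B (emp r)) =
    expectation (\<lambda>r. measure (iid_pairs (emp r)) (order_of -` A \<inter> space pair_sequences) * indicator B (emp r))"
proof -
  let ?A = "order_of -` A \<inter> space pair_sequences"
  have mA: "?A \<in> sets pair_sequences" by (rule measurable_sets[OF order_of_measurable A])
  have mB: "(\<lambda>r. indicator B (emp r) :: real) \<in> borel_measurable P"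
    by (rule measurable_compose[OF emp_measurable borel_measurable_indicator[OF B]])
  have "expectation (\<lambda>r. indicator A r * indicator B (emp r) :: real) = expectation (\<lambda>r. indicator ?A (\<lambda>n. w n r) * indicator B (emp r))"
  proof (rule integral_cong_AE)
    show "AE r in P. indicator A r * indicator B (emp r) = (indicator ?A (\<lambda>n. w n r) * indicator B (emp r) :: real)"
      using AE_order_of_w by eventually_elim (simp add: indicator_def space_PiM)
    show "(\<lambda>r. indicator A r * indicator B (emp r) :: real) \<in> borel_measurable P"
      using mB A sets_P by (intro borel_measurable_times borel_measurable_indicator) auto
    show "(\<lambda>r. indicator ?A (\<lambda>n. w n r) * indicator B (emp r) :: real) \<in> borel_measurable P"
      by (intro borel_measurable_times mB measurable_compose[OF w_measurable borel_measurable_indicator[OF mA]])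
  qed
  also have "\<dots> = expectation (\<lambda>r. measure (iid_pairs (emp r)) ?A * indicator B (emp r))"
    by (rule conditionally_iid_pairs[OF mA B])
  finally show ?thesis .
qed

lemma exchangeable_X: "inj g \<Longrightarrow> distr P (\<Pi>\<^sub>M n\<in>UNIV. borel) (\<lambda>r n. X (g n) r) = distr P (\<Pi>\<^sub>M n\<in>UNIV. borel) (\<lambda>r n. X n r)"
proof -
  assume g: "inj g"
  let ?PI = "\<Pi>\<^sub>M n\<in>(UNIV::int set). (borel :: real measure)"
  have m: "(\<lambda>r n. X (h n) r) \<in> P \<rightarrow>\<^sub>M ?PI" for h :: "int \<Rightarrow> int" by (rule measurable_PiM_single') auto
  show "distr P ?PI (\<lambda>r n. X (g n) r) = distr P ?PI (\<lambda>r n. X n r)"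
  proof (rule measure_eqI)
    fix A assume "A \<in> sets (distr P ?PI (\<lambda>r n. X (g n) r))"
    then have A: "A \<in> sets ?PI" by simp
    have e: "emeasure (distr P ?PI (\<lambda>r n. X (h n) r)) A = ennreal (expectation (\<lambda>r. indicator A (\<lambda>n. X (h n) r) * 1))" for h
    proof -
      interpret D: prob_space "distr P ?PI (\<lambda>r n. X (h n) r)" by (rule prob_space_distr[OF m])
      have "measure (distr P ?PI (\<lambda>r n. X (h n) r)) A = (\<integral>z. indicator A z \<partial>distr P ?PI (\<lambda>r n. X (h n) r))"
        using A by simp
      also have "\<dots> = expectation (\<lambda>r. indicator A (\<lambda>n. X (h n) r))"
        by (rule integral_distr[OF m]) (use A in simp)
      finally show ?thesis by (simp add: D.emeasure_eq_measure)
    qed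
    have "expectation (\<lambda>r. indicator A (\<lambda>n. X (g n) r) * 1) = expectation (\<lambda>r. indicator A (\<lambda>n. X n r) * (1::real))"
      by (rule exchangeable_under_injection[OF equivariant_X _ _ _ g A]) (auto simp: invariant_def)
    then show "emeasure (distr P ?PI (\<lambda>r n. X (g n) r)) A = emeasure (distr P ?PI (\<lambda>r n. X n r)) A"
      using e[of g] e[of "\<lambda>n. n"] by simp
  qed simp
qed

end

section \<open>Transfer from the law of the ordering to an arbitrary probability space\<close>

theorem theorem3p4:
  fixes M :: "'a measure" and D :: "'a \<Rightarrow> int rel"
  assumes "prob_space M"
    and "D \<in> measurable M order_space"
    and "I_invariant (distr M order_space D)"
  shows "let X = (\<lambda>\<omega> n. lim (left_average (D \<omega>) n));
             Y = (\<lambda>\<omega> n. lim (right_average (D \<omega>) n));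
             \<mu>X = (\<lambda>\<omega>. empirical_distribution (X \<omega>))
         in
           (AE \<omega> in M.
              (\<forall>n. convergent (left_average (D \<omega>) n) \<and> convergent (right_average (D \<omega>) n)) \<and>
              (\<forall>m n. m < n \<longrightarrow>
                 ((m, n) \<in> D \<omega> \<longleftrightarrow>
                    X \<omega> m < X \<omega> n \<or> Y \<omega> m < Y \<omega> n \<or>
                    (X \<omega> m = X \<omega> n \<and> Y \<omega> m = Y \<omega> n \<and> X \<omega> m > Y \<omega> m)))) \<and>
           exchangeable M X \<and>
           (AE \<omega> in M. has_empirical_distribution (X \<omega>) (\<mu>X \<omega>) \<and> quasi_uniform (\<mu>X \<omega>)) \<and>
           (\<forall>A\<in>sets order_space. AE \<omega> in M.
              real_cond_exp M (vimage_algebra (space M) \<mu>X (prob_algebra borel))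
                (\<lambda>\<omega>. indicator A (D \<omega>)) \<omega> = measure (ordering_law (\<mu>X \<omega>)) A)"
proof -
  interpret M: prob_space M by fact
  note D = assms(2)
  define P where "P = distr M order_space D"
  interpret spreadable_order P
    unfolding spreadable_order_def spreadable_order_axioms_def P_def
    using M.prob_space_distr[OF D] assms(3) by simp
  have DP: "D \<in> measurable M P" using D by (simp add: P_def)
  have AE_M: "AE \<omega> in M. Q (D \<omega>)" if "AE r in P. Q r" for Q
    by (rule AE_distrD[OF D], unfold P_def[symmetric], rule that)
  have int_M: "(\<integral>\<omega>. f (D \<omega>) \<partial>M) = expectation f" if "f \<in> borel_measurable P" for f :: "int rel \<Rightarrow> real"
    unfolding P_def by (rule integral_distr[OF D, symmetric]) (use that in \<open>simp add: P_def\<close>)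
  have Xl: "lim (left_average r n) = X n r" and Yl: "lim (right_average r n) = Y n r" for r n
    by (simp_all add: X_def Y_def)
  have empX: "empirical_distribution (\<lambda>n. X n r) = emp r" for r by (simp add: emp_def)
  have part1: "AE \<omega> in M. (\<forall>n. convergent (left_average (D \<omega>) n) \<and> convergent (right_average (D \<omega>) n)) \<and>
      (\<forall>m n. m < n \<longrightarrow> ((m, n) \<in> D \<omega> \<longleftrightarrow> X m (D \<omega>) < X n (D \<omega>) \<or> Y m (D \<omega>) < Y n (D \<omega>) \<or>
         (X m (D \<omega>) = X n (D \<omega>) \<and> Y m (D \<omega>) = Y n (D \<omega>) \<and> X m (D \<omega>) > Y m (D \<omega>))))"
    using AE_M[OF AE_averages] AE_M[OF AE_order_rule]
    by eventually_elim (auto simp: earlier_below_def convergent_def)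
  have part2: "exchangeable M (\<lambda>\<omega> n. X n (D \<omega>))"
    unfolding exchangeable_def
  proof (intro conjI allI impI)
    show "(\<lambda>\<omega>. X n (D \<omega>)) \<in> borel_measurable M" for n by (rule measurable_compose[OF DP X_measurable])
    fix \<pi> :: "int \<Rightarrow> int" assume "bij \<pi> \<and> finite {n. \<pi> n \<noteq> n}"
    then have "inj \<pi>" by (auto simp: bij_def)
    let ?PI = "\<Pi>\<^sub>M n\<in>(UNIV::int set). (borel :: real measure)"
    have "distr M ?PI (\<lambda>\<omega> n. X (h n) (D \<omega>)) = distr P ?PI (\<lambda>r n. X (h n) r)" for h :: "int \<Rightarrow> int"
    proof -
      have "(\<lambda>r n. X (h n) r) \<in> order_space \<rightarrow>\<^sub>M ?PI"
        using measurable_PiM_single'[of UNIV "\<lambda>n. X (h n)" P "\<lambda>_. borel"] X_measurable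
        by (simp add: measurable_cong_sets[OF sets_P refl])
      from distr_distr[OF this D] show ?thesis by (simp add: P_def o_def)
    qed
    then show "distr M ?PI (\<lambda>\<omega> n. X (\<pi> n) (D \<omega>)) = distr M ?PI (\<lambda>\<omega> n. X n (D \<omega>))"
      using exchangeable_X[OF \<open>inj \<pi>\<close>] by simp
  qed
  have part3: "AE \<omega> in M. has_empirical_distribution (\<lambda>n. X n (D \<omega>)) (emp (D \<omega>)) \<and> quasi_uniform (emp (D \<omega>))"
    using AE_M[OF AE_emp] by eventually_elim simp
  have part4: "AE \<omega> in M. real_cond_exp M (vimage_algebra (space M) (\<lambda>\<omega>. emp (D \<omega>)) (prob_algebra borel))
                (\<lambda>\<omega>. indicator A (D \<omega>)) \<omega> = measure (ordering_law (emp (D \<omega>))) A"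
    if A: "A \<in> sets order_space" for A
  proof -
    let ?F = "vimage_algebra (space M) (\<lambda>\<omega>. emp (D \<omega>)) (prob_algebra (borel :: real measure))"
    let ?A = "order_of -` A \<inter> space pair_sequences"
    \<comment> \<open>The version of the conditional probability is built from
      \<open>iid_pairs\<close>, whose measurability is known. It agrees with
      \<open>ordering_law\<close> only where \<open>emp\<close> has a decomposition, that is, almost
      surely.\<close>
    define g where "g \<omega> = measure (iid_pairs (emp (D \<omega>))) ?A" for \<omega>
    have mA: "?A \<in> sets pair_sequences" by (rule measurable_sets[OF order_of_measurable A])
    have me: "(\<lambda>\<omega>. emp (D \<omega>)) \<in> M \<rightarrow>\<^sub>M prob_algebra borel" by (rule measurable_compose[OF DP emp_measurable])
    have meF: "(\<lambda>\<omega>. emp (D \<omega>)) \<in> ?F \<rightarrow>\<^sub>M prob_algebra borel"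
      by (rule measurable_vimage_algebra1) (use measurable_space[OF me] in auto)
    have sub: "subalgebra M ?F"
      unfolding subalgebra_def
      by (auto simp: sets_vimage_algebra2[OF funcsetI[OF measurable_space[OF me]]] intro!: measurable_sets[OF me])
    interpret finite_measure_subalgebra M ?F by unfold_locales (rule sub)
    have gF: "g \<in> borel_measurable ?F"
      unfolding g_def
      by (rule measurable_compose[OF measurable_compose[OF meF iid_pairs_measurable] measurable_measure_prob_algebra[OF mA]])
    have gM: "g \<in> borel_measurable M" by (rule measurable_from_subalg[OF sub gF])
    have iM: "(\<lambda>\<omega>. indicator A (D \<omega>) :: real) \<in> borel_measurable M"
      by (rule measurable_compose[OF D borel_measurable_indicator[OF A]])
    have "AE \<omega> in M. real_cond_exp M ?F (\<lambda>\<omega>. indicator A (D \<omega>)) \<omega> = g \<omega>"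
    \<comment> \<open>Every set of the generated sigma-algebra is the preimage of some
      \<open>B\<close> under the empirical distribution, so the defining identity is
      \<open>conditional_ordering_law\<close> transported to \<open>M\<close>.\<close>
    proof (rule real_cond_exp_charact)
      fix C assume "C \<in> sets ?F"
      then obtain B where B: "B \<in> sets (prob_algebra borel)" "C = (\<lambda>\<omega>. emp (D \<omega>)) -` B \<inter> space M"
        by (auto simp: sets_vimage_algebra2[OF funcsetI[OF measurable_space[OF me]]])
      have mB: "(\<lambda>r. indicator B (emp r) :: real) \<in> borel_measurable P"
        by (rule measurable_compose[OF emp_measurable borel_measurable_indicator[OF B(1)]])
      have "(\<integral>\<omega>\<in>C. (indicator A (D \<omega>) :: real) \<partial>M) = (\<integral>\<omega>. indicator A (D \<omega>) * indicator B (emp (D \<omega>)) \<partial>M)"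
        unfolding set_lebesgue_integral_def
        by (rule Bochner_Integration.integral_cong) (auto simp: B indicator_def)
      also have "\<dots> = expectation (\<lambda>r. indicator A r * indicator B (emp r) :: real)"
        by (rule int_M, intro borel_measurable_times mB borel_measurable_indicator) (use A sets_P in simp)
      also have "\<dots> = expectation (\<lambda>r. measure (iid_pairs (emp r)) ?A * indicator B (emp r))"
        by (rule conditional_ordering_law[OF A B(1)])
      also have "\<dots> = (\<integral>\<omega>. g \<omega> * indicator B (emp (D \<omega>)) \<partial>M)"
        unfolding g_def by (rule int_M[symmetric], intro borel_measurable_times mB measure_iid_emp_measurable mA)
      also have "\<dots> = (\<integral>\<omega>\<in>C. g \<omega> \<partial>M)"
        unfolding set_lebesgue_integral_def
        by (rule Bochner_Integration.integral_cong) (auto simp: B indicator_def)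
      finally show "(\<integral>\<omega>\<in>C. indicator A (D \<omega>) \<partial>M) = (\<integral>\<omega>\<in>C. g \<omega> \<partial>M)" .
    next
      show "integrable M (\<lambda>\<omega>. indicator A (D \<omega>) :: real)"
        by (rule M.integrable_const_bound[where B = 1]) (use iM in \<open>auto simp: indicator_def\<close>)
      show "integrable M g"
        by (rule M.integrable_const_bound[where B = 1]) (use gM measure_iid_emp_le in \<open>auto simp: g_def\<close>)
    qed (rule gF)
    then show ?thesis using AE_M[OF AE_emp]
    proof eventually_elim
      case (elim \<omega>)
      then obtain F x where "decomposition (emp (D \<omega>)) F x" by blast
      from ordering_law_eq[OF this A] elim(1) show ?case by (simp add: g_def)
    qed
  qed
  show ?thesis
    unfolding Let_def Xl Yl empX using part1 part2 part3 part4 by blast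
qed

end
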